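(* Let $\mathbf{Sh}\to\mathbf{Sp}$ be a geofibered category. (1) For any SGFs $F$ and $G$, there exists at most one $\phi\colon F\to G$ in $\langle\mathsf{comp},\mathsf{triv}\rangle$. (2) Let $G=a_*b^*$; then for any SGF $F$, there exists at most one $\phi\colon F\to G$ in $\mathsf{SGNT}_0$.
   Context: **Geofibered category.** A functor $\mathbf{Sh}\to\mathbf{Sp}$ (objects: "shapes", "spaces"; $\mathbf{Sh}_X$ is the fiber over $X$) such that $\mathbf{Sp}$ has all finite fibered products; each $f\colon X\to Y$ in $\mathbf{Sp}$ has an adjoint pair $f^*\colon\mathbf{Sh}_Y\to\mathbf{Sh}_X$ (left adjoint), $f_*\colon\mathbf{Sh}_X\to\mathbf{Sh}_Y$, with unit $\mathsf{unit}(f)\colon\mathrm{id}\to f_*f^*$ and counit $\mathsf{counit}(f)\colon f^*f_*\to\mathrm{id}$; and $f\mapsto f^*$, $f\mapsto f_*$ are pseudofunctors (contravariant, covariant), with structure isomorphisms $\mathsf{comp}^*(f,g)\colon f^*g^*\to(gf)^*$, $\mathsf{comp}_*(f,g)\colon g_*f_*\to(gf)_*$, $\mathsf{triv}^*\colon\mathrm{id}^*\to\mathrm{id}$, $\mathsf{triv}_*\colon\mathrm{id}_*\to\mathrm{id}$ satisfying associativity for triple compositions and unitality ($\mathsf{comp}_*(f,\mathrm{id})=\mathsf{triv}_*f_*$, $\mathsf{comp}_*(\mathrm{id},f)=f_*\mathsf{triv}_*$, similarly for $^*$). The structures correspond under adjunction: the bijection $\mathrm{Hom}((gf)^*A,B)\cong\mathrm{Hom}(A,(gf)_*B)\cong\mathrm{Hom}(A,g_*f_*B)\cong\mathrm{Hom}(g^*A,f_*B)\cong\mathrm{Hom}(f^*g^*A,B)$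 is precomposition with $\mathsf{comp}^*(f,g)_A$, and $\mathrm{Hom}(\mathrm{id}^*A,B)\cong\mathrm{Hom}(A,\mathrm{id}_*B)\cong\mathrm{Hom}(A,B)$ is the one induced by $\mathsf{triv}^*_A$. **SGFs and classes of transformations.** A basic SGF (standard geometric functor) is some $f_*$ or $f^*$. An SGF is a composition of basic SGFs, with the terms of the composition remembered (the empty composition $\mathrm{id}$ is allowed). For a class $S$ of natural transformations between SGFs, $\langle S\rangle$ is the class generated by $S$ under composition (including identities). With $F,G$ ranging over SGFs and $f,g$ over maps of spaces (composites being defined): $\mathsf{comp}_0=\{F\,\mathsf{comp}_*(f,g)\,G\}\cup\{F\,\mathsf{comp}^*(f,g)\,G\}$; $\mathsf{comp}=\mathsf{comp}_0\cup\mathsf{comp}_0^{-1}$; $\mathsf{triv}_0=\{F\,\mathsf{triv}_*\,G\}\cup\{F\,\mathsf{triv}^*\,G\}$; $\mathsf{triv}=\mathsf{triv}_0\cup\mathsf{triv}_0^{-1}$. For a cartesian square $f\tilde g=g\tilde f$ (with $\tilde f$ the base change of $f$ along $g$ and $\tilde g$ that of $g$ along $f$), $\mathsf{bc}(f,g)\colon g^*f_*\to\tilde f_*\tilde g^*$ is the composite $g^*f_*\to g^*f_*\tilde g_*\tilde g^*\to g^*(f\tilde g)_*\tilde g^*=g^*(g\tilde f)_*\tilde g^*\to g^*g_*\tilde f_*\tilde g^*\to\tilde f_*\tilde g^*$ of $\mathsf{unit}(\tilde g)$, $\mathsf{comp}_*(\tilde g,f)$, $\mathsf{comp}_*(\tilde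 f,g)^{-1}$, $\mathsf{counit}(g)$; $\mathsf{bc}=\{F\,\mathsf{bc}(f,g)\,G\}$. $\mathsf{SGNT}_0^+=\langle\mathsf{bc},\mathsf{comp}_0,\mathsf{triv}_0\rangle$ and $\mathsf{SGNT}_0=\langle\mathsf{SGNT}_0^+\cup(\mathsf{SGNT}_0^+)^{-1}\rangle$, where $(\mathsf{SGNT}_0^+)^{-1}$ is the class of inverses of those elements of $\mathsf{SGNT}_0^+$ that are natural isomorphisms. Fibered products are regarded as determined (up to unique isomorphism) by their universal property.
   Formalization: In (2), "at most one" fails literally if bc uses all cartesian squares and (a,b) has automorphisms; it is proved literally for strictly determined fibered products, and in general up to the canonical change of fibered product by an automorphism k with ak=a, bk=b. *)

theory Defs
  imports Main
begin

section \<open>Categories, functors, natural transformations\<close>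

record ('o, 'm) category =
  Obj :: "'o set"
  Arr :: "'m set"
  Dom :: "'m \<Rightarrow> 'o"
  Cod :: "'m \<Rightarrow> 'o"
  Ide :: "'o \<Rightarrow> 'm"
  Cmp :: "'m \<Rightarrow> 'm \<Rightarrow> 'm"  (infixr "\<cdot>\<index>" 70)

definition Hom :: "('o, 'm) category \<Rightarrow> 'o \<Rightarrow> 'o \<Rightarrow> 'm set" where
  "Hom C A B = {h \<in> Arr C. Dom C h = A \<and> Cod C h = B}"

definition is_category :: "('o, 'm) category \<Rightarrow> bool" where
  "is_category C \<longleftrightarrow>
     (\<forall>h\<in>Arr C. Dom C h \<in> Obj C \<and> Cod C h \<in> Obj C) \<and>
     (\<forall>A\<in>Obj C. Ide C A \<in> Hom C A A) \<and>
     (\<forall>h\<in>Arr C. \<forall>k\<in>Arr C. Cod C h = Dom C k \<longrightarrow> k \<cdot>\<^bsub>C\<^esub> h \<in> Hom C (Dom C h) (Cod C k)) \<and>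
     (\<forall>h\<in>Arr C. h \<cdot>\<^bsub>C\<^esub> Ide C (Dom C h) = h \<and> Ide C (Cod C h) \<cdot>\<^bsub>C\<^esub> h = h) \<and>
     (\<forall>h\<in>Arr C. \<forall>k\<in>Arr C. \<forall>l\<in>Arr C. Cod C h = Dom C k \<longrightarrow> Cod C k = Dom C l \<longrightarrow>
        l \<cdot>\<^bsub>C\<^esub> (k \<cdot>\<^bsub>C\<^esub> h) = (l \<cdot>\<^bsub>C\<^esub> k) \<cdot>\<^bsub>C\<^esub> h)"

definition inverse_arrows :: "('o, 'm) category \<Rightarrow> 'm \<Rightarrow> 'm \<Rightarrow> bool" where
  "inverse_arrows C h k \<longleftrightarrow>
     h \<in> Arr C \<and> k \<in> Hom C (Cod C h) (Dom C h) \<and>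
     k \<cdot>\<^bsub>C\<^esub> h = Ide C (Dom C h) \<and> h \<cdot>\<^bsub>C\<^esub> k = Ide C (Cod C h)"

definition is_iso :: "('o, 'm) category \<Rightarrow> 'm \<Rightarrow> bool" where
  "is_iso C h \<longleftrightarrow> (\<exists>k. inverse_arrows C h k)"

definition inv_arr :: "('o, 'm) category \<Rightarrow> 'm \<Rightarrow> 'm" where
  "inv_arr C h = (THE k. inverse_arrows C h k)"

record ('o, 'm, 'p, 'n) fctr =
  onO :: "'o \<Rightarrow> 'p"
  onA :: "'m \<Rightarrow> 'n"

definition is_functor ::
    "('o, 'm) category \<Rightarrow> ('p, 'n) category \<Rightarrow> ('o, 'm, 'p, 'n) fctr \<Rightarrow> bool" where
  "is_functor C D F \<longleftrightarrow>
     is_category C \<and> is_category D \<and>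
     (\<forall>A\<in>Obj C. onO F A \<in> Obj D) \<and>
     (\<forall>h\<in>Arr C. onA F h \<in> Hom D (onO F (Dom C h)) (onO F (Cod C h))) \<and>
     (\<forall>A\<in>Obj C. onA F (Ide C A) = Ide D (onO F A)) \<and>
     (\<forall>h\<in>Arr C. \<forall>k\<in>Arr C. Cod C h = Dom C k \<longrightarrow>
        onA F (k \<cdot>\<^bsub>C\<^esub> h) = onA F k \<cdot>\<^bsub>D\<^esub> onA F h)"

definition id_fctr :: "('o, 'm, 'o, 'm) fctr" where
  "id_fctr = \<lparr>onO = (\<lambda>A. A), onA = (\<lambda>h. h)\<rparr>"

definition cmp_fctr ::
    "('p, 'n, 'q, 'r) fctr \<Rightarrow> ('o, 'm, 'p, 'n) fctr \<Rightarrow> ('o, 'm, 'q, 'r) fctr"  (infixr "\<circ>\<^sub>F" 70) where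
  "G \<circ>\<^sub>F F = \<lparr>onO = onO G \<circ> onO F, onA = onA G \<circ> onA F\<rparr>"

text \<open>A natural transformation is given by its components; their values at arguments outside
  \<^term>\<open>Obj C\<close> are irrelevant, so natural transformations are compared by \<open>nt_eq\<close> below.\<close>

definition is_nat_trans ::
    "('o, 'm) category \<Rightarrow> ('p, 'n) category \<Rightarrow> ('o, 'm, 'p, 'n) fctr \<Rightarrow> ('o, 'm, 'p, 'n) fctr
      \<Rightarrow> ('o \<Rightarrow> 'n) \<Rightarrow> bool" where
  "is_nat_trans C D F G \<phi> \<longleftrightarrow>
     is_functor C D F \<and> is_functor C D G \<and>
     (\<forall>A\<in>Obj C. \<phi> A \<in> Hom D (onO F A) (onO G A)) \<and>
     (\<forall>h\<in>Arr C. onA G h \<cdot>\<^bsub>D\<^esub> \<phi> (Dom C h) = \<phi> (Cod C h) \<cdot>\<^bsub>D\<^esub> onA F h)"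

definition nt_eq :: "('o, 'm) category \<Rightarrow> ('o \<Rightarrow> 'n) \<Rightarrow> ('o \<Rightarrow> 'n) \<Rightarrow> bool" where
  "nt_eq C \<phi> \<psi> \<longleftrightarrow> (\<forall>A\<in>Obj C. \<phi> A = \<psi> A)"

definition inverse_nats ::
    "('o, 'm) category \<Rightarrow> ('p, 'n) category \<Rightarrow> ('o, 'm, 'p, 'n) fctr \<Rightarrow> ('o, 'm, 'p, 'n) fctr
      \<Rightarrow> ('o \<Rightarrow> 'n) \<Rightarrow> ('o \<Rightarrow> 'n) \<Rightarrow> bool" where
  "inverse_nats C D F G \<phi> \<psi> \<longleftrightarrow>
     is_nat_trans C D F G \<phi> \<and> is_nat_trans C D G F \<psi> \<and>
     (\<forall>A\<in>Obj C. \<psi> A \<cdot>\<^bsub>D\<^esub> \<phi> A = Ide D (onO F A) \<and> \<phi> A \<cdot>\<^bsub>D\<^esub> \<psi> A = Ide D (onO G A))"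

definition is_nat_iso ::
    "('o, 'm) category \<Rightarrow> ('p, 'n) category \<Rightarrow> ('o, 'm, 'p, 'n) fctr \<Rightarrow> ('o, 'm, 'p, 'n) fctr
      \<Rightarrow> ('o \<Rightarrow> 'n) \<Rightarrow> bool" where
  "is_nat_iso C D F G \<phi> \<longleftrightarrow> (\<exists>\<psi>. inverse_nats C D F G \<phi> \<psi>)"

definition is_adjunction ::
    "('o, 'm) category \<Rightarrow> ('p, 'n) category \<Rightarrow> ('o, 'm, 'p, 'n) fctr \<Rightarrow> ('p, 'n, 'o, 'm) fctr
      \<Rightarrow> ('o \<Rightarrow> 'm) \<Rightarrow> ('p \<Rightarrow> 'n) \<Rightarrow> bool" where
  "is_adjunction C D L R \<eta> \<epsilon> \<longleftrightarrow>
     is_nat_trans C C id_fctr (R \<circ>\<^sub>F L) \<eta> \<and>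
     is_nat_trans D D (L \<circ>\<^sub>F R) id_fctr \<epsilon> \<and>
     (\<forall>A\<in>Obj C. \<epsilon> (onO L A) \<cdot>\<^bsub>D\<^esub> onA L (\<eta> A) = Ide D (onO L A)) \<and>
     (\<forall>B\<in>Obj D. onA R (\<epsilon> B) \<cdot>\<^bsub>C\<^esub> \<eta> (onO R B) = Ide C (onO R B))"

section \<open>Fibered products\<close>

text \<open>\<open>cartesian C f g f' g'\<close>: the square \<open>f \<cdot> g' = g \<cdot> f'\<close> is cartesian, where \<open>f'\<close> is the base
  change of \<open>f\<close> along \<open>g\<close> and \<open>g'\<close> that of \<open>g\<close> along \<open>f\<close>.\<close>

definition cartesian :: "('o, 'm) category \<Rightarrow> 'm \<Rightarrow> 'm \<Rightarrow> 'm \<Rightarrow> 'm \<Rightarrow> bool" where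
  "cartesian C f g f' g' \<longleftrightarrow>
     f \<in> Arr C \<and> g \<in> Arr C \<and> f' \<in> Arr C \<and> g' \<in> Arr C \<and>
     Cod C f = Cod C g \<and> Dom C f' = Dom C g' \<and> Cod C f' = Dom C g \<and> Cod C g' = Dom C f \<and>
     f \<cdot>\<^bsub>C\<^esub> g' = g \<cdot>\<^bsub>C\<^esub> f' \<and>
     (\<forall>u\<in>Arr C. \<forall>v\<in>Arr C.
        Dom C u = Dom C v \<and> Cod C u = Dom C f \<and> Cod C v = Dom C g \<and> f \<cdot>\<^bsub>C\<^esub> u = g \<cdot>\<^bsub>C\<^esub> v \<longrightarrow>
        (\<exists>!h. h \<in> Hom C (Dom C u) (Dom C f') \<and> g' \<cdot>\<^bsub>C\<^esub> h = u \<and> f' \<cdot>\<^bsub>C\<^esub> h = v))"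

definition has_fibered_products :: "('o, 'm) category \<Rightarrow> bool" where
  "has_fibered_products C \<longleftrightarrow>
     (\<forall>f\<in>Arr C. \<forall>g\<in>Arr C. Cod C f = Cod C g \<longrightarrow> (\<exists>f' g'. cartesian C f g f' g'))"

text \<open>The convention that fibered products are determined: every cospan has exactly one
  distinguished cartesian square, and the canonical isomorphisms between fibered products
  (base change along or of an identity, and iterated base change) are identities.  This matters:
  if \<open>i\<close> is an automorphism with \<open>a \<cdot> i = a\<close> and \<open>b \<cdot> i = b\<close>, then taking \<open>(i, i)\<close> as the
  fibered product of \<open>(id, id)\<close> makes \<open>a\<^sub>* b\<^sup>* \<rightarrow> a\<^sub>* i\<^sub>* i\<^sup>* b\<^sup>* \<rightarrow> (a i)\<^sub>* (b i)\<^sup>* = a\<^sub>* b\<^sup>*\<close> a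
  composite of base change and composition maps, and it need not be the identity.  For the class of
  all cartesian squares uniqueness therefore holds up to such identifications (\<open>change_fp\<close> below).\<close>

definition determined_fibered_products ::
    "('o, 'm) category \<Rightarrow> ('m \<Rightarrow> 'm \<Rightarrow> 'm \<Rightarrow> 'm \<Rightarrow> bool) \<Rightarrow> bool" where
  "determined_fibered_products C Q \<longleftrightarrow>
     (\<forall>f g f' g'. Q f g f' g' \<longrightarrow> cartesian C f g f' g') \<and>
     (\<forall>f\<in>Arr C. \<forall>g\<in>Arr C. Cod C f = Cod C g \<longrightarrow> (\<exists>!(f', g'). Q f g f' g')) \<and>
     (\<forall>f\<in>Arr C. Q f (Ide C (Cod C f)) f (Ide C (Dom C f))) \<and>
     (\<forall>g\<in>Arr C. Q (Ide C (Cod C g)) g (Ide C (Dom C g)) g) \<and>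
     (\<forall>f g\<^sub>1 f\<^sub>1 g\<^sub>1' g\<^sub>2 f\<^sub>2 g\<^sub>2'. Q f g\<^sub>1 f\<^sub>1 g\<^sub>1' \<longrightarrow> Q f\<^sub>1 g\<^sub>2 f\<^sub>2 g\<^sub>2' \<longrightarrow>
        Q f (g\<^sub>1 \<cdot>\<^bsub>C\<^esub> g\<^sub>2) f\<^sub>2 (g\<^sub>1' \<cdot>\<^bsub>C\<^esub> g\<^sub>2')) \<and>
     (\<forall>f\<^sub>1 g f\<^sub>1' g\<^sub>1 f\<^sub>2 f\<^sub>2' g\<^sub>2. Q f\<^sub>1 g f\<^sub>1' g\<^sub>1 \<longrightarrow> Q f\<^sub>2 g\<^sub>1 f\<^sub>2' g\<^sub>2 \<longrightarrow>
        Q (f\<^sub>1 \<cdot>\<^bsub>C\<^esub> f\<^sub>2) g (f\<^sub>1' \<cdot>\<^bsub>C\<^esub> f\<^sub>2') g\<^sub>2)"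

section \<open>Geofibered categories\<close>

text \<open>The structure maps are given by components:
  \<open>compU f g A : f\<^sup>* g\<^sup>* A \<rightarrow> (g f)\<^sup>* A\<close>, \<open>compL f g A : g\<^sub>* f\<^sub>* A \<rightarrow> (g f)\<^sub>* A\<close>,
  \<open>trivU X A : (id\<^sub>X)\<^sup>* A \<rightarrow> A\<close>, \<open>trivL X A : (id\<^sub>X)\<^sub>* A \<rightarrow> A\<close>.\<close>

record ('s, 'a, 'x, 'f) geofib =
  Sh :: "('s, 'a) category"
  Sp :: "('x, 'f) category"
  proj :: "('s, 'a, 'x, 'f) fctr"
  pull :: "'f \<Rightarrow> ('s, 'a, 's, 'a) fctr"
  push :: "'f \<Rightarrow> ('s, 'a, 's, 'a) fctr"
  unit :: "'f \<Rightarrow> 's \<Rightarrow> 'a"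
  counit :: "'f \<Rightarrow> 's \<Rightarrow> 'a"
  compU :: "'f \<Rightarrow> 'f \<Rightarrow> 's \<Rightarrow> 'a"
  compL :: "'f \<Rightarrow> 'f \<Rightarrow> 's \<Rightarrow> 'a"
  trivU :: "'x \<Rightarrow> 's \<Rightarrow> 'a"
  trivL :: "'x \<Rightarrow> 's \<Rightarrow> 'a"

definition Fib :: "('s, 'a, 'x, 'f) geofib \<Rightarrow> 'x \<Rightarrow> ('s, 'a) category" where
  "Fib \<G> X = (Sh \<G>)
     \<lparr>Obj := {A \<in> Obj (Sh \<G>). onO (proj \<G>) A = X},
      Arr := {h \<in> Arr (Sh \<G>). onO (proj \<G>) (Dom (Sh \<G>) h) = X \<and>
                onO (proj \<G>) (Cod (Sh \<G>) h) = X \<and> onA (proj \<G>) h = Ide (Sp \<G>) X}\<rparr>"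

text \<open>The bijection \<open>Hom(f\<^sup>*A, B) \<cong> Hom(A, f\<^sub>*B)\<close> and its inverse.\<close>

definition sharp :: "('s, 'a, 'x, 'f) geofib \<Rightarrow> 'f \<Rightarrow> 's \<Rightarrow> 'a \<Rightarrow> 'a" where
  "sharp \<G> f A h = onA (push \<G> f) h \<cdot>\<^bsub>Sh \<G>\<^esub> unit \<G> f A"

definition flat :: "('s, 'a, 'x, 'f) geofib \<Rightarrow> 'f \<Rightarrow> 's \<Rightarrow> 'a \<Rightarrow> 'a" where
  "flat \<G> f B k = counit \<G> f B \<cdot>\<^bsub>Sh \<G>\<^esub> onA (pull \<G> f) k"

definition geofibered :: "('s, 'a, 'x, 'f) geofib \<Rightarrow> bool" where
  "geofibered \<G> \<longleftrightarrow>
    (let S = Sp \<G>; T = Sh \<G> in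
     is_functor T S (proj \<G>) \<and>
     has_fibered_products S \<and>
     \<comment> \<open>adjoint pairs\<close>
     (\<forall>f\<in>Arr S. is_functor (Fib \<G> (Cod S f)) (Fib \<G> (Dom S f)) (pull \<G> f) \<and>
        is_functor (Fib \<G> (Dom S f)) (Fib \<G> (Cod S f)) (push \<G> f) \<and>
        is_adjunction (Fib \<G> (Cod S f)) (Fib \<G> (Dom S f)) (pull \<G> f) (push \<G> f)
          (unit \<G> f) (counit \<G> f)) \<and>
     \<comment> \<open>structure isomorphisms\<close>
     (\<forall>f\<in>Arr S. \<forall>g\<in>Arr S. Cod S f = Dom S g \<longrightarrow>
        is_nat_iso (Fib \<G> (Cod S g)) (Fib \<G> (Dom S f))
          (pull \<G> f \<circ>\<^sub>F pull \<G> g) (pull \<G> (g \<cdot>\<^bsub>S\<^esub> f)) (compU \<G> f g) \<and>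
        is_nat_iso (Fib \<G> (Dom S f)) (Fib \<G> (Cod S g))
          (push \<G> g \<circ>\<^sub>F push \<G> f) (push \<G> (g \<cdot>\<^bsub>S\<^esub> f)) (compL \<G> f g)) \<and>
     (\<forall>X\<in>Obj S.
        is_nat_iso (Fib \<G> X) (Fib \<G> X) (pull \<G> (Ide S X)) id_fctr (trivU \<G> X) \<and>
        is_nat_iso (Fib \<G> X) (Fib \<G> X) (push \<G> (Ide S X)) id_fctr (trivL \<G> X)) \<and>
     \<comment> \<open>associativity\<close>
     (\<forall>f\<in>Arr S. \<forall>g\<in>Arr S. \<forall>h\<in>Arr S. Cod S f = Dom S g \<longrightarrow> Cod S g = Dom S h \<longrightarrow>
        (\<forall>A\<in>Obj (Fib \<G> (Cod S h)).
           compU \<G> (g \<cdot>\<^bsub>S\<^esub> f) h A \<cdot>\<^bsub>T\<^esub> compU \<G> f g (onO (pull \<G> h) A) =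
           compU \<G> f (h \<cdot>\<^bsub>S\<^esub> g) A \<cdot>\<^bsub>T\<^esub> onA (pull \<G> f) (compU \<G> g h A)) \<and>
        (\<forall>A\<in>Obj (Fib \<G> (Dom S f)).
           compL \<G> f (h \<cdot>\<^bsub>S\<^esub> g) A \<cdot>\<^bsub>T\<^esub> compL \<G> g h (onO (push \<G> f) A) =
           compL \<G> (g \<cdot>\<^bsub>S\<^esub> f) h A \<cdot>\<^bsub>T\<^esub> onA (push \<G> h) (compL \<G> f g A))) \<and>
     \<comment> \<open>unitality\<close>
     (\<forall>f\<in>Arr S.
        (\<forall>A\<in>Obj (Fib \<G> (Dom S f)).
           compL \<G> f (Ide S (Cod S f)) A = trivL \<G> (Cod S f) (onO (push \<G> f) A) \<and>
           compL \<G> (Ide S (Dom S f)) f A = onA (push \<G> f) (trivL \<G> (Dom S f) A)) \<and>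
        (\<forall>A\<in>Obj (Fib \<G> (Cod S f)).
           compU \<G> f (Ide S (Cod S f)) A = onA (pull \<G> f) (trivU \<G> (Cod S f) A) \<and>
           compU \<G> (Ide S (Dom S f)) f A = trivU \<G> (Dom S f) (onO (pull \<G> f) A))) \<and>
     \<comment> \<open>the structure maps correspond under adjunction\<close>
     (\<forall>f\<in>Arr S. \<forall>g\<in>Arr S. Cod S f = Dom S g \<longrightarrow>
        (\<forall>A\<in>Obj (Fib \<G> (Cod S g)). \<forall>B\<in>Obj (Fib \<G> (Dom S f)).
         \<forall>k\<in>Hom (Fib \<G> (Dom S f)) (onO (pull \<G> (g \<cdot>\<^bsub>S\<^esub> f)) A) B.
           flat \<G> f B (flat \<G> g (onO (push \<G> f) B)
             (inv_arr (Fib \<G> (Cod S g)) (compL \<G> f g B) \<cdot>\<^bsub>T\<^esub> sharp \<G> (g \<cdot>\<^bsub>S\<^esub> f) A k)) =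
           k \<cdot>\<^bsub>T\<^esub> compU \<G> f g A)) \<and>
     (\<forall>X\<in>Obj S. \<forall>A\<in>Obj (Fib \<G> X). \<forall>B\<in>Obj (Fib \<G> X).
        \<forall>k\<in>Hom (Fib \<G> X) (onO (pull \<G> (Ide S X)) A) B.
           (trivL \<G> X B \<cdot>\<^bsub>T\<^esub> sharp \<G> (Ide S X) A k) \<cdot>\<^bsub>T\<^esub> trivU \<G> X A = k))"

section \<open>Standard geometric functors\<close>

datatype 'f basic = Push 'f | Pull 'f

text \<open>A composition of basic functors with its terms remembered, in the order in which the
  composition is written (the last term is applied first); source and target are recorded
  because the empty composition does not determine them.\<close>

record ('x, 'f) sgf =
  src :: 'x
  terms :: "'f basic list"
  tgt :: 'x

definition sgf_id :: "'x \<Rightarrow> ('x, 'f) sgf" where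
  "sgf_id X = \<lparr>src = X, terms = [], tgt = X\<rparr>"

definition lower :: "('s, 'a, 'x, 'f) geofib \<Rightarrow> 'f \<Rightarrow> ('x, 'f) sgf" where
  "lower \<G> f = \<lparr>src = Dom (Sp \<G>) f, terms = [Push f], tgt = Cod (Sp \<G>) f\<rparr>"

definition upper :: "('s, 'a, 'x, 'f) geofib \<Rightarrow> 'f \<Rightarrow> ('x, 'f) sgf" where
  "upper \<G> f = \<lparr>src = Cod (Sp \<G>) f, terms = [Pull f], tgt = Dom (Sp \<G>) f\<rparr>"

definition sgf_cmp :: "('x, 'f) sgf \<Rightarrow> ('x, 'f) sgf \<Rightarrow> ('x, 'f) sgf"  (infixr "\<odot>" 70) where
  "F \<odot> G = \<lparr>src = src G, terms = terms F @ terms G, tgt = tgt F\<rparr>"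

inductive_set SGF :: "('s, 'a, 'x, 'f) geofib \<Rightarrow> ('x, 'f) sgf set" for \<G> where
  "X \<in> Obj (Sp \<G>) \<Longrightarrow> sgf_id X \<in> SGF \<G>"
| "f \<in> Arr (Sp \<G>) \<Longrightarrow> F \<in> SGF \<G> \<Longrightarrow> src (lower \<G> f) = tgt F \<Longrightarrow> lower \<G> f \<odot> F \<in> SGF \<G>"
| "f \<in> Arr (Sp \<G>) \<Longrightarrow> F \<in> SGF \<G> \<Longrightarrow> src (upper \<G> f) = tgt F \<Longrightarrow> upper \<G> f \<odot> F \<in> SGF \<G>"

fun basic_fctr :: "('s, 'a, 'x, 'f) geofib \<Rightarrow> 'f basic \<Rightarrow> ('s, 'a, 's, 'a) fctr" where
  "basic_fctr \<G> (Push f) = push \<G> f"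
| "basic_fctr \<G> (Pull f) = pull \<G> f"

definition sem :: "('s, 'a, 'x, 'f) geofib \<Rightarrow> ('x, 'f) sgf \<Rightarrow> ('s, 'a, 's, 'a) fctr" where
  "sem \<G> F = foldr (\<lambda>b H. basic_fctr \<G> b \<circ>\<^sub>F H) (terms F) id_fctr"

section \<open>Classes of transformations between SGFs\<close>

text \<open>A triple \<open>(F, G, \<phi>)\<close> stands for \<open>\<phi> : F \<rightarrow> G\<close>, with \<open>\<phi>\<close> given by components.\<close>

type_synonym ('s, 'a, 'x, 'f) ntclass = "(('x, 'f) sgf \<times> ('x, 'f) sgf \<times> ('s \<Rightarrow> 'a)) set"

inductive_set gen ::
    "('s, 'a, 'x, 'f) geofib \<Rightarrow> ('s, 'a, 'x, 'f) ntclass \<Rightarrow> ('s, 'a, 'x, 'f) ntclass"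
  for \<G> S where
  "F \<in> SGF \<G> \<Longrightarrow> (F, F, \<lambda>A. Ide (Sh \<G>) (onO (sem \<G> F) A)) \<in> gen \<G> S"
| "(F, G, \<phi>) \<in> S \<Longrightarrow> (F, G, \<phi>) \<in> gen \<G> S"
| "(F, G, \<phi>) \<in> gen \<G> S \<Longrightarrow> (G, H, \<psi>) \<in> gen \<G> S \<Longrightarrow> (F, H, \<lambda>A. \<psi> A \<cdot>\<^bsub>Sh \<G>\<^esub> \<phi> A) \<in> gen \<G> S"

text \<open>The inverses of those elements of a class that are natural isomorphisms.\<close>

definition inverses ::
    "('s, 'a, 'x, 'f) geofib \<Rightarrow> ('s, 'a, 'x, 'f) ntclass \<Rightarrow> ('s, 'a, 'x, 'f) ntclass" where
  "inverses \<G> S = {(G, F, \<psi>) | F G \<phi> \<psi>. (F, G, \<phi>) \<in> S \<and>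
     inverse_nats (Fib \<G> (src F)) (Fib \<G> (tgt F)) (sem \<G> F) (sem \<G> G) \<phi> \<psi>}"

text \<open>All whiskerings \<open>F \<phi> G\<close> of the elements \<open>\<phi>\<close> of a class.\<close>

definition whiskerings ::
    "('s, 'a, 'x, 'f) geofib \<Rightarrow> ('s, 'a, 'x, 'f) ntclass \<Rightarrow> ('s, 'a, 'x, 'f) ntclass" where
  "whiskerings \<G> S =
     {(F \<odot> H \<odot> G, F \<odot> K \<odot> G, \<lambda>A. onA (sem \<G> F) (\<phi> (onO (sem \<G> G) A))) | F H K G \<phi>.
        F \<in> SGF \<G> \<and> G \<in> SGF \<G> \<and> (H, K, \<phi>) \<in> S \<and> src F = tgt H \<and> src H = tgt G}"

definition comp0 :: "('s, 'a, 'x, 'f) geofib \<Rightarrow> ('s, 'a, 'x, 'f) ntclass" where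
  "comp0 \<G> = whiskerings \<G>
     ({(lower \<G> g \<odot> lower \<G> f, lower \<G> (g \<cdot>\<^bsub>Sp \<G>\<^esub> f), compL \<G> f g) | f g.
         f \<in> Arr (Sp \<G>) \<and> g \<in> Arr (Sp \<G>) \<and> Cod (Sp \<G>) f = Dom (Sp \<G>) g} \<union>
      {(upper \<G> f \<odot> upper \<G> g, upper \<G> (g \<cdot>\<^bsub>Sp \<G>\<^esub> f), compU \<G> f g) | f g.
         f \<in> Arr (Sp \<G>) \<and> g \<in> Arr (Sp \<G>) \<and> Cod (Sp \<G>) f = Dom (Sp \<G>) g})"

definition triv0 :: "('s, 'a, 'x, 'f) geofib \<Rightarrow> ('s, 'a, 'x, 'f) ntclass" where
  "triv0 \<G> = whiskerings \<G>
     ({(lower \<G> (Ide (Sp \<G>) X), sgf_id X, trivL \<G> X) | X. X \<in> Obj (Sp \<G>)} \<union>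
      {(upper \<G> (Ide (Sp \<G>) X), sgf_id X, trivU \<G> X) | X. X \<in> Obj (Sp \<G>)})"

definition comp_class :: "('s, 'a, 'x, 'f) geofib \<Rightarrow> ('s, 'a, 'x, 'f) ntclass" where
  "comp_class \<G> = comp0 \<G> \<union> inverses \<G> (comp0 \<G>)"

definition triv_class :: "('s, 'a, 'x, 'f) geofib \<Rightarrow> ('s, 'a, 'x, 'f) ntclass" where
  "triv_class \<G> = triv0 \<G> \<union> inverses \<G> (triv0 \<G>)"

text \<open>The component at \<open>A\<close> of \<open>bc(f, g) : g\<^sup>* f\<^sub>* \<rightarrow> f'\<^sub>* g'\<^sup>*\<close>.\<close>

definition bc ::
    "('s, 'a, 'x, 'f) geofib \<Rightarrow> 'f \<Rightarrow> 'f \<Rightarrow> 'f \<Rightarrow> 'f \<Rightarrow> 's \<Rightarrow> 'a" where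
  "bc \<G> f g f' g' A =
     (let B = onO (pull \<G> g') A in
      counit \<G> g (onO (push \<G> f') B) \<cdot>\<^bsub>Sh \<G>\<^esub>
      onA (pull \<G> g) (inv_arr (Fib \<G> (Cod (Sp \<G>) g)) (compL \<G> f' g B)) \<cdot>\<^bsub>Sh \<G>\<^esub>
      onA (pull \<G> g) (compL \<G> g' f B) \<cdot>\<^bsub>Sh \<G>\<^esub>
      onA (pull \<G> g) (onA (push \<G> f) (unit \<G> g' A)))"

text \<open>In the following, \<open>Q\<close> is the class of cartesian squares whose base change maps are used.\<close>

definition bc_class ::
    "('s, 'a, 'x, 'f) geofib \<Rightarrow> ('f \<Rightarrow> 'f \<Rightarrow> 'f \<Rightarrow> 'f \<Rightarrow> bool) \<Rightarrow> ('s, 'a, 'x, 'f) ntclass" where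
  "bc_class \<G> Q = whiskerings \<G>
     {(upper \<G> g \<odot> lower \<G> f, lower \<G> f' \<odot> upper \<G> g', bc \<G> f g f' g') | f g f' g'.
        cartesian (Sp \<G>) f g f' g' \<and> Q f g f' g'}"

definition SGNT0_plus ::
    "('s, 'a, 'x, 'f) geofib \<Rightarrow> ('f \<Rightarrow> 'f \<Rightarrow> 'f \<Rightarrow> 'f \<Rightarrow> bool) \<Rightarrow> ('s, 'a, 'x, 'f) ntclass" where
  "SGNT0_plus \<G> Q = gen \<G> (bc_class \<G> Q \<union> comp0 \<G> \<union> triv0 \<G>)"

definition SGNT0 ::
    "('s, 'a, 'x, 'f) geofib \<Rightarrow> ('f \<Rightarrow> 'f \<Rightarrow> 'f \<Rightarrow> 'f \<Rightarrow> bool) \<Rightarrow> ('s, 'a, 'x, 'f) ntclass" where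
  "SGNT0 \<G> Q = gen \<G> (SGNT0_plus \<G> Q \<union> inverses \<G> (SGNT0_plus \<G> Q))"

text \<open>Two fibered products of the same maps differ by a unique isomorphism compatible with the
  projections.  For an isomorphism \<open>k\<close> onto the common source of \<open>a\<close> and \<open>b\<close>, this is the induced
  identification \<open>a\<^sub>* b\<^sup>* \<rightarrow> a\<^sub>* k\<^sub>* k\<^sup>* b\<^sup>* \<rightarrow> (a k)\<^sub>* (b k)\<^sup>*\<close>.\<close>

definition change_fp ::
    "('s, 'a, 'x, 'f) geofib \<Rightarrow> 'f \<Rightarrow> 'f \<Rightarrow> 'f \<Rightarrow> 's \<Rightarrow> 'a" where
  "change_fp \<G> a b k A =
     compL \<G> k a (onO (pull \<G> (b \<cdot>\<^bsub>Sp \<G>\<^esub> k)) A) \<cdot>\<^bsub>Sh \<G>\<^esub>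
     onA (push \<G> a) (onA (push \<G> k) (compU \<G> k b A)) \<cdot>\<^bsub>Sh \<G>\<^esub>
     onA (push \<G> a) (unit \<G> k (onO (pull \<G> b) A))"

end

theory Submission
  imports Defs
begin

text \<open>
Both parts attach to every composition of direct and inverse images a structure that the generating
transformations cannot change, and recover the transformation from that structure.

The second part uses cones. A composition \<open>F\<close> passes through a zigzag of spaces; a cone over it with
vertex \<open>W\<close> is a compatible family of maps from \<open>W\<close> to all of them. If \<open>p\<close> and \<open>q\<close> are its legs to
the source and the target of \<open>F\<close>, then every \<open>\<alpha> : A \<rightarrow> p\<^sub>* B\<close> extends along the cone to
\<open>F A \<rightarrow> q\<^sub>* B\<close> (\<open>along\<close>): at a direct image one applies the functor and composes with the composition
isomorphism, at an inverse image one transposes under the adjunction. Base change, composition and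
triviality maps replace a zigzag by one that has the same cones, because cones see a fibered
product only through its universal property, and they carry the extension along a cone to the
extension along the corresponding cone (\<open>step_bc\<close>, \<open>step_compL\<close>, \<open>step_compU\<close>, \<open>step_trivL\<close>,
\<open>step_trivU\<close>). Inverses inherit both properties. The zigzag of \<open>a\<^sub>* b\<^sup>*\<close> has the terminal cone
\<open>(a, id, b)\<close>, along which the unit \<open>A \<rightarrow> b\<^sub>* b\<^sup>* A\<close> extends to the identity of \<open>a\<^sub>* b\<^sup>* A\<close>
(\<open>along_pair_ide\<close>). So \<open>\<phi> : F \<rightarrow> a\<^sub>* b\<^sup>*\<close> is the extension of the unit along the cone over \<open>F\<close> that
\<open>\<phi>\<close> matches with \<open>(a, id, b)\<close>, and everything depends on which cone this is. It is terminal,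
hence unique up to an automorphism \<open>k\<close> of the vertex with \<open>a k = a\<close> and \<open>b k = b\<close>, whose effect
is \<open>change_fp\<close> (\<open>along_pair\<close>). When fibered products are determined, iterating the
distinguished squares singles out one cone over each \<open>F\<close>, all generators respect it, and the cone
is unique.

The first part concerns isomorphisms between arbitrary compositions. Fusing adjacent functors of the
same kind and erasing those of identities reduces each \<open>F\<close> to an alternating composition without
identities, through an isomorphism \<open>reduction\<close> built from the structure maps. By associativity,
unitality and naturality of the structure maps, each generator \<open>F \<rightarrow> G\<close> commutes with the
reductions of \<open>F\<close> and \<open>G\<close> to their common normal form (\<open>same_reduction_fuse\<close>,
\<open>same_reduction_erase\<close>); since the reduction of \<open>G\<close> is a monomorphism, the transformation is
determined.
\<close>

section \<open>Categories and natural isomorphisms\<close>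

lemma category_dom_cod:
  assumes "is_category C" "h \<in> Arr C"
  shows "Dom C h \<in> Obj C" "Cod C h \<in> Obj C"
  using assms unfolding is_category_def by blast+

lemma category_ide:
  assumes "is_category C" "A \<in> Obj C"
  shows "Ide C A \<in> Arr C" "Dom C (Ide C A) = A" "Cod C (Ide C A) = A"
  using assms unfolding is_category_def Hom_def by blast+

lemma category_comp:
  assumes "is_category C" "h \<in> Arr C" "k \<in> Arr C" "Cod C h = Dom C k"
  shows "Cmp C k h \<in> Arr C" "Dom C (Cmp C k h) = Dom C h" "Cod C (Cmp C k h) = Cod C k"
  using assms unfolding is_category_def Hom_def by blast+

lemma category_unit:
  assumes "is_category C" "h \<in> Arr C"
  shows "Cmp C h (Ide C (Dom C h)) = h" "Cmp C (Ide C (Cod C h)) h = h"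
  using assms unfolding is_category_def by blast+

lemma category_assoc:
  assumes "is_category C" "h \<in> Arr C" "k \<in> Arr C" "l \<in> Arr C"
    "Cod C h = Dom C k" "Cod C k = Dom C l"
  shows "Cmp C (Cmp C l k) h = Cmp C l (Cmp C k h)"
  using assms unfolding is_category_def by metis

lemma inverse_arrows_unique:
  assumes C: "is_category C" and k: "inverse_arrows C h k" and l: "inverse_arrows C h l"
  shows "k = l"
proof -
  have [simp]: "h \<in> Arr C" "k \<in> Arr C" "l \<in> Arr C" "Dom C k = Cod C h" "Cod C k = Dom C h"
    "Dom C l = Cod C h" "Cod C l = Dom C h"
    using k l by (auto simp: inverse_arrows_def Hom_def)
  have "k = Cmp C k (Ide C (Cod C h))"
    using category_unit(1)[OF C, of k] by simp
  also have "\<dots> = Cmp C k (Cmp C h l)"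
    using l by (simp add: inverse_arrows_def)
  also have "\<dots> = Cmp C (Cmp C k h) l"
    by (simp add: category_assoc[OF C])
  also have "\<dots> = Cmp C (Ide C (Dom C h)) l"
    using k by (simp add: inverse_arrows_def)
  also have "\<dots> = l"
    using category_unit(2)[OF C, of l] by simp
  finally show ?thesis .
qed

lemma inverse_arrows_inv_arr:
  assumes "is_category C" "inverse_arrows C h k"
  shows "inverse_arrows C h (inv_arr C h)"
  unfolding inv_arr_def
  by (rule theI[where a = k], rule assms(2), rule inverse_arrows_unique[OF assms(1) _ assms(2)])

lemma nat_iso_component:
  assumes "is_nat_iso C D F G \<phi>" "A \<in> Obj C"
  shows "\<phi> A \<in> Hom D (onO F A) (onO G A)" "inverse_arrows D (\<phi> A) (inv_arr D (\<phi> A))"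
proof -
  obtain \<psi> where \<psi>: "inverse_nats C D F G \<phi> \<psi>"
    using assms(1) unfolding is_nat_iso_def by blast
  show hom: "\<phi> A \<in> Hom D (onO F A) (onO G A)"
    using \<psi> assms(2) unfolding inverse_nats_def is_nat_trans_def by blast
  have "inverse_arrows D (\<phi> A) (\<psi> A)"
    using \<psi> assms(2) hom unfolding inverse_nats_def is_nat_trans_def inverse_arrows_def Hom_def
    by auto
  moreover have "is_category D"
    using \<psi> unfolding inverse_nats_def is_nat_trans_def is_functor_def by blast
  ultimately show "inverse_arrows D (\<phi> A) (inv_arr D (\<phi> A))"
    by (rule inverse_arrows_inv_arr[rotated])
qed

lemma nat_iso_natural:
  assumes "is_nat_iso C D F G \<phi>" "h \<in> Arr C"
  shows "Cmp D (onA G h) (\<phi> (Dom C h)) = Cmp D (\<phi> (Cod C h)) (onA F h)"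
  using assms unfolding is_nat_iso_def inverse_nats_def is_nat_trans_def by blast

section \<open>Arrows in the fibers\<close>

locale geofibration =
  fixes \<G> :: "('s, 'a, 'x, 'f) geofib"
  assumes geofib: "geofibered \<G>"
begin

abbreviation Cmp_shapes (infixr "\<bullet>" 70) where "h \<bullet> k \<equiv> Cmp (Sh \<G>) h k"
abbreviation Cmp_spaces (infixr "\<star>" 75) where "f \<star> g \<equiv> Cmp (Sp \<G>) f g"
abbreviation "adom \<equiv> Dom (Sh \<G>)"
abbreviation "acod \<equiv> Cod (Sh \<G>)"
abbreviation "ide \<equiv> Ide (Sh \<G>)"
abbreviation "sdom \<equiv> Dom (Sp \<G>)"
abbreviation "scod \<equiv> Cod (Sp \<G>)"
abbreviation "side \<equiv> Ide (Sp \<G>)"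
abbreviation "maps \<equiv> Arr (Sp \<G>)"
abbreviation "spaces \<equiv> Obj (Sp \<G>)"
abbreviation "shape A \<equiv> A \<in> Obj (Sh \<G>)"
abbreviation "base \<equiv> onO (proj \<G>)"
abbreviation "lowO f \<equiv> onO (push \<G> f)"
abbreviation "lowA f \<equiv> onA (push \<G> f)"
abbreviation "upO f \<equiv> onO (pull \<G> f)"
abbreviation "upA f \<equiv> onA (pull \<G> f)"
abbreviation "cL \<equiv> compL \<G>"
abbreviation "cU \<equiv> compU \<G>"
abbreviation "\<eta> \<equiv> unit \<G>"
abbreviation "\<epsilon> \<equiv> counit \<G>"

text \<open>A constant, so that rewriting the space that names the fiber leaves the inverse arrow itself unchanged.\<close>

definition cLi :: "'f \<Rightarrow> 'f \<Rightarrow> 's \<Rightarrow> 'a" where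
  "cLi f g A = inv_arr (Fib \<G> (scod g)) (cL f g A)"

text \<open>Membership in some fiber, without naming the fiber. All typing conditions then concern only the
domain, the codomain and the base, which are functions of the arrow, so that rewriting can settle them
without guessing a fiber.\<close>

definition vert :: "'a \<Rightarrow> bool" where
  "vert h \<longleftrightarrow> h \<in> Arr (Sh \<G>) \<and> base (acod h) = base (adom h) \<and> onA (proj \<G>) h = side (base (adom h))"

lemma Fib_sel [simp]:
  "Dom (Fib \<G> X) = adom" "Cod (Fib \<G> X) = acod" "Ide (Fib \<G> X) = ide"
  "Cmp (Fib \<G> X) = Cmp (Sh \<G>)"
  "A \<in> Obj (Fib \<G> X) \<longleftrightarrow> shape A \<and> base A = X"
  "h \<in> Arr (Fib \<G> X) \<longleftrightarrow> vert h \<and> base (adom h) = X"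
  by (auto simp: Fib_def vert_def)

lemma Hom_Fib: "h \<in> Hom (Fib \<G> X) A B \<longleftrightarrow> vert h \<and> adom h = A \<and> acod h = B \<and> base A = X"
  by (auto simp: Hom_def)

lemmas geofib_axioms = geofib[unfolded geofibered_def Let_def]
lemmas geofib_rest = geofib_axioms[THEN conjunct2, THEN conjunct2]
lemmas geofib_adj = geofib_rest[THEN conjunct1]
lemmas geofib_rest1 = geofib_rest[THEN conjunct2]
lemmas geofib_comp = geofib_rest1[THEN conjunct1]
lemmas geofib_rest2 = geofib_rest1[THEN conjunct2]
lemmas geofib_triv = geofib_rest2[THEN conjunct1]
lemmas geofib_rest3 = geofib_rest2[THEN conjunct2]
lemmas geofib_assoc = geofib_rest3[THEN conjunct1]
lemmas geofib_rest4 = geofib_rest3[THEN conjunct2]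
lemmas geofib_unit = geofib_rest4[THEN conjunct1]
lemmas geofib_rest5 = geofib_rest4[THEN conjunct2]
lemmas geofib_comp_adj = geofib_rest5[THEN conjunct1]
lemmas geofib_triv_adj = geofib_rest5[THEN conjunct2]

lemma proj_functor: "is_functor (Sh \<G>) (Sp \<G>) (proj \<G>)"
  using geofib_axioms by (rule conjunct1)

lemma is_category_shapes: "is_category (Sh \<G>)" and is_category_spaces: "is_category (Sp \<G>)"
  using proj_functor by (auto simp: is_functor_def)

lemma base_space [simp]: "shape A \<Longrightarrow> base A \<in> spaces"
  using proj_functor by (simp add: is_functor_def)

lemma map_space [simp]: "f \<in> maps \<Longrightarrow> sdom f \<in> spaces" "f \<in> maps \<Longrightarrow> scod f \<in> spaces"
  using category_dom_cod[OF is_category_spaces] by auto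

lemma map_ide [simp]:
  "X \<in> spaces \<Longrightarrow> side X \<in> maps" "X \<in> spaces \<Longrightarrow> sdom (side X) = X"
  "X \<in> spaces \<Longrightarrow> scod (side X) = X"
  using category_ide[OF is_category_spaces] by auto

lemma map_comp [simp]:
  assumes "f \<in> maps" "g \<in> maps" "scod f = sdom g"
  shows "g \<star> f \<in> maps" "sdom (g \<star> f) = sdom f" "scod (g \<star> f) = scod g"
  using category_comp[OF is_category_spaces assms] by auto

lemma map_unit [simp]:
  "f \<in> maps \<Longrightarrow> X = sdom f \<Longrightarrow> f \<star> side X = f" "f \<in> maps \<Longrightarrow> X = scod f \<Longrightarrow> side X \<star> f = f"
  using category_unit[OF is_category_spaces] by auto

lemma map_assoc:
  assumes "f \<in> maps" "g \<in> maps" "h \<in> maps" "scod f = sdom g" "scod g = sdom h"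
  shows "(h \<star> g) \<star> f = h \<star> g \<star> f"
  using category_assoc[OF is_category_spaces assms] .

lemma vert_shape [simp]:
  "vert h \<Longrightarrow> h \<in> Arr (Sh \<G>)"
  "vert h \<Longrightarrow> shape (adom h)" "vert h \<Longrightarrow> shape (acod h)" "vert h \<Longrightarrow> base (acod h) = base (adom h)"
  using category_dom_cod[OF is_category_shapes] by (auto simp: vert_def)

lemma vert_ide [simp]:
  assumes "shape A"
  shows "vert (ide A)" "adom (ide A) = A" "acod (ide A) = A"
  using category_ide[OF is_category_shapes assms] proj_functor assms
  by (auto simp: vert_def is_functor_def simp del: vert_shape)

lemma vert_comp [simp]:
  assumes "vert h" "vert k" "adom k = acod h"
  shows "vert (k \<bullet> h)" "adom (k \<bullet> h) = adom h" "acod (k \<bullet> h) = acod k"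
proof -
  note * = category_comp[OF is_category_shapes, of h k]
  show dc: "adom (k \<bullet> h) = adom h" "acod (k \<bullet> h) = acod k"
    using * assms by auto
  have eq: "base (acod k) = base (adom h)"
    using assms by (metis vert_shape(4))
  have sp: "base (adom h) \<in> spaces"
    using assms by simp
  have "onA (proj \<G>) (k \<bullet> h) = onA (proj \<G>) k \<star> onA (proj \<G>) h"
    using proj_functor assms by (simp add: is_functor_def)
  also have "\<dots> = side (base (adom h))"
    using assms sp by (auto simp add: vert_def simp del: vert_shape)
  finally show "vert (k \<bullet> h)"
    using * assms dc eq by (simp add: vert_def del: vert_shape)
qed

lemma vert_assoc [simp]:
  assumes "vert h" "vert k" "vert l" "acod h = adom k" "acod k = adom l"
  shows "(l \<bullet> k) \<bullet> h = l \<bullet> k \<bullet> h"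
  using category_assoc[OF is_category_shapes] assms by simp

lemma vert_unit [simp]:
  "vert h \<Longrightarrow> A = adom h \<Longrightarrow> h \<bullet> ide A = h" "vert h \<Longrightarrow> A = acod h \<Longrightarrow> ide A \<bullet> h = h"
  using category_unit[OF is_category_shapes] by auto

lemma push_functor: "f \<in> maps \<Longrightarrow> is_functor (Fib \<G> (sdom f)) (Fib \<G> (scod f)) (push \<G> f)"
  and pull_functor: "f \<in> maps \<Longrightarrow> is_functor (Fib \<G> (scod f)) (Fib \<G> (sdom f)) (pull \<G> f)"
  and pull_push_adjunction: "f \<in> maps \<Longrightarrow>
    is_adjunction (Fib \<G> (scod f)) (Fib \<G> (sdom f)) (pull \<G> f) (push \<G> f) (\<eta> f) (\<epsilon> f)"
  using geofib_adj by blast+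

lemma compL_nat_iso: "\<lbrakk>f \<in> maps; g \<in> maps; scod f = sdom g\<rbrakk> \<Longrightarrow>
    is_nat_iso (Fib \<G> (sdom f)) (Fib \<G> (scod g)) (push \<G> g \<circ>\<^sub>F push \<G> f) (push \<G> (g \<star> f)) (cL f g)"
  and compU_nat_iso: "\<lbrakk>f \<in> maps; g \<in> maps; scod f = sdom g\<rbrakk> \<Longrightarrow>
    is_nat_iso (Fib \<G> (scod g)) (Fib \<G> (sdom f)) (pull \<G> f \<circ>\<^sub>F pull \<G> g) (pull \<G> (g \<star> f)) (cU f g)"
  and trivL_nat_iso: "X \<in> spaces \<Longrightarrow>
    is_nat_iso (Fib \<G> X) (Fib \<G> X) (push \<G> (side X)) id_fctr (trivL \<G> X)"
  and trivU_nat_iso: "X \<in> spaces \<Longrightarrow>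
    is_nat_iso (Fib \<G> X) (Fib \<G> X) (pull \<G> (side X)) id_fctr (trivU \<G> X)"
  using geofib_comp geofib_triv by blast+

lemma push_obj [simp]:
  assumes "f \<in> maps" "shape A" "base A = sdom f"
  shows "shape (lowO f A)" "base (lowO f A) = scod f" "lowA f (ide A) = ide (lowO f A)"
  using push_functor[OF assms(1)] assms by (auto simp: is_functor_def)

lemma pull_obj [simp]:
  assumes "f \<in> maps" "shape A" "base A = scod f"
  shows "shape (upO f A)" "base (upO f A) = sdom f" "upA f (ide A) = ide (upO f A)"
  using pull_functor[OF assms(1)] assms by (auto simp: is_functor_def)

lemma push_arr [simp]:
  assumes "f \<in> maps" "vert h" "base (adom h) = sdom f"
  shows "vert (lowA f h)" "adom (lowA f h) = lowO f (adom h)" "acod (lowA f h) = lowO f (acod h)"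
  using push_functor[OF assms(1)] assms by (auto simp: is_functor_def Hom_Fib)

lemma pull_arr [simp]:
  assumes "f \<in> maps" "vert h" "base (adom h) = scod f"
  shows "vert (upA f h)" "adom (upA f h) = upO f (adom h)" "acod (upA f h) = upO f (acod h)"
  using pull_functor[OF assms(1)] assms by (auto simp: is_functor_def Hom_Fib)

lemma push_comp [simp]:
  assumes "f \<in> maps" "vert h" "vert k" "base (adom h) = sdom f" "acod h = adom k"
  shows "lowA f (k \<bullet> h) = lowA f k \<bullet> lowA f h"
proof -
  have "base (adom k) = sdom f"
    using assms by (metis vert_shape(4))
  then show ?thesis
    using push_functor[OF assms(1)] assms by (simp add: is_functor_def)
qed

lemma pull_comp [simp]:
  assumes "f \<in> maps" "vert h" "vert k" "base (adom h) = scod f" "acod h = adom k"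
  shows "upA f (k \<bullet> h) = upA f k \<bullet> upA f h"
proof -
  have "base (adom k) = scod f"
    using assms by (metis vert_shape(4))
  then show ?thesis
    using pull_functor[OF assms(1)] assms by (simp add: is_functor_def)
qed

lemma unit_arr [simp]:
  assumes "f \<in> maps" "shape A" "base A = scod f"
  shows "vert (\<eta> f A)" "adom (\<eta> f A) = A" "acod (\<eta> f A) = lowO f (upO f A)"
  using pull_push_adjunction[OF assms(1)] assms
  by (auto simp: is_adjunction_def is_nat_trans_def Hom_Fib id_fctr_def cmp_fctr_def)

lemma counit_arr [simp]:
  assumes "f \<in> maps" "shape A" "base A = sdom f"
  shows "vert (\<epsilon> f A)" "adom (\<epsilon> f A) = upO f (lowO f A)" "acod (\<epsilon> f A) = A"
  using pull_push_adjunction[OF assms(1)] assms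
  by (auto simp: is_adjunction_def is_nat_trans_def Hom_Fib id_fctr_def cmp_fctr_def)

lemma unit_natural:
  assumes "f \<in> maps" "vert h" "base (adom h) = scod f"
  shows "lowA f (upA f h) \<bullet> \<eta> f (adom h) = \<eta> f (acod h) \<bullet> h"
  using pull_push_adjunction[OF assms(1)] assms
  by (auto simp: is_adjunction_def is_nat_trans_def id_fctr_def cmp_fctr_def)

lemma counit_natural:
  assumes "f \<in> maps" "vert h" "base (adom h) = sdom f"
  shows "\<epsilon> f (acod h) \<bullet> upA f (lowA f h) = h \<bullet> \<epsilon> f (adom h)"
  using pull_push_adjunction[OF assms(1)] assms
  by (auto simp: is_adjunction_def is_nat_trans_def id_fctr_def cmp_fctr_def)

lemma triangle:
  assumes "f \<in> maps" "shape A"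
  shows "base A = scod f \<Longrightarrow> \<epsilon> f (upO f A) \<bullet> upA f (\<eta> f A) = ide (upO f A)"
    "base A = sdom f \<Longrightarrow> lowA f (\<epsilon> f A) \<bullet> \<eta> f (lowO f A) = ide (lowO f A)"
  using pull_push_adjunction[OF assms(1)] assms by (auto simp: is_adjunction_def)

lemma compL_arr [simp]:
  assumes "f \<in> maps" "g \<in> maps" "scod f = sdom g" "shape A" "base A = sdom f"
  shows "vert (cL f g A)" "adom (cL f g A) = lowO g (lowO f A)" "acod (cL f g A) = lowO (g \<star> f) A"
    "vert (cLi f g A)" "adom (cLi f g A) = lowO (g \<star> f) A" "acod (cLi f g A) = lowO g (lowO f A)"
    "cL f g A \<bullet> cLi f g A = ide (lowO (g \<star> f) A)" "cLi f g A \<bullet> cL f g A = ide (lowO g (lowO f A))"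
  using nat_iso_component[OF compL_nat_iso[OF assms(1-3)], of A] assms
  by (auto simp: Hom_Fib cmp_fctr_def inverse_arrows_def cLi_def)

lemma compU_arr [simp]:
  assumes "f \<in> maps" "g \<in> maps" "scod f = sdom g" "shape A" "base A = scod g"
  shows "vert (cU f g A)" "adom (cU f g A) = upO f (upO g A)" "acod (cU f g A) = upO (g \<star> f) A"
  using nat_iso_component[OF compU_nat_iso[OF assms(1-3)], of A] assms
  by (auto simp: Hom_Fib cmp_fctr_def)

lemma trivL_arr [simp]:
  assumes "X \<in> spaces" "shape A" "base A = X"
  shows "vert (trivL \<G> X A)" "adom (trivL \<G> X A) = lowO (side X) A" "acod (trivL \<G> X A) = A"
  using nat_iso_component[OF trivL_nat_iso[OF assms(1)], of A] assms
  by (auto simp: Hom_Fib id_fctr_def)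

lemma trivU_arr [simp]:
  assumes "X \<in> spaces" "shape A" "base A = X"
  shows "vert (trivU \<G> X A)" "adom (trivU \<G> X A) = upO (side X) A" "acod (trivU \<G> X A) = A"
  using nat_iso_component[OF trivU_nat_iso[OF assms(1)], of A] assms
  by (auto simp: Hom_Fib id_fctr_def)

lemma compL_natural:
  assumes "f \<in> maps" "g \<in> maps" "scod f = sdom g" "vert h" "base (adom h) = sdom f"
  shows "lowA (g \<star> f) h \<bullet> cL f g (adom h) = cL f g (acod h) \<bullet> lowA g (lowA f h)"
  using nat_iso_natural[OF compL_nat_iso[OF assms(1-3)], of h] assms by (simp add: cmp_fctr_def)

lemma compU_natural:
  assumes "f \<in> maps" "g \<in> maps" "scod f = sdom g" "vert h" "base (adom h) = scod g"
  shows "upA (g \<star> f) h \<bullet> cU f g (adom h) = cU f g (acod h) \<bullet> upA f (upA g h)"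
  using nat_iso_natural[OF compU_nat_iso[OF assms(1-3)], of h] assms by (simp add: cmp_fctr_def)

lemma trivL_natural:
  assumes "X \<in> spaces" "vert h" "base (adom h) = X"
  shows "h \<bullet> trivL \<G> X (adom h) = trivL \<G> X (acod h) \<bullet> lowA (side X) h"
  using nat_iso_natural[OF trivL_nat_iso[OF assms(1)], of h] assms by (simp add: id_fctr_def)

lemma trivU_natural:
  assumes "X \<in> spaces" "vert h" "base (adom h) = X"
  shows "h \<bullet> trivU \<G> X (adom h) = trivU \<G> X (acod h) \<bullet> upA (side X) h"
  using nat_iso_natural[OF trivU_nat_iso[OF assms(1)], of h] assms by (simp add: id_fctr_def)

lemma compL_assoc: "\<lbrakk>f \<in> maps; g \<in> maps; h \<in> maps; scod f = sdom g; scod g = sdom h; shape A;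
    base A = sdom f\<rbrakk> \<Longrightarrow>
    cL f (h \<star> g) A \<bullet> cL g h (lowO f A) = cL (g \<star> f) h A \<bullet> lowA h (cL f g A)"
  and compU_assoc: "\<lbrakk>f \<in> maps; g \<in> maps; h \<in> maps; scod f = sdom g; scod g = sdom h; shape A;
    base A = scod h\<rbrakk> \<Longrightarrow>
    cU (g \<star> f) h A \<bullet> cU f g (upO h A) = cU f (h \<star> g) A \<bullet> upA f (cU g h A)"
  using geofib_assoc by simp_all

lemma compL_unit: "\<lbrakk>f \<in> maps; shape A; base A = sdom f\<rbrakk> \<Longrightarrow>
      cL f (side (scod f)) A = trivL \<G> (scod f) (lowO f A)"
    "\<lbrakk>f \<in> maps; shape A; base A = sdom f\<rbrakk> \<Longrightarrow>
      cL (side (sdom f)) f A = lowA f (trivL \<G> (sdom f) A)"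
  and compU_unit: "\<lbrakk>f \<in> maps; shape A; base A = scod f\<rbrakk> \<Longrightarrow>
      cU f (side (scod f)) A = upA f (trivU \<G> (scod f) A)"
    "\<lbrakk>f \<in> maps; shape A; base A = scod f\<rbrakk> \<Longrightarrow>
      cU (side (sdom f)) f A = trivU \<G> (sdom f) (upO f A)"
  using geofib_unit by simp_all

lemma compU_adjoint:
  assumes "f \<in> maps" "g \<in> maps" "scod f = sdom g" "shape A" "base A = scod g"
    "vert k" "adom k = upO (g \<star> f) A" "acod k = B"
  shows "flat \<G> f B (flat \<G> g (lowO f B) (cLi f g B \<bullet> sharp \<G> (g \<star> f) A k)) = k \<bullet> cU f g A"
proof -
  have "shape B" "base B = sdom f"
    using assms vert_shape(3,4)[of k] by auto
  then show ?thesis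
    using geofib_comp_adj assms by (simp add: Hom_Fib cLi_def)
qed

lemma trivU_adjoint:
  assumes "X \<in> spaces" "shape A" "base A = X" "vert k" "adom k = upO (side X) A" "acod k = B"
  shows "(trivL \<G> X B \<bullet> sharp \<G> (side X) A k) \<bullet> trivU \<G> X A = k"
proof -
  have "shape B" "base B = X"
    using assms vert_shape(3,4)[of k] by auto
  then show ?thesis
    using geofib_triv_adj assms by (simp add: Hom_Fib)
qed

section \<open>The adjunction between inverse and direct image\<close>

lemma sharp_arr [simp]:
  assumes "f \<in> maps" "shape A" "base A = scod f" "vert h" "adom h = upO f A"
  shows "vert (sharp \<G> f A h)" "adom (sharp \<G> f A h) = A" "acod (sharp \<G> f A h) = lowO f (acod h)"
  using assms by (simp_all add: sharp_def)

lemma flat_arr [simp]: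
  assumes "f \<in> maps" "shape B" "base B = sdom f" "vert h" "acod h = lowO f B"
  shows "vert (flat \<G> f B h)" "adom (flat \<G> f B h) = upO f (adom h)" "acod (flat \<G> f B h) = B"
proof -
  have "base (adom h) = scod f"
    using assms vert_shape(4)[of h] by simp
  then show "vert (flat \<G> f B h)" "adom (flat \<G> f B h) = upO f (adom h)" "acod (flat \<G> f B h) = B"
    using assms by (simp_all add: flat_def)
qed

lemma sharp_flat [simp]:
  assumes "f \<in> maps" "shape B" "base B = sdom f" "vert h" "acod h = lowO f B" "adom h = A"
  shows "sharp \<G> f A (flat \<G> f B h) = h"
proof -
  have b: "base (adom h) = scod f"
    using assms vert_shape(4)[of h] by simp
  have "sharp \<G> f A (flat \<G> f B h) = lowA f (\<epsilon> f B) \<bullet> lowA f (upA f h) \<bullet> \<eta> f (adom h)"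
    using assms b by (auto simp add: sharp_def flat_def)
  also have "\<dots> = lowA f (\<epsilon> f B) \<bullet> \<eta> f (lowO f B) \<bullet> h"
    using assms b unit_natural[of f h] by simp
  also have "\<dots> = (lowA f (\<epsilon> f B) \<bullet> \<eta> f (lowO f B)) \<bullet> h"
    using assms b by simp
  also have "\<dots> = h"
    using assms b by (subst triangle) simp_all
  finally show ?thesis .
qed

lemma flat_sharp [simp]:
  assumes "f \<in> maps" "shape A" "base A = scod f" "vert h" "adom h = upO f A" "acod h = B"
  shows "flat \<G> f B (sharp \<G> f A h) = h"
proof -
  have "flat \<G> f B (sharp \<G> f A h) = \<epsilon> f (acod h) \<bullet> upA f (lowA f h) \<bullet> upA f (\<eta> f A)"
    using assms by (auto simp add: sharp_def flat_def)
  also have "\<dots> = (\<epsilon> f (acod h) \<bullet> upA f (lowA f h)) \<bullet> upA f (\<eta> f A)"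
    using assms vert_shape(3,4)[of h] by simp
  also have "\<dots> = h \<bullet> (\<epsilon> f (upO f A) \<bullet> upA f (\<eta> f A))"
    using assms by (subst counit_natural) simp_all
  also have "\<dots> = h"
    using assms by (subst triangle) simp_all
  finally show ?thesis .
qed

text \<open>Transposition is natural in the object that receives the direct image; this and \<open>flat_comp\<close> move arrows
across the adjunction.\<close>

lemma comp_flat:
  assumes "f \<in> maps" "shape B" "base B = sdom f" "vert h" "acod h = lowO f B" "vert u" "adom u = B"
  shows "u \<bullet> flat \<G> f B h = flat \<G> f (acod u) (lowA f u \<bullet> h)"
proof -
  have b: "base (adom h) = scod f"
    using assms vert_shape(4)[of h] by simp
  have bu: "shape (acod u)" "base (acod u) = sdom f"
    using assms by auto
  have "u \<bullet> flat \<G> f B h = (u \<bullet> \<epsilon> f (adom u)) \<bullet> upA f h"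
    using assms b by (auto simp: flat_def)
  also have "\<dots> = (\<epsilon> f (acod u) \<bullet> upA f (lowA f u)) \<bullet> upA f h"
    using assms by (simp add: counit_natural)
  also have "\<dots> = flat \<G> f (acod u) (lowA f u \<bullet> h)"
    using assms b bu by (simp add: flat_def)
  finally show ?thesis .
qed

lemma flat_comp:
  assumes "f \<in> maps" "shape B" "base B = sdom f" "vert h" "acod h = lowO f B" "vert k" "acod k = adom h"
  shows "flat \<G> f B (h \<bullet> k) = flat \<G> f B h \<bullet> upA f k"
proof -
  have b: "base (adom h) = scod f"
    using assms vert_shape(4)[of h] by simp
  have "base (adom k) = scod f"
    using assms b vert_shape(4)[of k] by simp
  then show ?thesis
    using assms b by (simp add: flat_def)
qed


section \<open>Words\<close>

fun letter :: "'f basic \<Rightarrow> bool" where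
  "letter (Push f) \<longleftrightarrow> f \<in> maps"
| "letter (Pull f) \<longleftrightarrow> f \<in> maps"

fun letter_src :: "'f basic \<Rightarrow> 'x" where
  "letter_src (Push f) = sdom f"
| "letter_src (Pull f) = scod f"

fun letter_tgt :: "'f basic \<Rightarrow> 'x" where
  "letter_tgt (Push f) = scod f"
| "letter_tgt (Pull f) = sdom f"

abbreviation "letterO b \<equiv> onO (basic_fctr \<G> b)"
abbreviation "letterA b \<equiv> onA (basic_fctr \<G> b)"

definition wordO :: "'f basic list \<Rightarrow> 's \<Rightarrow> 's" where
  "wordO ts A = foldr letterO ts A"

definition wordA :: "'f basic list \<Rightarrow> 'a \<Rightarrow> 'a" where
  "wordA ts h = foldr letterA ts h"

lemma word_simps [simp]:
  "wordO [] A = A" "wordO (b # ts) A = letterO b (wordO ts A)"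
  "wordA [] h = h" "wordA (b # ts) h = letterA b (wordA ts h)"
  "wordO (ts @ us) A = wordO ts (wordO us A)"
  by (simp_all add: wordO_def wordA_def)

fun typed :: "'f basic list \<Rightarrow> 'x \<Rightarrow> 'x \<Rightarrow> bool" where
  "typed [] X Z \<longleftrightarrow> X = Z \<and> X \<in> spaces"
| "typed (b # ts) X Z \<longleftrightarrow> letter b \<and> Z = letter_tgt b \<and> typed ts X (letter_src b)"

lemma typed_spaces: "typed ts X Z \<Longrightarrow> X \<in> spaces" "typed ts X Z \<Longrightarrow> Z \<in> spaces"
proof -
  show 1: "typed ts X Z \<Longrightarrow> X \<in> spaces" for ts X Z
    by (induction ts arbitrary: Z) auto
  show "typed ts X Z \<Longrightarrow> Z \<in> spaces"
  proof (cases ts)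
    case (Cons b us)
    then show "typed ts X Z \<Longrightarrow> Z \<in> spaces" by (cases b) auto
  qed auto
qed

lemma letter_obj [simp]:
  assumes "letter b" "shape A" "base A = letter_src b"
  shows "shape (letterO b A)" "base (letterO b A) = letter_tgt b"
    "letterA b (ide A) = ide (letterO b A)"
  using assms by (cases b; simp)+

lemma letter_arr [simp]:
  assumes "letter b" "vert h" "base (adom h) = letter_src b"
  shows "vert (letterA b h)" "adom (letterA b h) = letterO b (adom h)"
    "acod (letterA b h) = letterO b (acod h)"
  using assms by (cases b; simp)+

lemma letter_comp [simp]:
  assumes "letter b" "vert h" "vert k" "base (adom h) = letter_src b" "acod h = adom k"
  shows "letterA b (k \<bullet> h) = letterA b k \<bullet> letterA b h"
  using assms by (cases b) simp_all

lemma word_obj: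
  assumes "typed ts X Z" "shape A" "base A = X"
  shows "shape (wordO ts A) \<and> base (wordO ts A) = Z"
  using assms by (induction ts arbitrary: Z) auto

lemma sem_obj [simp]: "onO (sem \<G> F) A = wordO (terms F) A"
  and sem_arr [simp]: "onA (sem \<G> F) h = wordA (terms F) h"
proof -
  have "onO (foldr (\<lambda>b H. basic_fctr \<G> b \<circ>\<^sub>F H) ts id_fctr) A = wordO ts A"
    "onA (foldr (\<lambda>b H. basic_fctr \<G> b \<circ>\<^sub>F H) ts id_fctr) h = wordA ts h" for ts
    by (induction ts) (auto simp: cmp_fctr_def id_fctr_def)
  then show "onO (sem \<G> F) A = wordO (terms F) A" "onA (sem \<G> F) h = wordA (terms F) h"
    by (auto simp: sem_def)
qed

lemma SGF_typed: "F \<in> SGF \<G> \<Longrightarrow> typed (terms F) (src F) (tgt F)"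
  by (induction rule: SGF.induct) (auto simp: sgf_id_def lower_def upper_def sgf_cmp_def)

definition between :: "'x \<Rightarrow> 'f basic list \<Rightarrow> 'f basic list \<Rightarrow> ('s \<Rightarrow> 'a) \<Rightarrow> bool" where
  "between X ts us \<phi> \<longleftrightarrow> (\<forall>A. shape A \<longrightarrow> base A = X \<longrightarrow>
     vert (\<phi> A) \<and> adom (\<phi> A) = wordO ts A \<and> acod (\<phi> A) = wordO us A)"

lemma between_arr:
  assumes "between X ts us \<phi>" "shape A" "base A = X"
  shows "vert (\<phi> A)" "adom (\<phi> A) = wordO ts A" "acod (\<phi> A) = wordO us A"
  using assms by (auto simp: between_def)

end

section \<open>Invariants of classes of transformations\<close>

text \<open>Both parts follow one pattern: a property of transformations between words that survives
identities, composition, inversion and application of one more functor holds for a generated class as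
soon as it holds for the generators at the head of an arbitrary word.\<close>

locale transformation_invariant = geofibration \<G>
  for \<G> :: "('s, 'a, 'x, 'f) geofib" +
  fixes P :: "'x \<Rightarrow> 'x \<Rightarrow> 'f basic list \<Rightarrow> 'f basic list \<Rightarrow> ('s \<Rightarrow> 'a) \<Rightarrow> bool"
  assumes P_id: "typed ts X Z \<Longrightarrow> P X Z ts ts (\<lambda>A. ide (wordO ts A))"
    and P_comp: "P X Z ts us \<phi> \<Longrightarrow> P X Z us vs \<psi> \<Longrightarrow> P X Z ts vs (\<lambda>A. \<psi> A \<bullet> \<phi> A)"
    and P_inverse: "P X Z ts us \<phi> \<Longrightarrow> between X us ts \<psi> \<Longrightarrow>
      (\<And>A. shape A \<Longrightarrow> base A = X \<Longrightarrow> \<phi> A \<bullet> \<psi> A = ide (wordO us A)) \<Longrightarrow> P X Z us ts \<psi>"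
    and P_letter: "P X Z ts us \<phi> \<Longrightarrow> letter b \<Longrightarrow> letter_src b = Z \<Longrightarrow>
      P X (letter_tgt b) (b # ts) (b # us) (\<lambda>A. letterA b (\<phi> A))"
begin

definition invariant :: "('s, 'a, 'x, 'f) ntclass \<Rightarrow> bool" where
  "invariant S \<longleftrightarrow> (\<forall>(F, G, \<phi>) \<in> S. src G = src F \<and> tgt G = tgt F \<and>
     P (src F) (tgt F) (terms F) (terms G) \<phi>)"

lemma invariant_Un: "invariant S \<Longrightarrow> invariant S' \<Longrightarrow> invariant (S \<union> S')"
  by (auto simp: invariant_def)

lemma invariant_gen:
  assumes "invariant S"
  shows "invariant (gen \<G> S)"
proof -
  have "src G = src F \<and> tgt G = tgt F \<and> P (src F) (tgt F) (terms F) (terms G) \<phi>"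
    if "(F, G, \<phi>) \<in> gen \<G> S" for F G \<phi>
    using that
  proof (induction rule: gen.induct)
    case (1 F)
    then show ?case using P_id[OF SGF_typed] by simp
  next
    case (2 F G \<phi>)
    then show ?case using assms by (auto simp: invariant_def)
  next
    case (3 F G \<phi> H \<psi>)
    then show ?case using P_comp by auto
  qed
  then show ?thesis by (auto simp: invariant_def)
qed

lemma invariant_inverses:
  assumes "invariant S"
  shows "invariant (inverses \<G> S)"
  unfolding invariant_def
proof (clarify)
  fix G F \<psi>
  assume "(G, F, \<psi>) \<in> inverses \<G> S"
  then obtain \<phi> where \<phi>: "(F, G, \<phi>) \<in> S"
    and inv: "inverse_nats (Fib \<G> (src F)) (Fib \<G> (tgt F)) (sem \<G> F) (sem \<G> G) \<phi> \<psi>"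
    by (auto simp: inverses_def)
  have F: "src G = src F" "tgt G = tgt F" "P (src F) (tgt F) (terms F) (terms G) \<phi>"
    using assms \<phi> by (auto simp: invariant_def)
  have "P (src F) (tgt F) (terms G) (terms F) \<psi>"
  proof (rule P_inverse[OF F(3)])
    show "between (src F) (terms G) (terms F) \<psi>"
      using inv by (auto simp: inverse_nats_def is_nat_trans_def Hom_Fib between_def)
  qed (use inv in \<open>auto simp: inverse_nats_def\<close>)
  then show "src F = src G \<and> tgt F = tgt G \<and> P (src G) (tgt G) (terms G) (terms F) \<psi>"
    using F by simp
qed

lemma P_word:
  assumes "P X Z ts us \<phi>" "typed vs Z Y"
  shows "P X Y (vs @ ts) (vs @ us) (\<lambda>A. wordA vs (\<phi> A))"
  using assms(2)
proof (induction vs arbitrary: Y)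
  case (Cons b vs)
  then show ?case using P_letter[of X "letter_src b" "vs @ ts" "vs @ us" _ b] by simp
qed (use assms(1) in simp)

text \<open>The inner functor of a whiskering is absorbed in the word \<open>ts\<close> below the generator, the outer one is
added letter by letter.\<close>

lemma invariant_whiskerings:
  assumes "\<And>H K \<phi> ts X. (H, K, \<phi>) \<in> S \<Longrightarrow> typed ts X (src H) \<Longrightarrow>
    src K = src H \<and> tgt K = tgt H \<and> P X (tgt H) (terms H @ ts) (terms K @ ts) (\<lambda>A. \<phi> (wordO ts A))"
  shows "invariant (whiskerings \<G> S)"
proof -
  have "P (src G) (tgt F) (terms F @ terms H @ terms G) (terms F @ terms K @ terms G)
      (\<lambda>A. wordA (terms F) (\<phi> (wordO (terms G) A)))"
    if "F \<in> SGF \<G>" "G \<in> SGF \<G>" "(H, K, \<phi>) \<in> S" "src F = tgt H" "src H = tgt G" for F G H K \<phi>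
    using assms[OF that(3)] P_word SGF_typed[OF that(1)] SGF_typed[OF that(2)] that(4,5) by metis
  then show ?thesis
    by (auto simp: invariant_def whiskerings_def sgf_cmp_def)
qed

end

context geofibration begin

section \<open>Cones over words\<close>

text \<open>The compatibility of two neighbouring legs of a cone: \<open>v\<close> ends in the target and \<open>w\<close> in the source of
the letter. A direct image determines \<open>v\<close> by \<open>w\<close>; an inverse image along \<open>f\<close> asks for a lift \<open>v\<close> of
\<open>w\<close> through \<open>f\<close>.\<close>

fun step :: "'f basic \<Rightarrow> 'f \<Rightarrow> 'f \<Rightarrow> bool" where
  "step (Push f) v w \<longleftrightarrow> w \<in> maps \<and> scod w = sdom f \<and> v = f \<star> w"
| "step (Pull f) v w \<longleftrightarrow> v \<in> maps \<and> scod v = sdom f \<and> w = f \<star> v"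

text \<open>The legs are listed in the order of the letters, so the first leg ends in the target of the word
and the last leg in its source \<open>X\<close>; the empty word has the one leg to \<open>X\<close>.\<close>

fun cone :: "'x \<Rightarrow> 'f basic list \<Rightarrow> 'f list \<Rightarrow> bool" where
  "cone X [] c \<longleftrightarrow> (\<exists>p. c = [p] \<and> p \<in> maps \<and> scod p = X)"
| "cone X (b # ts) c \<longleftrightarrow> (\<exists>v e. c = v # e \<and> cone X ts e \<and> step b v (hd e))"

abbreviation restrict_cone :: "'f list \<Rightarrow> 'f \<Rightarrow> 'f list" where
  "restrict_cone c k \<equiv> map (\<lambda>v. v \<star> k) c"

lemma cone_nonempty: "cone X ts c \<Longrightarrow> c \<noteq> []"
  by (cases ts) auto

lemma cone_ends:
  assumes "typed ts X Z" "cone X ts c"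
  shows "hd c \<in> maps \<and> scod (hd c) = Z \<and> last c \<in> maps \<and> scod (last c) = X \<and>
    sdom (last c) = sdom (hd c)"
  using assms
proof (induction ts arbitrary: Z c)
  case (Cons b ts)
  then obtain v e where e: "c = v # e" "cone X ts e" "step b v (hd e)" by auto
  then show ?case
    using Cons.IH[of "letter_src b" e] Cons.prems cone_nonempty[OF e(2)] by (cases b) auto
qed auto

lemma step_sdom:
  assumes "step b v w" "letter b" "w \<in> maps" "scod w = letter_src b"
  shows "v \<in> maps" "sdom w = sdom v" "scod v = letter_tgt b"
  using assms by (cases b; simp)+

lemma step_restrict:
  assumes "step b v w" "letter b" "w \<in> maps" "scod w = letter_src b" "k \<in> maps" "scod k = sdom v"
  shows "step b (v \<star> k) (w \<star> k)"
  using assms by (cases b) (simp_all add: map_assoc)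

lemma cone_restrict:
  assumes "typed ts X Z" "cone X ts c" "k \<in> maps" "scod k = sdom (hd c)"
  shows "cone X ts (restrict_cone c k)"
  using assms
proof (induction ts arbitrary: Z c)
  case (Cons b ts)
  then obtain v e where e: "c = v # e" "cone X ts e" "step b v (hd e)" by auto
  have ends: "hd e \<in> maps" "scod (hd e) = letter_src b"
    using cone_ends[of ts X "letter_src b" e] Cons.prems e by auto
  have b: "letter b" "typed ts X (letter_src b)"
    using Cons.prems by auto
  have k: "scod k = sdom v"
    using Cons.prems(4) e by simp
  have sd: "sdom (hd e) = sdom v"
    by (rule step_sdom(2)[OF e(3) b(1) ends])
  have h: "hd (restrict_cone e k) = hd e \<star> k"
    using cone_nonempty[OF e(2)] by (simp add: hd_map)
  have "cone X ts (restrict_cone e k)"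
    by (rule Cons.IH[OF b(2) e(2) Cons.prems(3)]) (simp add: k sd)
  then show ?case
    using step_restrict[OF e(3) b(1) ends Cons.prems(3) k] by (simp add: e(1) h)
qed auto

text \<open>One step of the extension along a cone: from \<open>t : C \<rightarrow> w\<^sub>* B\<close> to \<open>f\<^sub>* C \<rightarrow> v\<^sub>* B\<close> or to
\<open>f\<^sup>* C \<rightarrow> v\<^sub>* B\<close>. In the second case \<open>w = f v\<close>, and \<open>C \<rightarrow> (f v)\<^sub>* B \<cong> f\<^sub>* v\<^sub>* B\<close> is
transposed.\<close>

fun step_arr :: "'f basic \<Rightarrow> 'f \<Rightarrow> 'f \<Rightarrow> 's \<Rightarrow> 'a \<Rightarrow> 'a" where
  "step_arr (Push f) v w B t = cL w f B \<bullet> lowA f t"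
| "step_arr (Pull f) v w B t = flat \<G> f (lowO v B) (cLi v f B \<bullet> t)"

fun along :: "'f basic list \<Rightarrow> 'f list \<Rightarrow> 's \<Rightarrow> 'a \<Rightarrow> 'a" where
  "along [] c B \<alpha> = \<alpha>"
| "along (b # ts) c B \<alpha> = step_arr b (hd c) (hd (tl c)) B (along ts (tl c) B \<alpha>)"

lemma step_arr_arr [simp]:
  assumes "letter b" "step b v w" "w \<in> maps" "scod w = letter_src b"
    "shape B" "base B = sdom w" "vert t" "acod t = lowO w B"
  shows "vert (step_arr b v w B t)" "adom (step_arr b v w B t) = letterO b (adom t)"
    "acod (step_arr b v w B t) = lowO v B"
proof -
  have "base (adom t) = scod w"
    using assms vert_shape(4)[of t] by simp
  then show "vert (step_arr b v w B t)" "adom (step_arr b v w B t) = letterO b (adom t)"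
    "acod (step_arr b v w B t) = lowO v B"
    using assms by (cases b; auto)+
qed

text \<open>The extension is natural in the shape that it starts from, which is why it passes through whiskering on
the outside.\<close>

lemma step_arr_comp:
  assumes "letter b" "step b v w" "w \<in> maps" "scod w = letter_src b"
    "shape B" "base B = sdom w" "vert t" "acod t = lowO w B" "vert s" "acod s = adom t"
  shows "step_arr b v w B (t \<bullet> s) = step_arr b v w B t \<bullet> letterA b s"
proof -
  have b: "base (adom t) = scod w"
    using assms vert_shape(4)[of t] by simp
  have bs: "base (adom s) = scod w"
    using assms b vert_shape(4)[of s] by simp
  show ?thesis
  proof (cases b)
    case (Push f)
    then show ?thesis using assms b bs by simp
  next
    case (Pull f)
    have "flat \<G> f (lowO v B) ((cLi v f B \<bullet> t) \<bullet> s) = flat \<G> f (lowO v B) (cLi v f B \<bullet> t) \<bullet> upA f s"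
      using assms b bs Pull by (intro flat_comp) auto
    then show ?thesis using assms b bs Pull by simp
  qed
qed

lemma along_arr:
  assumes "typed ts X Z" "cone X ts c" "shape B" "base B = sdom (hd c)"
    "vert \<alpha>" "acod \<alpha> = lowO (last c) B"
  shows "vert (along ts c B \<alpha>) \<and> adom (along ts c B \<alpha>) = wordO ts (adom \<alpha>) \<and>
    acod (along ts c B \<alpha>) = lowO (hd c) B"
  using assms
proof (induction ts arbitrary: Z c)
  case (Cons b ts)
  then obtain v e where e: "c = v # e" "cone X ts e" "step b v (hd e)" by auto
  have ends: "hd e \<in> maps" "scod (hd e) = letter_src b"
    using cone_ends[of ts X "letter_src b" e] Cons.prems e by auto
  have b: "letter b" "typed ts X (letter_src b)"
    using Cons.prems by auto
  have B: "base B = sdom (hd e)"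
    using Cons.prems(4) e(1) step_sdom(2)[OF e(3) b(1) ends] by simp
  have last: "acod \<alpha> = lowO (last e) B"
    using Cons.prems(6) e(1) cone_nonempty[OF e(2)] by simp
  note IH = Cons.IH[OF b(2) e(2) Cons.prems(3) B Cons.prems(5) last]
  show ?case
    using step_arr_arr[OF b(1) e(3) ends Cons.prems(3) B, of "along ts e B \<alpha>"] IH
    by (simp add: e(1))
qed auto

section \<open>Compatibility with the structure maps\<close>

lemma compLi_cancel [simp]:
  assumes "f \<in> maps" "g \<in> maps" "scod f = sdom g" "shape A" "base A = sdom f" "vert h"
  shows "acod h = lowO (g \<star> f) A \<Longrightarrow> cL f g A \<bullet> cLi f g A \<bullet> h = h"
    and "acod h = lowO g (lowO f A) \<Longrightarrow> cLi f g A \<bullet> cL f g A \<bullet> h = h"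
proof -
  show "cL f g A \<bullet> cLi f g A \<bullet> h = h" if "acod h = lowO (g \<star> f) A"
    using assms that vert_assoc[of h "cLi f g A" "cL f g A"] by (simp del: vert_assoc)
  show "cLi f g A \<bullet> cL f g A \<bullet> h = h" if "acod h = lowO g (lowO f A)"
    using assms that vert_assoc[of h "cL f g A" "cLi f g A"] by (simp del: vert_assoc)
qed

text \<open>The associativity square \<open>compL_assoc\<close> with its four arrows inverted.\<close>

lemma compLi_assoc:
  assumes "f \<in> maps" "g \<in> maps" "h \<in> maps" "scod f = sdom g" "scod g = sdom h" "shape A"
    "base A = sdom f"
  shows "cLi g h (lowO f A) \<bullet> cLi f (h \<star> g) A = lowA h (cLi f g A) \<bullet> cLi (g \<star> f) h A"
proof -
  let ?a = "cL f (h \<star> g) A" and ?a' = "cLi f (h \<star> g) A"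
  let ?b = "cL g h (lowO f A)" and ?b' = "cLi g h (lowO f A)"
  let ?c = "cL (g \<star> f) h A" and ?c' = "cLi (g \<star> f) h A"
  let ?d = "lowA h (cL f g A)" and ?d' = "lowA h (cLi f g A)"
  have [simp]: "(h \<star> g) \<star> f = h \<star> g \<star> f"
    using assms by (simp add: map_assoc)
  have dd: "?d \<bullet> ?d' = ide (lowO h (lowO (g \<star> f) A))"
    using assms push_comp[of h "cLi f g A" "cL f g A"] by simp
  have "?b' \<bullet> ?a' = ?b' \<bullet> ?a' \<bullet> ?c \<bullet> (?d \<bullet> ?d') \<bullet> ?c'"
    using assms unfolding dd by simp
  also have "\<dots> = ?b' \<bullet> ?a' \<bullet> (?c \<bullet> ?d) \<bullet> ?d' \<bullet> ?c'"
    using assms by simp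
  also have "\<dots> = ?b' \<bullet> (?a' \<bullet> ?a) \<bullet> ?b \<bullet> ?d' \<bullet> ?c'"
    unfolding compL_assoc[OF assms, symmetric] using assms by simp
  also have "\<dots> = (?b' \<bullet> ?b) \<bullet> ?d' \<bullet> ?c'"
    using assms by simp
  also have "\<dots> = ?d' \<bullet> ?c'"
    using assms by simp
  finally show ?thesis .
qed

text \<open>Naturality of the composition isomorphism, followed by its associativity for the three maps
\<open>q\<close>, \<open>f\<close>, \<open>g\<close>.\<close>

lemma step_compL:
  assumes "f \<in> maps" "g \<in> maps" "scod f = sdom g" "q \<in> maps" "scod q = sdom f"
    "shape B" "base B = sdom q" "vert t" "acod t = lowO q B" "adom t = C"
  shows "step_arr (Push (g \<star> f)) v q B t \<bullet> cL f g C =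
    step_arr (Push g) v (f \<star> q) B (step_arr (Push f) v' q B t)"
proof -
  have b: "shape C" "base C = sdom f"
    using assms vert_shape(2,4)[of t] by auto
  have "step_arr (Push (g \<star> f)) v q B t \<bullet> cL f g C =
      cL q (g \<star> f) B \<bullet> lowA (g \<star> f) t \<bullet> cL f g (adom t)"
    using assms b by auto
  also have "\<dots> = (cL q (g \<star> f) B \<bullet> cL f g (lowO q B)) \<bullet> lowA g (lowA f t)"
    using assms b compL_natural[of f g t] by (simp add: map_assoc)
  also have "\<dots> = (cL (f \<star> q) g B \<bullet> lowA g (cL q f B)) \<bullet> lowA g (lowA f t)"
    using assms by (subst compL_assoc) simp_all
  also have "\<dots> = step_arr (Push g) v (f \<star> q) B (step_arr (Push f) v' q B t)"
    using assms b by simp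
  finally show ?thesis .
qed

lemma step_trivL:
  assumes "q \<in> maps" "scod q = Y" "shape B" "base B = sdom q" "vert t" "acod t = lowO q B"
    "adom t = C"
  shows "t \<bullet> trivL \<G> Y C = step_arr (Push (side Y)) v q B t"
proof -
  have b: "shape C" "base C = Y"
    using assms vert_shape(2,4)[of t] by auto
  show ?thesis
    using assms b trivL_natural[of Y t] by (auto simp: compL_unit)
qed

text \<open>The composition isomorphism of inverse images is the transpose of the inverse of the one for direct images,
so precomposing a transpose under \<open>g f\<close> with it gives the iterated transpose under \<open>g\<close> and \<open>f\<close>. What
remains is associativity for direct images.\<close>

lemma step_compU:
  assumes "f \<in> maps" "g \<in> maps" "scod f = sdom g" "w \<in> maps" "scod w = sdom f"
    "q = g \<star> f \<star> w" "shape B" "base B = sdom w" "vert t" "acod t = lowO q B" "adom t = C"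
  shows "step_arr (Pull (g \<star> f)) w q B t \<bullet> cU f g C =
    step_arr (Pull f) w (f \<star> w) B (step_arr (Pull g) (f \<star> w) q B t)"
proof -
  have b: "shape C" "base C = scod g"
    using assms vert_shape(2,4)[of t] by auto
  have [simp]: "(g \<star> f) \<star> w = g \<star> f \<star> w"
    using assms by (simp add: map_assoc)
  let ?k = "flat \<G> (g \<star> f) (lowO w B) (cLi w (g \<star> f) B \<bullet> t)"
  have "step_arr (Pull (g \<star> f)) w q B t \<bullet> cU f g C = ?k \<bullet> cU f g C"
    by simp
  also have "\<dots> = flat \<G> f (lowO w B) (flat \<G> g (lowO f (lowO w B))
      (cLi f g (lowO w B) \<bullet> sharp \<G> (g \<star> f) C ?k))"
    using assms b by (subst compU_adjoint) auto
  also have "sharp \<G> (g \<star> f) C ?k = cLi w (g \<star> f) B \<bullet> t"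
    using assms b by simp
  also have "cLi f g (lowO w B) \<bullet> cLi w (g \<star> f) B \<bullet> t =
      (cLi f g (lowO w B) \<bullet> cLi w (g \<star> f) B) \<bullet> t"
    using assms b by simp
  also have "\<dots> = lowA g (cLi w f B) \<bullet> cLi (f \<star> w) g B \<bullet> t"
    using assms b by (subst compLi_assoc) auto
  also have "flat \<G> g (lowO f (lowO w B)) \<dots> =
      cLi w f B \<bullet> flat \<G> g (lowO (f \<star> w) B) (cLi (f \<star> w) g B \<bullet> t)"
    using assms b comp_flat[of g "lowO (f \<star> w) B" "cLi (f \<star> w) g B \<bullet> t" "cLi w f B"] by simp
  finally show ?thesis
    by simp
qed

text \<open>The triviality isomorphism of inverse images is the transpose of the one for direct images, and unitality
identifies the latter, at \<open>q\<^sub>* B\<close>, with \<open>compL q id\<close>.\<close>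

lemma step_trivU:
  assumes "q \<in> maps" "scod q = Y" "shape B" "base B = sdom q" "vert t" "acod t = lowO q B"
    "adom t = C"
  shows "t \<bullet> trivU \<G> Y C = step_arr (Pull (side Y)) q q B t"
proof -
  have b: "shape C" "base C = Y" "Y \<in> spaces"
    using assms vert_shape(2,4)[of t] map_space(2)[of q] by auto
  let ?k = "flat \<G> (side Y) (lowO q B) (cLi q (side Y) B \<bullet> t)"
  have "(trivL \<G> Y (lowO q B) \<bullet> sharp \<G> (side Y) C ?k) \<bullet> trivU \<G> Y C = ?k"
    using assms b by (intro trivU_adjoint) auto
  also have "sharp \<G> (side Y) C ?k = cLi q (side Y) B \<bullet> t"
    using assms b by simp
  also have "trivL \<G> Y (lowO q B) \<bullet> cLi q (side Y) B \<bullet> t = t"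
    using assms b compL_unit(1)[of q B, symmetric] by simp
  finally show ?thesis
    by simp
qed

text \<open>The base change map is a transpose under \<open>g\<close> by definition, hence so is the left side. Its transpose
uses the unit of \<open>g'\<close>, which undoes the transposition under \<open>g'\<close> in the extension; the remaining
composition isomorphisms cancel by associativity for \<open>w, f', g\<close> and for \<open>w, g', f\<close>, where the two
triple composites agree because the square commutes.\<close>

lemma step_bc:
  assumes sq: "f \<in> maps" "g \<in> maps" "f' \<in> maps" "g' \<in> maps" "scod f = scod g" "sdom f' = sdom g'"
    "scod f' = sdom g" "scod g' = sdom f" "f \<star> g' = g \<star> f'"
    and assms: "w \<in> maps" "scod w = sdom f'" "q = g' \<star> w" "shape B" "base B = sdom w"
    "vert t" "acod t = lowO q B" "adom t = C"
  shows "step_arr (Push f') v w B (step_arr (Pull g') w q B t) \<bullet> bc \<G> f g f' g' C =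
    step_arr (Pull g) (f' \<star> w) (f \<star> q) B (step_arr (Push f) v' q B t)"
proof -
  have C: "shape C" "base C = sdom f"
    using assms sq vert_shape(2,4)[of t] by auto
  let ?P = "upO g' C"
  let ?s = "flat \<G> g' (lowO w B) (cLi w g' B \<bullet> t)"
  let ?x = "cLi f' g ?P \<bullet> cL g' f ?P \<bullet> lowA f (\<eta> g' C)"
  let ?y = "cL w f' B \<bullet> lowA f' ?s"
  have bc: "bc \<G> f g f' g' C = flat \<G> g (lowO f' ?P) ?x"
    using sq C by (simp add: bc_def Let_def flat_def cLi_def[symmetric])
  have s: "vert ?s" "adom ?s = ?P" "acod ?s = lowO w B"
    using sq assms C by auto
  have fgw: "(g \<star> f') \<star> w = g \<star> f' \<star> w" "f \<star> g' \<star> w = g \<star> f' \<star> w"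
    using sq assms map_assoc[of w g' f] map_assoc[of w f' g] by simp_all
  \<comment> \<open>Associativity for the two ways around the square, solved for the arrows that occur in the transpose.\<close>
  have A1: "lowA g (cL w f' B) \<bullet> cLi f' g (lowO w B) = cLi (f' \<star> w) g B \<bullet> cL w (g \<star> f') B"
  proof -
    have "cLi (f' \<star> w) g B \<bullet> cL w (g \<star> f') B =
        cLi (f' \<star> w) g B \<bullet> (cL w (g \<star> f') B \<bullet> cL f' g (lowO w B)) \<bullet> cLi f' g (lowO w B)"
      using sq assms fgw by simp
    also have "\<dots> = cLi (f' \<star> w) g B \<bullet> (cL (f' \<star> w) g B \<bullet> lowA g (cL w f' B)) \<bullet> cLi f' g (lowO w B)"
      using sq assms by (subst compL_assoc) simp_all
    also have "\<dots> = lowA g (cL w f' B) \<bullet> cLi f' g (lowO w B)"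
      using sq assms by simp
    finally show ?thesis by simp
  qed
  have A2: "cL w (f \<star> g') B \<bullet> cL g' f (lowO w B) \<bullet> lowA f (cLi w g' B) = cL (g' \<star> w) f B"
  proof -
    have dd: "lowA f (cL w g' B) \<bullet> lowA f (cLi w g' B) = ide (lowO f (lowO (g' \<star> w) B))"
      using sq assms push_comp[of f "cLi w g' B" "cL w g' B"] by simp
    have "cL w (f \<star> g') B \<bullet> cL g' f (lowO w B) \<bullet> lowA f (cLi w g' B) =
        (cL w (f \<star> g') B \<bullet> cL g' f (lowO w B)) \<bullet> lowA f (cLi w g' B)"
      using sq assms fgw by simp
    also have "\<dots> = (cL (g' \<star> w) f B \<bullet> lowA f (cL w g' B)) \<bullet> lowA f (cLi w g' B)"
      using sq assms by (subst compL_assoc) simp_all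
    also have "\<dots> = cL (g' \<star> w) f B"
      using sq assms dd by simp
    finally show ?thesis .
  qed
  have nat1: "lowA g (lowA f' ?s) \<bullet> cLi f' g ?P = cLi f' g (lowO w B) \<bullet> lowA (g \<star> f') ?s"
  proof -
    have "lowA g (lowA f' ?s) \<bullet> cLi f' g ?P =
        cLi f' g (lowO w B) \<bullet> (cL f' g (lowO w B) \<bullet> lowA g (lowA f' ?s)) \<bullet> cLi f' g ?P"
      using sq assms C s by simp
    also have "\<dots> = cLi f' g (lowO w B) \<bullet> (lowA (g \<star> f') ?s \<bullet> cL f' g ?P) \<bullet> cLi f' g ?P"
      using sq assms C s compL_natural[of f' g ?s] by simp
    also have "\<dots> = cLi f' g (lowO w B) \<bullet> lowA (g \<star> f') ?s"
      using sq assms C s by simp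
    finally show ?thesis .
  qed
  have nat2: "lowA (f \<star> g') ?s \<bullet> cL g' f ?P = cL g' f (lowO w B) \<bullet> lowA f (lowA g' ?s)"
    using sq assms C s compL_natural[of g' f ?s] by simp
  have sh: "lowA g' ?s \<bullet> \<eta> g' C = cLi w g' B \<bullet> t"
    using sq assms C sharp_flat[of g' "lowO w B" "cLi w g' B \<bullet> t" C] by (simp add: sharp_def)
  have "lowA g ?y \<bullet> ?x = lowA g (cL w f' B) \<bullet> (lowA g (lowA f' ?s) \<bullet> cLi f' g ?P) \<bullet> cL g' f ?P \<bullet> lowA f (\<eta> g' C)"
    using sq assms C s by simp
  also have "\<dots> = (lowA g (cL w f' B) \<bullet> cLi f' g (lowO w B)) \<bullet> (lowA (f \<star> g') ?s \<bullet> cL g' f ?P) \<bullet> lowA f (\<eta> g' C)"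
    unfolding nat1 using sq assms C s by simp
  also have "\<dots> = cLi (f' \<star> w) g B \<bullet> cL w (f \<star> g') B \<bullet> cL g' f (lowO w B) \<bullet> lowA f (lowA g' ?s \<bullet> \<eta> g' C)"
    unfolding A1 nat2 using sq assms C s fgw by simp
  also have "\<dots> = cLi (f' \<star> w) g B \<bullet> (cL w (f \<star> g') B \<bullet> cL g' f (lowO w B) \<bullet> lowA f (cLi w g' B)) \<bullet> lowA f t"
    unfolding sh using sq assms C s fgw by simp
  also have "\<dots> = cLi (f' \<star> w) g B \<bullet> cL q f B \<bullet> lowA f t"
    unfolding A2 using assms by simp
  finally have *: "lowA g ?y \<bullet> ?x = cLi (f' \<star> w) g B \<bullet> cL q f B \<bullet> lowA f t" .
  \<comment> \<open>Both sides are transposes under \<open>g\<close>, so it suffices that their transposes agree.\<close>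
  have "?y \<bullet> flat \<G> g (lowO f' ?P) ?x = flat \<G> g (lowO (f' \<star> w) B) (lowA g ?y \<bullet> ?x)"
    using sq assms C s by (subst comp_flat) auto
  then show ?thesis
    unfolding * bc by simp
qed


section \<open>Transport of cones\<close>

text \<open>The terminal cone that iterated distinguished fibered products produce. At an inverse image the leg \<open>hd e\<close>
is base changed along \<open>f\<close>: the new first leg is its base change \<open>v\<close>, and all previous legs are
restricted along the other projection \<open>f'\<close>.\<close>

fun distinguished :: "('f \<Rightarrow> 'f \<Rightarrow> 'f \<Rightarrow> 'f \<Rightarrow> bool) \<Rightarrow> 'x \<Rightarrow> 'f basic list \<Rightarrow> 'f list \<Rightarrow> bool" where
  "distinguished Q X [] c \<longleftrightarrow> c = [side X]"
| "distinguished Q X (Push f # ts) c \<longleftrightarrow> (\<exists>e. distinguished Q X ts e \<and> c = (f \<star> hd e) # e)"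
| "distinguished Q X (Pull f # ts) c \<longleftrightarrow>
    (\<exists>e v f'. distinguished Q X ts e \<and> Q (hd e) f v f' \<and> c = v # restrict_cone e f')"

lemma distinguished_PullI:
  assumes "distinguished Q X ts e" "Q (hd e) f v f'" "c = restrict_cone e f'"
  shows "distinguished Q X (Pull f # ts) (v # c)"
  using assms by auto

lemma distinguished_PullE:
  assumes "distinguished Q X (Pull f # ts) (v # c)"
  obtains e f' where "distinguished Q X ts e" "Q (hd e) f v f'" "c = restrict_cone e f'"
  using assms by auto

lemma cartesian_square:
  assumes "cartesian (Sp \<G>) f g f' g'"
  shows "f \<in> maps" "g \<in> maps" "f' \<in> maps" "g' \<in> maps" "scod f = scod g" "sdom f' = sdom g'"
    "scod f' = sdom g" "scod g' = sdom f" "f \<star> g' = g \<star> f'"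
  using assms by (simp_all only: cartesian_def)

lemma cartesian_lift:
  assumes "cartesian (Sp \<G>) f g f' g'" "u \<in> maps" "v \<in> maps" "sdom u = sdom v"
    "scod u = sdom f" "scod v = sdom g" "f \<star> u = g \<star> v"
  shows "\<exists>!h. (h \<in> maps \<and> sdom h = sdom u \<and> scod h = sdom f') \<and> g' \<star> h = u \<and> f' \<star> h = v"
  using assms(1)[unfolded cartesian_def Hom_def mem_Collect_eq] assms(2-) by blast

lemma determined_cartesian:
  assumes "determined_fibered_products (Sp \<G>) Q" "Q f g f' g'"
  shows "cartesian (Sp \<G>) f g f' g'"
  using assms(1)[unfolded determined_fibered_products_def, THEN conjunct1] assms(2) by blast

lemma determined_ex1:
  assumes "determined_fibered_products (Sp \<G>) Q" "f \<in> maps" "g \<in> maps" "scod f = scod g"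
  shows "\<exists>!(f', g'). Q f g f' g'"
  using assms(1)[unfolded determined_fibered_products_def, THEN conjunct2, THEN conjunct1] assms(2-)
  by blast

lemma determined_unique:
  assumes Q: "determined_fibered_products (Sp \<G>) Q" and "Q f g f' g'" "Q f g f'' g''"
  shows "f' = f'' \<and> g' = g''"
  using determined_ex1[OF Q, of f g] cartesian_square[OF determined_cartesian[OF Q assms(2)]]
    assms(2,3) by auto

lemma determined_ide:
  assumes "determined_fibered_products (Sp \<G>) Q" "f \<in> maps"
  shows "Q f (side (scod f)) f (side (sdom f))" "Q (side (scod f)) f (side (sdom f)) f"
  using assms unfolding determined_fibered_products_def by blast+

lemma determined_paste:
  assumes Q: "determined_fibered_products (Sp \<G>) Q"
  shows "Q f g f' g' \<Longrightarrow> Q f' h f'' h' \<Longrightarrow> Q f (g \<star> h) f'' (g' \<star> h')"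
    and "Q f g f' g' \<Longrightarrow> Q h g' h' g'' \<Longrightarrow> Q (f \<star> h) g (f' \<star> h') g''"
  using Q[unfolded determined_fibered_products_def] by blast+

lemma distinguished_cone:
  assumes Q: "determined_fibered_products (Sp \<G>) Q" and "typed ts X Z" "distinguished Q X ts c"
  shows "cone X ts c"
  using assms(2,3)
proof (induction ts arbitrary: Z c)
  case (Cons b ts)
  then have ty: "letter b" "typed ts X (letter_src b)" by auto
  show ?case
  proof (cases b)
    case (Push f)
    then obtain e where "distinguished Q X ts e" "c = (f \<star> hd e) # e"
      using Cons.prems by auto
    then show ?thesis
      using Cons.IH[OF ty(2)] cone_ends[OF ty(2)] Push by auto
  next
    case (Pull f)
    then obtain e v f' where e: "distinguished Q X ts e" "Q (hd e) f v f'" "c = v # restrict_cone e f'"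
      using Cons.prems by auto
    note sq = cartesian_square[OF determined_cartesian[OF Q e(2)]]
    have ce: "cone X ts e"
      using Cons.IH[OF ty(2) e(1)] .
    have "hd (restrict_cone e f') = f \<star> v"
      using cone_nonempty[OF ce] sq by (simp add: hd_map)
    then show ?thesis
      using cone_restrict[OF ty(2) ce sq(4,8)] sq e(3) Pull by auto
  qed
qed (auto dest: typed_spaces)

lemma distinguished_unique:
  assumes Q: "determined_fibered_products (Sp \<G>) Q"
  shows "distinguished Q X ts c \<Longrightarrow> distinguished Q X ts d \<Longrightarrow> c = d"
proof (induction ts arbitrary: c d)
  case (Cons b ts)
  show ?case
  proof (cases b)
    case (Push f)
    then show ?thesis using Cons by auto
  next
    case (Pull f)
    obtain e v f' where e: "distinguished Q X ts e" "Q (hd e) f v f'" "c = v # restrict_cone e f'"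
      using Cons.prems(1) Pull by auto
    obtain e' v' f'' where e': "distinguished Q X ts e'" "Q (hd e') f v' f''"
      "d = v' # restrict_cone e' f''"
      using Cons.prems(2) Pull by auto
    have "e' = e"
      using Cons.IH e'(1) e(1) by blast
    then show ?thesis
      using determined_unique[OF Q e(2), of v' f''] e' e by simp
  qed
qed simp

definition cone_data :: "'x \<Rightarrow> 'f list \<Rightarrow> 's \<Rightarrow> 'a \<Rightarrow> bool" where
  "cone_data X c B \<alpha> \<longleftrightarrow> shape B \<and> base B = sdom (hd c) \<and> vert \<alpha> \<and> base (adom \<alpha>) = X \<and>
     acod \<alpha> = lowO (last c) B"

text \<open>A bijection between the cones over two words that keeps the outer legs and commutes with restriction along
maps of vertices. It is a relation rather than a function because for base change one
direction is an explicit formula and the other a lift, and because inverses of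
transformations become converses.\<close>

definition cone_bijection :: "('f \<Rightarrow> 'f \<Rightarrow> 'f \<Rightarrow> 'f \<Rightarrow> bool) \<Rightarrow> 'x \<Rightarrow> 'f basic list \<Rightarrow>
    'f basic list \<Rightarrow> ('f list \<Rightarrow> 'f list \<Rightarrow> bool) \<Rightarrow> bool" where
  "cone_bijection Q X ts us R \<longleftrightarrow>
     (\<forall>c d. R c d \<longrightarrow> cone X ts c \<and> cone X us d \<and> hd c = hd d \<and> last c = last d) \<and>
     (\<forall>c. cone X ts c \<longrightarrow> (\<exists>d. R c d)) \<and>
     (\<forall>d. cone X us d \<longrightarrow> (\<exists>c. R c d)) \<and>
     (\<forall>c d c' d'. R c d \<longrightarrow> R c' d' \<longrightarrow> (c = c' \<longleftrightarrow> d = d')) \<and>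
     (\<forall>c d k. R c d \<longrightarrow> k \<in> maps \<longrightarrow> scod k = sdom (hd c) \<longrightarrow>
        R (restrict_cone c k) (restrict_cone d k)) \<and>
     (determined_fibered_products (Sp \<G>) Q \<longrightarrow>
        (\<forall>c d. R c d \<longrightarrow> distinguished Q X ts c = distinguished Q X us d))"

lemma cone_bijectionD:
  assumes "cone_bijection Q X ts us R"
  shows "R c d \<Longrightarrow> cone X ts c \<and> cone X us d \<and> hd c = hd d \<and> last c = last d"
    "cone X ts c \<Longrightarrow> \<exists>d. R c d" "cone X us d \<Longrightarrow> \<exists>c. R c d"
    "R c d \<Longrightarrow> R c' d' \<Longrightarrow> c = c' \<longleftrightarrow> d = d'"
    "R c d \<Longrightarrow> k \<in> maps \<Longrightarrow> scod k = sdom (hd c) \<Longrightarrow> R (restrict_cone c k) (restrict_cone d k)"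
    "determined_fibered_products (Sp \<G>) Q \<Longrightarrow> R c d \<Longrightarrow>
      distinguished Q X ts c = distinguished Q X us d"
  using assms unfolding cone_bijection_def by blast+

lemma cone_bijection_converse:
  assumes R: "cone_bijection Q X ts us R"
  shows "cone_bijection Q X us ts R\<inverse>\<inverse>"
  unfolding cone_bijection_def conversep_iff
proof (intro conjI allI impI)
  fix d c assume "R c d"
  then show "cone X us d" "cone X ts c" "hd d = hd c" "last d = last c"
    using cone_bijectionD(1)[OF R] by simp_all
next
  fix d assume "cone X us d" then show "\<exists>c. R c d" by (rule cone_bijectionD(3)[OF R])
next
  fix c assume "cone X ts c" then show "\<exists>d. R c d" by (rule cone_bijectionD(2)[OF R])
next
  fix c d c' d' assume "R c d" "R c' d'"
  then show "d = d' \<longleftrightarrow> c = c'" using cone_bijectionD(4)[OF R] by simp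
next
  fix d c k assume "R c d" "k \<in> maps" "scod k = sdom (hd d)"
  then show "R (restrict_cone c k) (restrict_cone d k)"
    using cone_bijectionD(1,5)[OF R] by simp
next
  fix d c assume "determined_fibered_products (Sp \<G>) Q" "R c d"
  then show "distinguished Q X us d = distinguished Q X ts c"
    using cone_bijectionD(6)[OF R] by simp
qed

lemma cone_bijection_comp:
  assumes R: "cone_bijection Q X ts us R" and S: "cone_bijection Q X us vs S"
  shows "cone_bijection Q X ts vs (R OO S)"
  unfolding cone_bijection_def
proof (intro conjI allI impI; (elim relcomppE)?)
  fix c e d assume "R c d" "S d e"
  then show "cone X ts c" "cone X vs e" "hd c = hd e" "last c = last e"
    using cone_bijectionD(1)[OF R] cone_bijectionD(1)[OF S] by metis+
next
  fix c assume "cone X ts c"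
  then obtain d where d: "R c d" using cone_bijectionD(2)[OF R] by blast
  then obtain e where "S d e" using cone_bijectionD(1)[OF R] cone_bijectionD(2)[OF S] by blast
  with d show "\<exists>e. (R OO S) c e" by blast
next
  fix e assume "cone X vs e"
  then obtain d where d: "S d e" using cone_bijectionD(3)[OF S] by blast
  then obtain c where "R c d" using cone_bijectionD(1)[OF S] cone_bijectionD(3)[OF R] by blast
  with d show "\<exists>c. (R OO S) c e" by blast
next
  fix c e c' e' d d' assume "R c d" "S d e" "R c' d'" "S d' e'"
  then show "c = c' \<longleftrightarrow> e = e'"
    using cone_bijectionD(4)[OF R] cone_bijectionD(4)[OF S] by metis
next
  fix c e k d assume *: "R c d" "S d e" and k: "k \<in> maps" "scod k = sdom (hd c)"
  have "scod k = sdom (hd d)"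
    using cone_bijectionD(1)[OF R *(1)] k by simp
  then show "(R OO S) (restrict_cone c k) (restrict_cone e k)"
    using cone_bijectionD(5)[OF R *(1) k] cone_bijectionD(5)[OF S *(2) k(1)] by blast
next
  fix c e d assume "determined_fibered_products (Sp \<G>) Q" "R c d" "S d e"
  then show "distinguished Q X ts c = distinguished Q X vs e"
    using cone_bijectionD(6)[OF R] cone_bijectionD(6)[OF S] by metis
qed

definition extend_relation :: "'f basic \<Rightarrow> ('f list \<Rightarrow> 'f list \<Rightarrow> bool) \<Rightarrow> 'f list \<Rightarrow> 'f list \<Rightarrow> bool" where
  "extend_relation b R c' d' \<longleftrightarrow> (\<exists>v c d. c' = v # c \<and> d' = v # d \<and> R c d \<and> step b v (hd c))"

text \<open>The distinguished cone over \<open>f\<^sup>* F\<close> depends only on the leg to the target of the one over \<open>F\<close>, and it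
restricts the rest along a map; the bijection keeps the leg and commutes with restriction.\<close>

lemma distinguished_Pull_transfer:
  assumes R: "cone_bijection Q X ts us R" and "R c d" and ty: "typed ts X (letter_src (Pull f))"
    and Q: "determined_fibered_products (Sp \<G>) Q" and "distinguished Q X (Pull f # ts) (v # c)"
  shows "distinguished Q X (Pull f # us) (v # d)"
proof -
  obtain e f' where e: "distinguished Q X ts e" "Q (hd e) f v f'" "c = restrict_cone e f'"
    using assms(5) by auto
  obtain e' where e': "R e e'"
    using cone_bijectionD(2)[OF R distinguished_cone[OF Q ty e(1)]] by blast
  note sq = cartesian_square[OF determined_cartesian[OF Q e(2)]]
  have "d = restrict_cone e' f'"
    using cone_bijectionD(4)[OF R assms(2) cone_bijectionD(5)[OF R e' sq(4,8)]] e(3) by simp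
  moreover have "distinguished Q X us e'" "hd e' = hd e"
    using cone_bijectionD(1,6)[OF R] Q e' e(1) by auto
  ultimately show ?thesis
    using e(2) by (simp only: distinguished.simps) metis
qed

lemma cone_bijection_letter:
  assumes R: "cone_bijection Q X ts us R" and b: "letter b"
    and ty: "typed ts X (letter_src b)" "typed us X (letter_src b)"
  shows "cone_bijection Q X (b # ts) (b # us) (extend_relation b R)"
proof -
  have SI: "extend_relation b R (v # c) (v # d)" if "R c d" "step b v (hd c)" for v c d
    using that by (auto simp: extend_relation_def)
  show ?thesis
    unfolding cone_bijection_def
  proof (intro conjI allI impI)
    fix c' d' assume "extend_relation b R c' d'"
    then obtain v c d where *: "c' = v # c" "d' = v # d" "R c d" "step b v (hd c)"
      by (auto simp: extend_relation_def)
    note c = cone_bijectionD(1)[OF R *(3)]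
    show "cone X (b # ts) c'" "cone X (b # us) d'" "hd c' = hd d'" "last c' = last d'"
      using * c cone_nonempty[of X ts c] cone_nonempty[of X us d] by auto
  next
    fix c' assume "cone X (b # ts) c'"
    then obtain v c where *: "c' = v # c" "cone X ts c" "step b v (hd c)" by auto
    then show "\<exists>d'. extend_relation b R c' d'"
      using cone_bijectionD(2)[OF R *(2)] SI by blast
  next
    fix d' assume "cone X (b # us) d'"
    then obtain v d where *: "d' = v # d" "cone X us d" "step b v (hd d)" by auto
    then obtain c where c: "R c d"
      using cone_bijectionD(3)[OF R] by blast
    then show "\<exists>c'. extend_relation b R c' d'"
      using cone_bijectionD(1)[OF R c] SI[OF c, of v] * by auto
  next
    fix c d c' d' assume "extend_relation b R c d" "extend_relation b R c' d'"
    then show "c = c' \<longleftrightarrow> d = d'"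
      using cone_bijectionD(4)[OF R] by (auto simp: extend_relation_def)
  next
    fix c' d' k assume S: "extend_relation b R c' d'" and k: "k \<in> maps" "scod k = sdom (hd c')"
    then obtain v c d where *: "c' = v # c" "d' = v # d" "R c d" "step b v (hd c)"
      by (auto simp: extend_relation_def)
    note c = cone_bijectionD(1)[OF R *(3)]
    have ends: "hd c \<in> maps" "scod (hd c) = letter_src b"
      using cone_ends[OF ty(1), of c] c by auto
    have kv: "scod k = sdom v" "scod k = sdom (hd c)"
      using k * step_sdom(2)[OF *(4) b ends] by simp_all
    have "hd (restrict_cone c k) = hd c \<star> k"
      using c cone_nonempty[of X ts c] by (simp add: hd_map)
    then show "extend_relation b R (restrict_cone c' k) (restrict_cone d' k)"
      using SI[OF cone_bijectionD(5)[OF R *(3) k(1) kv(2)], of "v \<star> k"]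
        step_restrict[OF *(4) b ends k(1) kv(1)] *(1,2)
      by simp
  next
    fix c' d' assume Q: "determined_fibered_products (Sp \<G>) Q" and S: "extend_relation b R c' d'"
    then obtain v c d where *: "c' = v # c" "d' = v # d" "R c d" "step b v (hd c)"
      by (auto simp: extend_relation_def)
    show "distinguished Q X (b # ts) c' = distinguished Q X (b # us) d'"
    proof (cases b)
      case (Push f)
      then show ?thesis
        using *(1,2) cone_bijectionD(1)[OF R *(3)] cone_bijectionD(6)[OF R Q *(3)] by auto
    next
      case (Pull f)
      have "R\<inverse>\<inverse> d c"
        using *(3) by simp
      then show ?thesis
        unfolding *(1,2) Pull
        using distinguished_Pull_transfer[OF R *(3) _ Q, of f v]
          distinguished_Pull_transfer[OF cone_bijection_converse[OF R] _ _ Q, of d c f v] ty Pull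
        by blast
    qed
  qed
qed

text \<open>A transformation transports cones if it turns extension along a cone over its target into extension along the
matching cone over its source. For a target \<open>a\<^sub>* b\<^sup>*\<close> it is determined by the cone that it matches with
\<open>(a, id, b)\<close>.\<close>

definition transports :: "('f \<Rightarrow> 'f \<Rightarrow> 'f \<Rightarrow> 'f \<Rightarrow> bool) \<Rightarrow> 'x \<Rightarrow> 'x \<Rightarrow> 'f basic list \<Rightarrow>
    'f basic list \<Rightarrow> ('s \<Rightarrow> 'a) \<Rightarrow> bool" where
  "transports Q X Z ts us \<phi> \<longleftrightarrow> typed ts X Z \<and> typed us X Z \<and> between X ts us \<phi> \<and>
     (\<exists>R. cone_bijection Q X ts us R \<and>
       (\<forall>c d B \<alpha>. R c d \<longrightarrow> cone_data X c B \<alpha> \<longrightarrow>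
          along ts c B \<alpha> = along us d B \<alpha> \<bullet> \<phi> (adom \<alpha>)))"

lemma transports_relation:
  assumes "transports Q X Z ts us \<phi>"
  obtains R where "cone_bijection Q X ts us R"
    "\<And>c d B \<alpha>. R c d \<Longrightarrow> cone_data X c B \<alpha> \<Longrightarrow>
      along ts c B \<alpha> = along us d B \<alpha> \<bullet> \<phi> (adom \<alpha>)"
  using assms unfolding transports_def by blast

lemma along_data:
  assumes "typed ts X Z" "cone X ts c" "cone_data X c B \<alpha>"
  shows "vert (along ts c B \<alpha>)" "adom (along ts c B \<alpha>) = wordO ts (adom \<alpha>)"
    "acod (along ts c B \<alpha>) = lowO (hd c) B"
  using along_arr[OF assms(1,2), of B \<alpha>] assms(3) by (auto simp: cone_data_def)

lemma cone_data_tail: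
  assumes "typed (b # ts) X Z" "cone X (b # ts) (v # e)" "cone_data X (v # e) B \<alpha>"
  shows "cone_data X e B \<alpha>"
proof -
  have e: "cone X ts e" "step b v (hd e)" "letter b" "typed ts X (letter_src b)"
    using assms by auto
  have "sdom (hd e) = sdom v"
    using step_sdom(2)[OF e(2,3)] cone_ends[OF e(4,1)] by simp
  then show ?thesis
    using assms(3) cone_nonempty[OF e(1)] by (auto simp: cone_data_def)
qed

lemma transports_id:
  assumes ts: "typed ts X Z"
  shows "transports Q X Z ts ts (\<lambda>A. ide (wordO ts A))"
proof -
  have "cone_bijection Q X ts ts (\<lambda>c d. cone X ts c \<and> c = d)"
    using cone_restrict[OF ts] by (auto simp: cone_bijection_def)
  moreover have "along ts c B \<alpha> = along ts c B \<alpha> \<bullet> ide (wordO ts (adom \<alpha>))"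
    if "cone X ts c" "cone_data X c B \<alpha>" for c B \<alpha>
    using along_data[OF ts that] by simp
  moreover have "between X ts ts (\<lambda>A. ide (wordO ts A))"
    using word_obj[OF ts] by (simp add: between_def)
  ultimately show ?thesis
    using ts unfolding transports_def by blast
qed

lemma transports_comp:
  assumes \<phi>: "transports Q X Z ts us \<phi>" and \<psi>: "transports Q X Z us vs \<psi>"
  shows "transports Q X Z ts vs (\<lambda>A. \<psi> A \<bullet> \<phi> A)"
proof -
  obtain R where R: "cone_bijection Q X ts us R"
    and aR: "\<And>c d B \<alpha>. R c d \<Longrightarrow> cone_data X c B \<alpha> \<Longrightarrow>
      along ts c B \<alpha> = along us d B \<alpha> \<bullet> \<phi> (adom \<alpha>)"
    by (rule transports_relation[OF \<phi>]) blast
  obtain S where S: "cone_bijection Q X us vs S"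
    and aS: "\<And>c d B \<alpha>. S c d \<Longrightarrow> cone_data X c B \<alpha> \<Longrightarrow>
      along us c B \<alpha> = along vs d B \<alpha> \<bullet> \<psi> (adom \<alpha>)"
    by (rule transports_relation[OF \<psi>]) blast
  have ty: "typed ts X Z" "typed us X Z" "typed vs X Z" "between X ts us \<phi>" "between X us vs \<psi>"
    using assms by (auto simp: transports_def)
  have "along ts c B \<alpha> = along vs e B \<alpha> \<bullet> \<psi> (adom \<alpha>) \<bullet> \<phi> (adom \<alpha>)"
    if "R c d" "S d e" "cone_data X c B \<alpha>" for c d e B \<alpha>
  proof -
    note c = cone_bijectionD(1)[OF R that(1)] and d = cone_bijectionD(1)[OF S that(2)]
    have data: "cone_data X d B \<alpha>" "cone_data X e B \<alpha>"
      using that(3) c d by (auto simp: cone_data_def)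
    have A: "shape (adom \<alpha>)" "base (adom \<alpha>) = X"
      using that(3) by (auto simp: cone_data_def)
    have "along ts c B \<alpha> = (along vs e B \<alpha> \<bullet> \<psi> (adom \<alpha>)) \<bullet> \<phi> (adom \<alpha>)"
      using aR[OF that(1,3)] aS[OF that(2) data(1)] by simp
    then show ?thesis
      using along_data[OF ty(3) _ data(2)] d between_arr[OF ty(4) A] between_arr[OF ty(5) A] by simp
  qed
  then have "\<forall>c e B \<alpha>. (R OO S) c e \<longrightarrow> cone_data X c B \<alpha> \<longrightarrow>
      along ts c B \<alpha> = along vs e B \<alpha> \<bullet> \<psi> (adom \<alpha>) \<bullet> \<phi> (adom \<alpha>)"
    by blast
  moreover have "between X ts vs (\<lambda>A. \<psi> A \<bullet> \<phi> A)"
    using ty by (auto simp: between_def)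
  ultimately show ?thesis
    using ty cone_bijection_comp[OF R S] unfolding transports_def by blast
qed

lemma transports_inverse:
  assumes \<phi>: "transports Q X Z ts us \<phi>" and \<psi>: "between X us ts \<psi>"
    and inv: "\<And>A. shape A \<Longrightarrow> base A = X \<Longrightarrow> \<phi> A \<bullet> \<psi> A = ide (wordO us A)"
  shows "transports Q X Z us ts \<psi>"
proof -
  obtain R where R: "cone_bijection Q X ts us R"
    and aR: "\<And>c d B \<alpha>. R c d \<Longrightarrow> cone_data X c B \<alpha> \<Longrightarrow>
      along ts c B \<alpha> = along us d B \<alpha> \<bullet> \<phi> (adom \<alpha>)"
    by (rule transports_relation[OF \<phi>]) blast
  have ty: "typed ts X Z" "typed us X Z" "between X ts us \<phi>"
    using \<phi> by (auto simp: transports_def)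
  have "along us d B \<alpha> = along ts c B \<alpha> \<bullet> \<psi> (adom \<alpha>)"
    if "R\<inverse>\<inverse> d c" "cone_data X d B \<alpha>" for c d B \<alpha>
  proof -
    have r: "R c d"
      using that(1) by simp
    note c = cone_bijectionD(1)[OF R r]
    have data: "cone_data X c B \<alpha>"
      using that(2) c by (auto simp: cone_data_def)
    have A: "shape (adom \<alpha>)" "base (adom \<alpha>) = X"
      using that(2) by (auto simp: cone_data_def)
    have us: "cone X us d"
      using c by simp
    have "along ts c B \<alpha> \<bullet> \<psi> (adom \<alpha>) = (along us d B \<alpha> \<bullet> \<phi> (adom \<alpha>)) \<bullet> \<psi> (adom \<alpha>)"
      using aR[OF r data] by simp
    also have "\<dots> = along us d B \<alpha> \<bullet> \<phi> (adom \<alpha>) \<bullet> \<psi> (adom \<alpha>)"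
      using along_data[OF ty(2) us that(2)] between_arr[OF ty(3) A] between_arr[OF \<psi> A] by simp
    also have "\<dots> = along us d B \<alpha>"
      using along_data[OF ty(2) us that(2)] inv[OF A] by simp
    finally show ?thesis by simp
  qed
  then show ?thesis
    using ty \<psi> cone_bijection_converse[OF R] unfolding transports_def by blast
qed

lemma transports_letter:
  assumes \<phi>: "transports Q X Z ts us \<phi>" and b: "letter b" "letter_src b = Z"
  shows "transports Q X (letter_tgt b) (b # ts) (b # us) (\<lambda>A. letterA b (\<phi> A))"
proof -
  obtain R where R: "cone_bijection Q X ts us R"
    and aR: "\<And>c d B \<alpha>. R c d \<Longrightarrow> cone_data X c B \<alpha> \<Longrightarrow>
      along ts c B \<alpha> = along us d B \<alpha> \<bullet> \<phi> (adom \<alpha>)"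
    by (rule transports_relation[OF \<phi>]) blast
  have ty: "typed ts X (letter_src b)" "typed us X (letter_src b)" "between X ts us \<phi>"
    using \<phi> b by (auto simp: transports_def)
  have tyb: "typed (b # ts) X (letter_tgt b)" "typed (b # us) X (letter_tgt b)"
    using ty b by auto
  have "along (b # ts) c' B \<alpha> = along (b # us) d' B \<alpha> \<bullet> letterA b (\<phi> (adom \<alpha>))"
    if S: "extend_relation b R c' d'" and data: "cone_data X c' B \<alpha>" for c' d' B \<alpha>
  proof -
    obtain v c d where *: "c' = v # c" "d' = v # d" "R c d" "step b v (hd c)"
      using S by (auto simp: extend_relation_def)
    note c = cone_bijectionD(1)[OF R *(3)]
    have ends: "hd c \<in> maps" "scod (hd c) = letter_src b"
      using cone_ends[OF ty(1), of c] c by auto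
    have d: "cone_data X c B \<alpha>"
      using cone_data_tail[OF tyb(1)] data * c by auto
    then have d': "cone_data X d B \<alpha>"
      using c by (simp add: cone_data_def)
    have A: "shape (adom \<alpha>)" "base (adom \<alpha>) = X" "shape B" "base B = sdom (hd c)"
      using d by (auto simp: cone_data_def)
    have cd: "cone X us d" "hd c = hd d"
      using c by auto
    have "step_arr b v (hd c) B (along us d B \<alpha> \<bullet> \<phi> (adom \<alpha>)) =
        step_arr b v (hd c) B (along us d B \<alpha>) \<bullet> letterA b (\<phi> (adom \<alpha>))"
      by (rule step_arr_comp[OF b(1) *(4) ends A(3,4)])
        (use along_data[OF ty(2) cd(1) d'] cd between_arr[OF ty(3) A(1,2)] in simp_all)
    then show ?thesis
      using * cd aR[OF *(3) d] by simp
  qed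
  moreover have "between X (b # ts) (b # us) (\<lambda>A. letterA b (\<phi> A))"
    unfolding between_def
    using b between_arr[OF ty(3)] word_obj[OF ty(1)] by simp
  ultimately show ?thesis
    using tyb cone_bijection_letter[OF R b(1) ty(1,2)] unfolding transports_def by blast
qed

text \<open>For every generator, each cone over the target of the transformation yields one over its source by a formula \<open>\<rho>\<close>,
since the extra legs over the source are composites. This is the direction to define, also for base
change.\<close>

lemma transports_by_pullback:
  assumes ty: "typed ts X Z" "typed us X Z" "between X ts us \<phi>"
    and cone: "\<And>d. cone X us d \<Longrightarrow> cone X ts (\<rho> d) \<and> hd (\<rho> d) = hd d \<and> last (\<rho> d) = last d"
    and inj: "\<And>d d'. cone X us d \<Longrightarrow> cone X us d' \<Longrightarrow> \<rho> d = \<rho> d' \<Longrightarrow> d = d'"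
    and surj: "\<And>c. cone X ts c \<Longrightarrow> \<exists>d. cone X us d \<and> \<rho> d = c"
    and restrict: "\<And>d k. cone X us d \<Longrightarrow> k \<in> maps \<Longrightarrow> scod k = sdom (hd d) \<Longrightarrow>
      \<rho> (restrict_cone d k) = restrict_cone (\<rho> d) k"
    and dist: "\<And>d. determined_fibered_products (Sp \<G>) Q \<Longrightarrow> cone X us d \<Longrightarrow>
      distinguished Q X ts (\<rho> d) = distinguished Q X us d"
    and along: "\<And>d B \<alpha>. cone X us d \<Longrightarrow> cone_data X d B \<alpha> \<Longrightarrow>
      along ts (\<rho> d) B \<alpha> = along us d B \<alpha> \<bullet> \<phi> (adom \<alpha>)"
  shows "transports Q X Z ts us \<phi>"
proof -
  have "cone_bijection Q X ts us (\<lambda>c d. cone X us d \<and> c = \<rho> d)"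
    unfolding cone_bijection_def
  proof (intro conjI allI impI; (elim conjE)?)
    fix c d k assume "cone X us d" "c = \<rho> d" "k \<in> maps" "scod k = sdom (hd c)"
    then show "cone X us (restrict_cone d k)" "restrict_cone c k = \<rho> (restrict_cone d k)"
      using cone_restrict[OF ty(2)] restrict cone by simp_all
  next
    fix c d c' d' assume "cone X us d" "c = \<rho> d" "cone X us d'" "c' = \<rho> d'"
    then show "c = c' \<longleftrightarrow> d = d'" using inj by blast
  qed (use cone surj dist in auto)
  moreover have "along ts c B \<alpha> = along us d B \<alpha> \<bullet> \<phi> (adom \<alpha>)"
    if "cone X us d \<and> c = \<rho> d" "cone_data X c B \<alpha>" for c d B \<alpha>
    using that along cone by (simp add: cone_data_def)
  ultimately show ?thesis
    using ty unfolding transports_def by blast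
qed


section \<open>Transport along the generators\<close>

lemma cone_Cons:
  assumes "typed (b # ts) X Z" "cone X (b # ts) d"
  obtains v e where "d = v # e" "cone X ts e" "step b v (hd e)" "typed ts X (letter_src b)" "e \<noteq> []"
    "hd e \<in> maps" "scod (hd e) = letter_src b" "v \<in> maps" "scod v = Z" "sdom (hd e) = sdom v"
proof -
  obtain v e where e: "d = v # e" "cone X ts e" "step b v (hd e)"
    using assms(2) by auto
  have ty: "typed ts X (letter_src b)" "letter b"
    using assms(1) by auto
  have ends: "hd e \<in> maps" "scod (hd e) = letter_src b"
    using cone_ends[OF ty(1) e(2)] by auto
  show ?thesis
    using that[OF e ty(1) cone_nonempty[OF e(2)] ends] step_sdom[OF e(3) ty(2) ends] assms(1) by simp
qed

lemma restrict_cone_ide: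
  assumes "typed ts X Z" "cone X ts c" "Y = sdom (hd c)"
  shows "restrict_cone c (side Y) = c"
  using assms
proof (induction ts arbitrary: Z c)
  case (Cons b ts)
  then obtain v e where e: "c = v # e" "cone X ts e" "typed ts X (letter_src b)"
    "v \<in> maps" "sdom (hd e) = sdom v"
    using cone_Cons[of b ts X Z c] by metis
  then show ?case
    using Cons.IH[OF e(3,2)] Cons.prems(3) by simp
qed auto

lemma restrict_cone_comp:
  assumes "typed ts X Z" "cone X ts c" "k \<in> maps" "scod k = sdom (hd c)" "l \<in> maps" "scod l = sdom k"
  shows "restrict_cone (restrict_cone c k) l = restrict_cone c (k \<star> l)"
  using assms(1,2,4)
proof (induction ts arbitrary: Z c)
  case Nil
  then show ?case using assms(3,5,6) by (auto simp: map_assoc)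
next
  case (Cons b ts)
  then obtain v e where e: "c = v # e" "cone X ts e" "typed ts X (letter_src b)"
    "v \<in> maps" "sdom (hd e) = sdom v"
    using cone_Cons[of b ts X Z c] by metis
  then show ?case
    using Cons.IH[OF e(3,2)] Cons.prems(3) assms(3,5,6) by (simp add: map_assoc)
qed

lemma hd_restrict_cone: "c \<noteq> [] \<Longrightarrow> hd (restrict_cone c k) = hd c \<star> k"
  by (simp add: hd_map)

lemma along_Cons_data:
  assumes "typed (b # ts) X Z" "cone X (b # ts) (v # e)" "cone_data X (v # e) B \<alpha>"
  shows "vert (along ts e B \<alpha>)" "adom (along ts e B \<alpha>) = wordO ts (adom \<alpha>)"
    "acod (along ts e B \<alpha>) = lowO (hd e) B" "shape B" "base B = sdom (hd e)"
proof -
  have "typed ts X (letter_src b)" "cone X ts e"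
    using assms by auto
  note * = this cone_data_tail[OF assms]
  show "vert (along ts e B \<alpha>)" "adom (along ts e B \<alpha>) = wordO ts (adom \<alpha>)"
    "acod (along ts e B \<alpha>) = lowO (hd e) B" "shape B" "base B = sdom (hd e)"
    using along_data[OF *] *(3) by (auto simp: cone_data_def)
qed

lemma transports_compL:
  assumes f: "f \<in> maps" "g \<in> maps" "scod f = sdom g" and ty: "typed ts X (sdom f)"
  shows "transports Q X (scod g) (Push g # Push f # ts) (Push (g \<star> f) # ts)
    (\<lambda>A. cL f g (wordO ts A))"
proof (rule transports_by_pullback[where \<rho> = "\<lambda>d. hd d # (f \<star> hd (tl d)) # tl d"])
  have ty': "typed (Push (g \<star> f) # ts) X (scod g)"
    using f ty by simp
  show "typed (Push g # Push f # ts) X (scod g)" "typed (Push (g \<star> f) # ts) X (scod g)"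
    using f ty by simp_all
  show "between X (Push g # Push f # ts) (Push (g \<star> f) # ts) (\<lambda>A. cL f g (wordO ts A))"
    using f word_obj[OF ty] by (simp add: between_def)
  fix d assume d: "cone X (Push (g \<star> f) # ts) d"
  then obtain v e where ve: "d = v # e" "cone X ts e" "v = (g \<star> f) \<star> hd e"
    by auto
  then have e: "d = ((g \<star> f) \<star> hd e) # e" "cone X ts e" "e \<noteq> []" "hd e \<in> maps" "scod (hd e) = sdom f"
    using cone_nonempty[OF ve(2)] cone_ends[OF ty ve(2)] by auto
  show "cone X (Push g # Push f # ts) (hd d # (f \<star> hd (tl d)) # tl d) \<and>
    hd (hd d # (f \<star> hd (tl d)) # tl d) = hd d \<and> last (hd d # (f \<star> hd (tl d)) # tl d) = last d"
    using e f by (simp add: map_assoc)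
  show "hd (restrict_cone d k) # (f \<star> hd (tl (restrict_cone d k))) # tl (restrict_cone d k) =
      restrict_cone (hd d # (f \<star> hd (tl d)) # tl d) k"
    if "k \<in> maps" "scod k = sdom (hd d)" for k
    using e f that by (simp add: map_assoc hd_restrict_cone)
  show "distinguished Q X (Push g # Push f # ts) (hd d # (f \<star> hd (tl d)) # tl d) =
      distinguished Q X (Push (g \<star> f) # ts) d"
    using e f by (auto simp: map_assoc)
  show "along (Push g # Push f # ts) (hd d # (f \<star> hd (tl d)) # tl d) B \<alpha> =
      along (Push (g \<star> f) # ts) d B \<alpha> \<bullet> cL f g (wordO ts (adom \<alpha>))"
    if "cone_data X d B \<alpha>" for B \<alpha>
    using step_compL[OF f e(4,5), of B "along ts e B \<alpha>" "wordO ts (adom \<alpha>)" "(g \<star> f) \<star> hd e" "f \<star> hd e"]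
      along_Cons_data[OF ty', of _ e] d that e(1) by simp
  fix d' assume "cone X (Push (g \<star> f) # ts) d'"
  then show "d = d'" if "hd d # (f \<star> hd (tl d)) # tl d = hd d' # (f \<star> hd (tl d')) # tl d'"
    using that e(1) by auto
next
  fix c assume c: "cone X (Push g # Push f # ts) c"
  then obtain v u e where e: "c = v # u # e" "cone X ts e" "u = f \<star> hd e" "v = g \<star> u" by auto
  then show "\<exists>d. cone X (Push (g \<star> f) # ts) d \<and> hd d # (f \<star> hd (tl d)) # tl d = c"
    using f cone_ends[OF ty e(2)] by (intro exI[of _ "v # e"]) (simp add: map_assoc)
qed

lemma transports_trivL:
  assumes ty: "typed ts X Y"
  shows "transports Q X Y (Push (side Y) # ts) ts (\<lambda>A. trivL \<G> Y (wordO ts A))"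
proof (rule transports_by_pullback[where \<rho> = "\<lambda>d. hd d # d"])
  note Y = typed_spaces(2)[OF ty]
  show "typed (Push (side Y) # ts) X Y" "typed ts X Y"
    using Y ty by simp_all
  show "between X (Push (side Y) # ts) ts (\<lambda>A. trivL \<G> Y (wordO ts A))"
    using Y word_obj[OF ty] by (simp add: between_def)
  fix d assume d: "cone X ts d"
  note ends = cone_ends[OF ty d] cone_nonempty[OF d]
  show "cone X (Push (side Y) # ts) (hd d # d) \<and> hd (hd d # d) = hd d \<and> last (hd d # d) = last d"
    using d ends Y by simp
  show "hd (restrict_cone d k) # restrict_cone d k = restrict_cone (hd d # d) k" for k
    using ends by (simp add: hd_restrict_cone)
  show "distinguished Q X (Push (side Y) # ts) (hd d # d) = distinguished Q X ts d"
    using ends by simp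
  show "along (Push (side Y) # ts) (hd d # d) B \<alpha> = along ts d B \<alpha> \<bullet> trivL \<G> Y (wordO ts (adom \<alpha>))"
    if "cone_data X d B \<alpha>" for B \<alpha>
    using step_trivL[of "hd d" Y B "along ts d B \<alpha>" "wordO ts (adom \<alpha>)" "hd d"] ends
      along_data[OF ty d that] that by (simp add: cone_data_def)
next
  fix c assume c: "cone X (Push (side Y) # ts) c"
  then obtain v e where e: "c = v # e" "cone X ts e" "v = side Y \<star> hd e" by auto
  then show "\<exists>d. cone X ts d \<and> hd d # d = c"
    using cone_ends[OF ty e(2)] by auto
qed auto

text \<open>The distinguished base change of a leg along an identity is the leg itself, so the distinguished cone does not
change.\<close>

lemma transports_trivU:
  assumes ty: "typed ts X Y"
  shows "transports Q X Y (Pull (side Y) # ts) ts (\<lambda>A. trivU \<G> Y (wordO ts A))"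
proof (rule transports_by_pullback[where \<rho> = "\<lambda>d. hd d # d"])
  note Y = typed_spaces(2)[OF ty]
  show "typed (Pull (side Y) # ts) X Y" "typed ts X Y"
    using Y ty by simp_all
  show "between X (Pull (side Y) # ts) ts (\<lambda>A. trivU \<G> Y (wordO ts A))"
    using Y word_obj[OF ty] by (simp add: between_def)
  fix d assume d: "cone X ts d"
  note ends = cone_ends[OF ty d] cone_nonempty[OF d]
  show "cone X (Pull (side Y) # ts) (hd d # d) \<and> hd (hd d # d) = hd d \<and> last (hd d # d) = last d"
    using d ends Y by simp
  show "hd (restrict_cone d k) # restrict_cone d k = restrict_cone (hd d # d) k" for k
    using ends by (simp add: hd_restrict_cone)
  show "along (Pull (side Y) # ts) (hd d # d) B \<alpha> = along ts d B \<alpha> \<bullet> trivU \<G> Y (wordO ts (adom \<alpha>))"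
    if "cone_data X d B \<alpha>" for B \<alpha>
    using step_trivU[of "hd d" Y B "along ts d B \<alpha>" "wordO ts (adom \<alpha>)"] ends
      along_data[OF ty d that] that by (simp add: cone_data_def)
  show "distinguished Q X (Pull (side Y) # ts) (hd d # d) = distinguished Q X ts d"
    if Q: "determined_fibered_products (Sp \<G>) Q"
  proof
    have Qd: "Q (hd e) (side Y) (hd e) (side (sdom (hd e)))" if "distinguished Q X ts e" for e
      using determined_ide(1)[OF Q, of "hd e"] cone_ends[OF ty distinguished_cone[OF Q ty that]] by simp
    have r: "restrict_cone e (side (sdom (hd e))) = e" if "distinguished Q X ts e" for e
      using restrict_cone_ide[OF ty distinguished_cone[OF Q ty that]] by simp
    show "distinguished Q X (Pull (side Y) # ts) (hd d # d)" if "distinguished Q X ts d"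
      using that Qd[OF that] r[OF that] by (simp only: distinguished.simps) metis
    assume "distinguished Q X (Pull (side Y) # ts) (hd d # d)"
    then obtain e f' where e: "distinguished Q X ts e" "Q (hd e) (side Y) (hd d) f'"
      "d = restrict_cone e f'"
      by auto
    then show "distinguished Q X ts d"
      using determined_unique[OF Q e(2) Qd[OF e(1)]] r[OF e(1)] by simp
  qed
next
  fix c assume c: "cone X (Pull (side Y) # ts) c"
  then obtain v e where e: "c = v # e" "cone X ts e" "hd e = side Y \<star> v" "v \<in> maps" "scod v = Y"
    using typed_spaces(2)[OF ty] by auto
  then show "\<exists>d. cone X ts d \<and> hd d # d = c"
    by auto
qed auto

text \<open>For the distinguished cones this is the pasting of two distinguished squares along \<open>f\<close> and \<open>g\<close> into one
along \<open>g f\<close>.\<close>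

lemma transports_compU:
  assumes f: "f \<in> maps" "g \<in> maps" "scod f = sdom g" and ty: "typed ts X (scod g)"
  shows "transports Q X (sdom f) (Pull f # Pull g # ts) (Pull (g \<star> f) # ts)
    (\<lambda>A. cU f g (wordO ts A))"
proof (rule transports_by_pullback[where \<rho> = "\<lambda>d. hd d # (f \<star> hd d) # tl d"])
  have ty': "typed (Pull (g \<star> f) # ts) X (sdom f)"
    using f ty by simp
  show "typed (Pull f # Pull g # ts) X (sdom f)" "typed (Pull (g \<star> f) # ts) X (sdom f)"
    using f ty by simp_all
  show "between X (Pull f # Pull g # ts) (Pull (g \<star> f) # ts) (\<lambda>A. cU f g (wordO ts A))"
    using f word_obj[OF ty] by (simp add: between_def)
  fix d assume d: "cone X (Pull (g \<star> f) # ts) d"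
  then obtain w e where e: "d = w # e" "cone X ts e" "hd e = (g \<star> f) \<star> w" "w \<in> maps" "scod w = sdom f"
    using f by auto
  have he: "hd e = g \<star> f \<star> w"
    using e f by (simp add: map_assoc)
  show "cone X (Pull f # Pull g # ts) (hd d # (f \<star> hd d) # tl d) \<and>
    hd (hd d # (f \<star> hd d) # tl d) = hd d \<and> last (hd d # (f \<star> hd d) # tl d) = last d"
    using e(1,2,4,5) f he cone_nonempty[OF e(2)] by simp
  show "hd (restrict_cone d k) # (f \<star> hd (restrict_cone d k)) # tl (restrict_cone d k) =
      restrict_cone (hd d # (f \<star> hd d) # tl d) k"
    if "k \<in> maps" "scod k = sdom (hd d)" for k
    using e(1,2,4,5) f that by (simp add: map_assoc)
  show "along (Pull f # Pull g # ts) (hd d # (f \<star> hd d) # tl d) B \<alpha> =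
      along (Pull (g \<star> f) # ts) d B \<alpha> \<bullet> cU f g (wordO ts (adom \<alpha>))"
    if "cone_data X d B \<alpha>" for B \<alpha>
  proof -
    have d': "cone X (Pull (g \<star> f) # ts) (w # e)" "cone_data X (w # e) B \<alpha>"
      using d that e(1) by auto
    have "base B = sdom w"
      using that e(1) by (simp add: cone_data_def)
    then show ?thesis
      using step_compU[OF f e(4,5) he, of B "along ts e B \<alpha>" "wordO ts (adom \<alpha>)"]
        along_Cons_data[OF ty' d'] e(1) by simp
  qed
  show "distinguished Q X (Pull f # Pull g # ts) (hd d # (f \<star> hd d) # tl d) =
      distinguished Q X (Pull (g \<star> f) # ts) d"
    if Q: "determined_fibered_products (Sp \<G>) Q"
  proof
    assume "distinguished Q X (Pull f # Pull g # ts) (hd d # (f \<star> hd d) # tl d)"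
    then obtain e1 f' where e1: "distinguished Q X (Pull g # ts) e1" "Q (hd e1) f w f'"
      "(f \<star> w) # e = restrict_cone e1 f'"
      unfolding e(1) list.sel by (rule distinguished_PullE)
    then obtain e0 v g' where "distinguished Q X ts e0" "Q (hd e0) g v g'" "e1 = v # restrict_cone e0 g'"
      by auto
    with e1 have *: "distinguished Q X ts e0" "Q (hd e0) g v g'" "Q v f w f'"
      "e = restrict_cone (restrict_cone e0 g') f'"
      by simp_all
    have ce: "cone X ts e0"
      using distinguished_cone[OF Q ty *(1)] .
    note sq = cartesian_square[OF determined_cartesian[OF Q *(2)]]
      cartesian_square[OF determined_cartesian[OF Q *(3)]]
    have a: "e = restrict_cone e0 (g' \<star> f')"
      using restrict_cone_comp[OF ty ce, of g' f'] sq *(4) by simp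
    show "distinguished Q X (Pull (g \<star> f) # ts) d"
      unfolding e(1) by (rule distinguished_PullI[OF *(1) determined_paste(1)[OF Q *(2,3)] a])
  next
    assume "distinguished Q X (Pull (g \<star> f) # ts) d"
    then obtain e0 h where *: "distinguished Q X ts e0" "Q (hd e0) (g \<star> f) w h" "e = restrict_cone e0 h"
      using e(1) by auto
    have ce: "cone X ts e0"
      using distinguished_cone[OF Q ty *(1)] .
    note ends = cone_ends[OF ty ce]
    obtain v g' where v: "Q (hd e0) g v g'"
      using determined_ex1[OF Q, of "hd e0" g] ends f by auto
    note sq = cartesian_square[OF determined_cartesian[OF Q v]]
    obtain w' f' where w: "Q v f w' f'"
      using determined_ex1[OF Q, of v f] sq f by auto
    note sq' = cartesian_square[OF determined_cartesian[OF Q w]]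
    have eq: "w' = w \<and> g' \<star> f' = h"
      using determined_unique[OF Q determined_paste(1)[OF Q v w] *(2)] .
    have a: "distinguished Q X (Pull g # ts) (v # restrict_cone e0 g')"
      using *(1) v by auto
    have b: "restrict_cone (v # restrict_cone e0 g') f' = (f \<star> w) # e"
      using restrict_cone_comp[OF ty ce, of g' f'] sq sq' eq *(3) by simp
    have c: "Q (hd (v # restrict_cone e0 g')) f w f'"
      using w eq by simp
    show "distinguished Q X (Pull f # Pull g # ts) (hd d # (f \<star> hd d) # tl d)"
      unfolding e(1) list.sel by (rule distinguished_PullI[where f' = f', OF a c b[symmetric]])
  qed
  fix d' assume "cone X (Pull (g \<star> f) # ts) d'"
  then show "d = d'" if "hd d # (f \<star> hd d) # tl d = hd d' # (f \<star> hd d') # tl d'"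
    using that e(1) by auto
next
  fix c assume c: "cone X (Pull f # Pull g # ts) c"
  then obtain w v e where e: "c = w # v # e" "cone X ts e" "v = f \<star> w" "hd e = g \<star> v" "w \<in> maps"
    "scod w = sdom f" by auto
  then show "\<exists>d. cone X (Pull (g \<star> f) # ts) d \<and> hd d # (f \<star> hd d) # tl d = c"
    using f by (intro exI[of _ "w # e"]) (simp add: map_assoc)
qed

text \<open>The projections of a fibered product are jointly monic.\<close>

lemma cartesian_cancel:
  assumes sq: "cartesian (Sp \<G>) f g f' g'" and "h \<in> maps" "k \<in> maps" "scod h = sdom f'"
    "scod k = sdom f'" "sdom h = sdom k" "g' \<star> h = g' \<star> k" "f' \<star> h = f' \<star> k"
  shows "h = k"
proof -
  note s = cartesian_square[OF sq]
  have "f \<star> g' \<star> h = g \<star> f' \<star> h"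
    using assms(2,4) s map_assoc[of h g' f] map_assoc[of h f' g] by simp
  then have "\<exists>!l. (l \<in> maps \<and> sdom l = sdom (g' \<star> h) \<and> scod l = sdom f') \<and> g' \<star> l = g' \<star> h \<and> f' \<star> l = f' \<star> h"
    using assms(2,4) s by (intro cartesian_lift[OF sq]) simp_all
  moreover have "sdom (g' \<star> h) = sdom h"
    using assms(2,4) s by simp
  ultimately show ?thesis
    using assms(2-8) by metis
qed

text \<open>A lift \<open>w\<close> of \<open>f u\<close> through \<open>g\<close> is the same as a map to the fibered product over \<open>u\<close>. For the
distinguished cones, base changing \<open>u\<close> along \<open>g'\<close> and pasting with the square of \<open>f\<close> and \<open>g\<close> gives the base
change of \<open>f u\<close> along \<open>g\<close>.\<close>

lemma transports_bc:
  assumes sq: "cartesian (Sp \<G>) f g f' g'" and Qsq: "Q f g f' g'" and ty: "typed ts X (sdom f)"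
  shows "transports Q X (sdom g) (Pull g # Push f # ts) (Push f' # Pull g' # ts)
    (\<lambda>A. bc \<G> f g f' g' (wordO ts A))"
proof (rule transports_by_pullback[where \<rho> = "\<lambda>d. hd d # (f \<star> hd (tl (tl d))) # tl (tl d)"])
  note s = cartesian_square[OF sq]
  show ty1: "typed (Pull g # Push f # ts) X (sdom g)" and ty': "typed (Push f' # Pull g' # ts) X (sdom g)"
    using s ty by simp_all
  have ty2: "typed (Pull g' # ts) X (sdom g')"
    using s ty by simp
  show "between X (Pull g # Push f # ts) (Push f' # Pull g' # ts) (\<lambda>A. bc \<G> f g f' g' (wordO ts A))"
    using s word_obj[OF ty] by (simp add: between_def bc_def Let_def cLi_def[symmetric])
  fix d assume d: "cone X (Push f' # Pull g' # ts) d"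
  then obtain w e where e: "d = (f' \<star> w) # w # e" "cone X ts e" "hd e = g' \<star> w" "w \<in> maps"
      "scod w = sdom f'"
    using s by auto
  note e_ne = cone_nonempty[OF e(2)]
  have fgu: "f \<star> g' \<star> u = g \<star> f' \<star> u" if "u \<in> maps" "scod u = sdom f'" for u
    using s that map_assoc[of u g' f] map_assoc[of u f' g] by simp
  note fg = fgu[OF e(4,5)]
  show "cone X (Pull g # Push f # ts) (hd d # (f \<star> hd (tl (tl d))) # tl (tl d)) \<and>
    hd (hd d # (f \<star> hd (tl (tl d))) # tl (tl d)) = hd d \<and>
    last (hd d # (f \<star> hd (tl (tl d))) # tl (tl d)) = last d"
    using e s e_ne fg by simp
  show "hd (restrict_cone d k) # (f \<star> hd (tl (tl (restrict_cone d k)))) # tl (tl (restrict_cone d k)) =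
      restrict_cone (hd d # (f \<star> hd (tl (tl d))) # tl (tl d)) k"
    if "k \<in> maps" "scod k = sdom (hd d)" for k
    using e s that e_ne fg fgu[of "w \<star> k"] by (simp add: map_assoc hd_restrict_cone)
  show "along (Pull g # Push f # ts) (hd d # (f \<star> hd (tl (tl d))) # tl (tl d)) B \<alpha> =
      along (Push f' # Pull g' # ts) d B \<alpha> \<bullet> bc \<G> f g f' g' (wordO ts (adom \<alpha>))"
    if data: "cone_data X d B \<alpha>" for B \<alpha>
  proof -
    have d1: "cone X (Push f' # Pull g' # ts) ((f' \<star> w) # w # e)" "cone_data X ((f' \<star> w) # w # e) B \<alpha>"
      using d data e(1) by auto
    have d2: "cone X (Pull g' # ts) (w # e)"
      using d1(1) by auto
    note a = along_Cons_data[OF ty2 d2 cone_data_tail[OF ty' d1]]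
    have B: "base B = sdom w"
      using d1(2) e(4,5) s by (simp add: cone_data_def)
    show ?thesis
      using step_bc[OF s e(4,5) e(3) a(4) B a(1,3,2), of "f' \<star> w" "f \<star> hd e"] e(1) by simp
  qed
  show "distinguished Q X (Pull g # Push f # ts) (hd d # (f \<star> hd (tl (tl d))) # tl (tl d)) =
      distinguished Q X (Push f' # Pull g' # ts) d"
    if Q: "determined_fibered_products (Sp \<G>) Q"
  proof
    assume "distinguished Q X (Push f' # Pull g' # ts) d"
    then have "distinguished Q X (Pull g' # ts) (w # e)"
      using e(1) by (simp del: distinguished.simps(3))
    then obtain e0 h where *: "distinguished Q X ts e0" "Q (hd e0) g' w h" "e = restrict_cone e0 h"
      by auto
    have ce: "cone X ts e0"
      using distinguished_cone[OF Q ty *(1)] .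
    note ends = cone_ends[OF ty ce] cone_nonempty[OF ce]
    note s' = cartesian_square[OF determined_cartesian[OF Q *(2)]]
    have a: "distinguished Q X (Push f # ts) ((f \<star> hd e0) # e0)"
      using *(1) by simp
    have b: "Q (hd ((f \<star> hd e0) # e0)) g (f' \<star> w) h"
      using determined_paste(2)[OF Q Qsq *(2)] by simp
    have c: "restrict_cone ((f \<star> hd e0) # e0) h = (f \<star> hd e) # e"
      using *(3) ends s s' by (simp add: hd_restrict_cone map_assoc)
    show "distinguished Q X (Pull g # Push f # ts) (hd d # (f \<star> hd (tl (tl d))) # tl (tl d))"
      unfolding e(1) list.sel
      by (rule distinguished_PullI[where f' = h, OF a b c[symmetric]])
  next
    assume "distinguished Q X (Pull g # Push f # ts) (hd d # (f \<star> hd (tl (tl d))) # tl (tl d))"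
    then obtain e1 h where e1: "distinguished Q X (Push f # ts) e1" "Q (hd e1) g (f' \<star> w) h"
      "(f \<star> hd e) # e = restrict_cone e1 h"
      unfolding e(1) list.sel by (rule distinguished_PullE)
    then obtain e0 where "distinguished Q X ts e0" "e1 = (f \<star> hd e0) # e0"
      by auto
    with e1 have *: "distinguished Q X ts e0" "Q (f \<star> hd e0) g (f' \<star> w) h" "e = restrict_cone e0 h"
      by simp_all
    have ce: "cone X ts e0"
      using distinguished_cone[OF Q ty *(1)] .
    note ends = cone_ends[OF ty ce] cone_nonempty[OF ce]
    obtain w1 h1 where w1: "Q (hd e0) g' w1 h1"
      using determined_ex1[OF Q, of "hd e0" g'] ends s by auto
    note s' = cartesian_square[OF determined_cartesian[OF Q w1]]
    have eq: "f' \<star> w1 = f' \<star> w" "h1 = h"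
      using determined_unique[OF Q determined_paste(2)[OF Q Qsq w1] *(2)] by simp_all
    have "g' \<star> w1 = g' \<star> w"
      using s' eq(2) *(3) e(3) ends by (simp add: hd_restrict_cone)
    moreover have "sdom w1 = sdom w"
      using eq(1) s s' e(4,5) map_comp(2)[of w1 f'] map_comp(2)[of w f'] by simp
    ultimately have "w1 = w"
      using cartesian_cancel[OF sq, of w1 w] eq(1) s s' e(4,5) by simp
    then show "distinguished Q X (Push f' # Pull g' # ts) d"
      using distinguished_PullI[where f' = h, OF *(1) _ *(3), of g' w] w1 eq(2) e(1)
      by (simp del: distinguished.simps(3))
  qed
  fix d' assume "cone X (Push f' # Pull g' # ts) d'"
  then obtain w' e' where e': "d' = (f' \<star> w') # w' # e'" "cone X ts e'" "hd e' = g' \<star> w'" "w' \<in> maps"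
      "scod w' = sdom f'"
    using s by auto
  show "d = d'" if "hd d # (f \<star> hd (tl (tl d))) # tl (tl d) = hd d' # (f \<star> hd (tl (tl d'))) # tl (tl d')"
  proof -
    have eq: "e = e'" "f' \<star> w = f' \<star> w'"
      using that e(1) e'(1) by auto
    have "sdom w = sdom w'"
      using eq(2) s e(4,5) e'(4,5) map_comp(2)[of w f'] map_comp(2)[of w' f'] by simp
    then have "w = w'"
      using cartesian_cancel[OF sq, of w w'] eq e(3,4,5) e'(3,4,5) by simp
    then show ?thesis
      using eq e(1) e'(1) by simp
  qed
next
  note s = cartesian_square[OF sq]
  fix c assume c: "cone X (Pull g # Push f # ts) c"
  then obtain w e where e: "c = w # (f \<star> hd e) # e" "cone X ts e" "f \<star> hd e = g \<star> w" "w \<in> maps"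
    "scod w = sdom g" by auto
  note ends = cone_ends[OF ty e(2)]
  have "sdom (hd e) = sdom w"
    using map_comp(2)[of "hd e" f] map_comp(2)[of w g] e(3-) ends s by simp
  then obtain h where h: "h \<in> maps" "scod h = sdom f'" "g' \<star> h = hd e" "f' \<star> h = w"
    using cartesian_lift[OF sq, of "hd e" w] e(3-) ends s by auto
  show "\<exists>d. cone X (Push f' # Pull g' # ts) d \<and> hd d # (f \<star> hd (tl (tl d))) # tl (tl d) = c"
    using e(1,2) h s by (intro exI[of _ "w # h # e"]) simp
qed


section \<open>Transformations into a direct image of an inverse image\<close>

lemma transformation_invariant_transports: "transformation_invariant \<G> (transports Q)"
  by unfold_locales (blast intro: transports_id transports_comp transports_inverse transports_letter)+

lemma SGNT0_transports:
  assumes "(F, G, \<phi>) \<in> SGNT0 \<G> Q"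
  shows "transports Q (src F) (tgt F) (terms F) (terms G) \<phi>"
proof -
  interpret transformation_invariant \<G> "transports Q"
    by (rule transformation_invariant_transports)
  have "invariant (comp0 \<G>)"
    unfolding comp0_def
    by (rule invariant_whiskerings)
      (auto simp: lower_def upper_def sgf_cmp_def intro: transports_compL transports_compU)
  moreover have "invariant (triv0 \<G>)"
    unfolding triv0_def
    by (rule invariant_whiskerings)
      (auto simp: lower_def upper_def sgf_id_def intro: transports_trivL transports_trivU)
  moreover have "invariant (bc_class \<G> Q)"
    unfolding bc_class_def
  proof (rule invariant_whiskerings)
    fix H K \<phi> ts X
    assume "(H, K, \<phi>) \<in> {(upper \<G> g \<odot> lower \<G> f, lower \<G> f' \<odot> upper \<G> g', bc \<G> f g f' g') | f g f' g'.
        cartesian (Sp \<G>) f g f' g' \<and> Q f g f' g'}" and ts: "typed ts X (src H)"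
    then obtain f g f' g' where *: "H = upper \<G> g \<odot> lower \<G> f" "K = lower \<G> f' \<odot> upper \<G> g'"
      "\<phi> = bc \<G> f g f' g'" "cartesian (Sp \<G>) f g f' g'" "Q f g f' g'" by auto
    show "src K = src H \<and> tgt K = tgt H \<and>
        transports Q X (tgt H) (terms H @ ts) (terms K @ ts) (\<lambda>A. \<phi> (wordO ts A))"
      using transports_bc[where Q = Q, OF *(4,5), of ts X] ts * cartesian_square[OF *(4)]
      by (simp add: lower_def upper_def sgf_cmp_def)
  qed
  ultimately have "invariant (SGNT0 \<G> Q)"
    by (simp add: SGNT0_def SGNT0_plus_def invariant_gen invariant_inverses invariant_Un)
  then show ?thesis
    using assms by (auto simp: invariant_def)
qed

context
  fixes a b
  assumes ab: "a \<in> maps" "b \<in> maps" "sdom a = sdom b"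
begin

lemma cone_pair:
  assumes "cone X [Push a, Pull b] c"
  obtains k where "k \<in> maps" "scod k = sdom a" "c = [a \<star> k, k, b \<star> k]"
  using assms ab by auto

text \<open>The effect of an automorphism \<open>k\<close> of the terminal cone. At \<open>b\<^sup>*\<close> the extension of the unit is the transpose
under \<open>k\<close> of the composition map \<open>k\<^sup>* b\<^sup>* A \<rightarrow> (b k)\<^sup>* A\<close>, by the compatibility of \<open>compU\<close> with the
adjunctions applied to an identity.\<close>

lemma along_pair:
  assumes k: "k \<in> maps" "sdom k = sdom a" "scod k = sdom a" "a \<star> k = a" "b \<star> k = b"
    and A: "shape A" "base A = scod b"
  shows "along [Push a, Pull b] [a, k, b] (upO b A) (\<eta> b A) = change_fp \<G> a b k A"
proof -
  let ?B = "upO b A"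
  let ?x = "flat \<G> b (lowO k ?B) (cLi k b ?B \<bullet> \<eta> b A)"
  have [simp]: "vert ?x" "adom ?x = ?B" "acod ?x = lowO k ?B"
    using ab k A by simp_all
  have "flat \<G> k ?B (flat \<G> b (lowO k ?B) (cLi k b ?B \<bullet> sharp \<G> (b \<star> k) A (ide ?B))) = ide ?B \<bullet> cU k b A"
    using ab k A by (intro compU_adjoint) simp_all
  moreover have "sharp \<G> b A (ide ?B) = \<eta> b A"
    using ab A by (simp add: sharp_def)
  ultimately have "flat \<G> k ?B ?x = cU k b A"
    using ab k A compU_arr(3)[of k b A] by simp
  then have "?x = sharp \<G> k ?B (cU k b A)"
    using ab k A sharp_flat[of k ?B ?x ?B] by simp
  then show ?thesis
    using ab k A by (simp add: change_fp_def sharp_def)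
qed

text \<open>Unitality turns both composition isomorphisms of the cone \<open>(a, id, b)\<close> into direct images of the triviality
isomorphism; one occurs inverted and they cancel.\<close>

lemma along_pair_ide:
  assumes A: "shape A" "base A = scod b"
  shows "along [Push a, Pull b] [a, side (sdom a), b] (upO b A) (\<eta> b A) = ide (lowO a (upO b A))"
proof -
  let ?B = "upO b A" and ?V = "sdom b"
  let ?x = "flat \<G> b (lowO (side ?V) ?B) (cLi (side ?V) b ?B \<bullet> \<eta> b A)"
  have "trivL \<G> ?V ?B \<bullet> ?x = flat \<G> b ?B (lowA b (trivL \<G> ?V ?B) \<bullet> cLi (side ?V) b ?B \<bullet> \<eta> b A)"
    using ab A comp_flat[of b "lowO (side ?V) ?B" "cLi (side ?V) b ?B \<bullet> \<eta> b A" "trivL \<G> ?V ?B"]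
    by simp
  also have "\<dots> = flat \<G> b ?B (\<eta> b A)"
    using ab A compL_unit(2)[of b ?B, symmetric] by simp
  also have "\<dots> = flat \<G> b ?B (sharp \<G> b A (ide ?B))"
    using ab A by (simp add: sharp_def)
  also have "\<dots> = ide ?B"
    using ab A by simp
  finally have x: "trivL \<G> ?V ?B \<bullet> ?x = ide ?B" .
  have "cL (side ?V) a ?B \<bullet> lowA a ?x = lowA a (trivL \<G> ?V ?B \<bullet> ?x)"
    using ab A compL_unit(2)[of a ?B] by simp
  then show ?thesis
    unfolding x using ab A by simp
qed

lemma transports_into_pair:
  assumes \<phi>: "transports Q (scod b) Z ts [Push a, Pull b] \<phi>"
    and R: "cone_bijection Q (scod b) ts [Push a, Pull b] R"
    and aR: "\<And>c d B \<alpha>. R c d \<Longrightarrow> cone_data (scod b) c B \<alpha> \<Longrightarrow>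
      along ts c B \<alpha> = along [Push a, Pull b] d B \<alpha> \<bullet> \<phi> (adom \<alpha>)"
    and c: "R c [a, k, b]" and k: "k \<in> maps" "sdom k = sdom a" "scod k = sdom a" "a \<star> k = a" "b \<star> k = b"
    and A: "shape A" "base A = scod b"
  shows "along ts c (upO b A) (\<eta> b A) = change_fp \<G> a b k A \<bullet> \<phi> A"
    and "k = side (sdom a) \<Longrightarrow> along ts c (upO b A) (\<eta> b A) = \<phi> A"
proof -
  have "cone_data (scod b) c (upO b A) (\<eta> b A)"
    using cone_bijectionD(1)[OF R c] ab A by (simp add: cone_data_def)
  then have *: "along ts c (upO b A) (\<eta> b A) =
      along [Push a, Pull b] [a, k, b] (upO b A) (\<eta> b A) \<bullet> \<phi> A"
    using aR[OF c] ab A by simp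
  then show "along ts c (upO b A) (\<eta> b A) = change_fp \<G> a b k A \<bullet> \<phi> A"
    using along_pair[OF k A] by simp
  have "between (scod b) ts [Push a, Pull b] \<phi>"
    using \<phi> by (simp add: transports_def)
  then show "along ts c (upO b A) (\<eta> b A) = \<phi> A" if "k = side (sdom a)"
    using * along_pair_ide[OF A] that between_arr[of "scod b" ts _ \<phi> A] A by simp
qed

text \<open>Both transformations match \<open>(a, id, b)\<close>, which is distinguished, with a distinguished cone over the source, and
there is only one.\<close>

lemma determined_unique_transport:
  assumes Q: "determined_fibered_products (Sp \<G>) Q"
    and \<phi>: "transports Q (scod b) Z ts [Push a, Pull b] \<phi>"
    and \<psi>: "transports Q (scod b) Z ts [Push a, Pull b] \<psi>"
    and A: "shape A" "base A = scod b"
  shows "\<phi> A = \<psi> A"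
proof -
  let ?k = "side (sdom a)" and ?us = "[Push a, Pull b]" and ?X = "scod b"
  have k: "?k \<in> maps" "sdom ?k = sdom a" "scod ?k = sdom a" "a \<star> ?k = a" "b \<star> ?k = b"
    using ab by simp_all
  have d: "cone ?X ?us [a, ?k, b]"
    using ab by simp
  have "distinguished Q ?X [Pull b] [?k, b]"
    by (rule distinguished_PullI[where e = "[side (scod b)]" and f' = b])
      (use determined_ide(2)[OF Q ab(2)] ab in simp_all)
  then have dist: "distinguished Q ?X ?us [a, ?k, b]"
    using ab by simp
  have ex: "\<exists>c. distinguished Q ?X ts c \<and> (\<forall>A. shape A \<longrightarrow> base A = ?X \<longrightarrow> along ts c (upO b A) (\<eta> b A) = \<chi> A)"
    if \<chi>: "transports Q ?X Z ts ?us \<chi>" for \<chi>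
  proof -
    obtain R where R: "cone_bijection Q ?X ts ?us R"
      and aR: "\<And>c d B \<alpha>. R c d \<Longrightarrow> cone_data ?X c B \<alpha> \<Longrightarrow>
        along ts c B \<alpha> = along ?us d B \<alpha> \<bullet> \<chi> (adom \<alpha>)"
      by (rule transports_relation[OF \<chi>]) blast
    obtain c where c: "R c [a, ?k, b]"
      using cone_bijectionD(3)[OF R d] by blast
    show ?thesis
      using transports_into_pair(2)[OF \<chi> R aR c k] cone_bijectionD(6)[OF R Q c] dist by blast
  qed
  have "typed ts ?X Z"
    using \<phi> unfolding transports_def by blast
  then show ?thesis
    using ex[OF \<phi>] ex[OF \<psi>] distinguished_unique[OF Q] A by metis
qed

text \<open>Let \<open>c\<close> and \<open>e\<close> be the cones that \<open>\<phi>\<close> and \<open>\<psi>\<close> match with \<open>(a, id, b)\<close>. Every cone over \<open>a\<^sub>* b\<^sup>*\<close> is a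
restriction of \<open>(a, id, b)\<close>, so \<open>c\<close> and \<open>e\<close> are restrictions of each other along maps \<open>k\<close> and \<open>l\<close>, which are
therefore inverse to each other.\<close>

lemma transports_differ_by_change_fp:
  assumes \<phi>: "transports Q (scod b) Z ts [Push a, Pull b] \<phi>"
    and \<psi>: "transports Q (scod b) Z ts [Push a, Pull b] \<psi>"
  shows "\<exists>k. is_iso (Sp \<G>) k \<and> sdom k = sdom a \<and> scod k = sdom a \<and> a \<star> k = a \<and> b \<star> k = b \<and>
    nt_eq (Fib \<G> (scod b)) \<psi> (\<lambda>A. change_fp \<G> a b k A \<bullet> \<phi> A)"
proof -
  let ?i = "side (sdom a)" and ?us = "[Push a, Pull b]" and ?X = "scod b"
  have i: "?i \<in> maps" "sdom ?i = sdom a" "scod ?i = sdom a" "a \<star> ?i = a" "b \<star> ?i = b"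
    using ab by simp_all
  have d: "cone ?X ?us [a, ?i, b]"
    using ab by simp
  obtain R where R: "cone_bijection Q ?X ts ?us R"
    and aR: "\<And>c d B \<alpha>. R c d \<Longrightarrow> cone_data ?X c B \<alpha> \<Longrightarrow>
      along ts c B \<alpha> = along ?us d B \<alpha> \<bullet> \<phi> (adom \<alpha>)"
    by (rule transports_relation[OF \<phi>]) blast
  obtain S where S: "cone_bijection Q ?X ts ?us S"
    and aS: "\<And>c d B \<alpha>. S c d \<Longrightarrow> cone_data ?X c B \<alpha> \<Longrightarrow>
      along ts c B \<alpha> = along ?us d B \<alpha> \<bullet> \<psi> (adom \<alpha>)"
    by (rule transports_relation[OF \<psi>]) blast
  obtain c where c: "R c [a, ?i, b]"
    using cone_bijectionD(3)[OF R d] by blast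
  obtain e where e: "S e [a, ?i, b]"
    using cone_bijectionD(3)[OF S d] by blast
  note c1 = cone_bijectionD(1)[OF R c] and e1 = cone_bijectionD(1)[OF S e]
  \<comment> \<open>A cone with the legs \<open>a\<close> and \<open>b\<close> over the source is a restriction of the one matched with \<open>(a, id, b)\<close>.\<close>
  have compare: "\<exists>k. k \<in> maps \<and> sdom k = sdom a \<and> scod k = sdom a \<and> a \<star> k = a \<and> b \<star> k = b \<and>
      R' e' [a, k, b] \<and> e' = restrict_cone c' k"
    if R': "cone_bijection Q ?X ts ?us R'" and c': "R' c' [a, ?i, b]" and e': "cone ?X ts e'" "hd e' = a" "last e' = b"
    for R' c' e'
  proof -
    obtain d' where d': "R' e' d'"
      using cone_bijectionD(2)[OF R' e'(1)] by blast
    note d1 = cone_bijectionD(1)[OF R' d']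
    then obtain k where k: "k \<in> maps" "scod k = sdom a" "d' = [a \<star> k, k, b \<star> k]"
      using cone_pair[of ?X d'] by blast
    have ak: "a \<star> k = a" "b \<star> k = b"
      using d1 e' k(3) by simp_all
    have "sdom k = sdom a"
      using map_comp(2)[OF k(1) ab(1) k(2)] ak(1) by simp
    moreover have "R' (restrict_cone c' k) [a, k, b]"
      using cone_bijectionD(5)[OF R' c' k(1)] cone_bijectionD(1)[OF R' c'] k(1,2) ak by simp
    ultimately show ?thesis
      using cone_bijectionD(4)[OF R' d'] d' k ak by (intro exI[of _ k] conjI) simp_all
  qed
  have ends: "cone ?X ts c" "hd c = a" "last c = b" "cone ?X ts e" "hd e = a" "last e = b"
    using c1 e1 by simp_all
  obtain k where k: "k \<in> maps" "sdom k = sdom a" "scod k = sdom a" "a \<star> k = a" "b \<star> k = b"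
    "R e [a, k, b]" "e = restrict_cone c k"
    using compare[OF R c ends(4-6)] by (elim exE conjE) (rule that)
  obtain l where l: "l \<in> maps" "sdom l = sdom a" "scod l = sdom a" "a \<star> l = a" "b \<star> l = b"
    "S c [a, l, b]" "c = restrict_cone e l"
    using compare[OF S e ends(1-3)] by (elim exE conjE) (rule that)
  have "scod l = sdom (hd e)"
    using e1 l(3) by simp
  then have "R (restrict_cone e l) (restrict_cone [a, k, b] l)"
    by (rule cone_bijectionD(5)[OF R k(6) l(1)])
  then have "R c [a \<star> l, k \<star> l, b \<star> l]"
    by (simp only: l(7)[symmetric] list.map)
  then have "[a, ?i, b] = [a \<star> l, k \<star> l, b \<star> l]"
    using cone_bijectionD(4)[OF R c] by blast
  then have kl: "k \<star> l = ?i"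
    by simp
  have "scod k = sdom (hd c)"
    using c1 k(3) by simp
  then have "S (restrict_cone c k) (restrict_cone [a, l, b] k)"
    by (rule cone_bijectionD(5)[OF S l(6) k(1)])
  then have "S e [a \<star> k, l \<star> k, b \<star> k]"
    by (simp only: k(7)[symmetric] list.map)
  then have "[a, ?i, b] = [a \<star> k, l \<star> k, b \<star> k]"
    using cone_bijectionD(4)[OF S e] by blast
  then have lk: "l \<star> k = ?i"
    by simp
  have "is_iso (Sp \<G>) k"
    unfolding is_iso_def inverse_arrows_def Hom_def using k(1-5) l(1-5) kl lk by auto
  moreover have "\<psi> A = change_fp \<G> a b k A \<bullet> \<phi> A" if "shape A" "base A = ?X" for A
    using transports_into_pair(2)[OF \<psi> S aS e i that] transports_into_pair(1)[OF \<phi> R aR k(6) k(1-5) that]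
    by simp
  ultimately show ?thesis
    using k(1-5) by (auto simp: nt_eq_def)
qed

end


section \<open>Fusing and erasing letters\<close>

fun same_kind :: "'f basic \<Rightarrow> 'f basic \<Rightarrow> bool" where
  "same_kind (Push f) (Push g) \<longleftrightarrow> True"
| "same_kind (Pull f) (Pull g) \<longleftrightarrow> True"
| "same_kind _ _ \<longleftrightarrow> False"

fun ident_like :: "'f basic \<Rightarrow> 'x \<Rightarrow> 'f basic" where
  "ident_like (Push f) X = Push (side X)"
| "ident_like (Pull f) X = Pull (side X)"

definition is_ident :: "'f basic \<Rightarrow> bool" where
  "is_ident b \<longleftrightarrow> (\<exists>X\<in>spaces. b = Push (side X) \<or> b = Pull (side X))"

text \<open>Letters of the same kind are treated uniformly: the composition maps of direct and of inverse images satisfy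
the same laws once the order of the letters, rather than that of the maps, is followed. The value on letters of
different kinds is arbitrary.\<close>

fun fuse_letters :: "'f basic \<Rightarrow> 'f basic \<Rightarrow> 'f basic" where
  "fuse_letters (Push g) (Push f) = Push (g \<star> f)"
| "fuse_letters (Pull f) (Pull g) = Pull (g \<star> f)"
| "fuse_letters b c = b"

fun fuse :: "'f basic \<Rightarrow> 'f basic \<Rightarrow> 's \<Rightarrow> 'a" where
  "fuse (Push g) (Push f) A = cL f g A"
| "fuse (Pull f) (Pull g) A = cU f g A"
| "fuse b c A = ide A"

fun erase :: "'f basic \<Rightarrow> 's \<Rightarrow> 'a" where
  "erase (Push f) A = trivL \<G> (sdom f) A"
| "erase (Pull f) A = trivU \<G> (sdom f) A"

definition erase_inv :: "'f basic \<Rightarrow> 's \<Rightarrow> 'a" where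
  "erase_inv b A = inv_arr (Fib \<G> (letter_tgt b)) (erase b A)"

lemma same_kind_sym: "same_kind b c \<Longrightarrow> same_kind c b"
  and same_kind_trans: "same_kind b c \<Longrightarrow> same_kind c d \<Longrightarrow> same_kind b d"
  by (cases b; cases c; cases d; simp)+

lemma is_identE:
  assumes "is_ident u" "letter u"
  obtains X where "X \<in> spaces" "u = Push (side X)" | X where "X \<in> spaces" "u = Pull (side X)"
  using assms unfolding is_ident_def by blast

lemma fuse_letters_letter [simp]:
  assumes "same_kind b c" "letter b" "letter c" "letter_src b = letter_tgt c"
  shows "letter (fuse_letters b c)" "letter_src (fuse_letters b c) = letter_src c"
    "letter_tgt (fuse_letters b c) = letter_tgt b"
    "same_kind b (fuse_letters b c)"
  using assms by (cases b; cases c; simp)+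

lemma fuse_letters_assoc:
  assumes "same_kind b c" "same_kind c d" "letter b" "letter c" "letter d"
    "letter_src b = letter_tgt c" "letter_src c = letter_tgt d"
  shows "fuse_letters (fuse_letters b c) d = fuse_letters b (fuse_letters c d)"
  using assms by (cases b; cases c; cases d) (simp_all add: map_assoc)

lemma fuse_arr [simp]:
  assumes "same_kind b c" "letter b" "letter c" "letter_src b = letter_tgt c" "shape A"
    "base A = letter_src c"
  shows "vert (fuse b c A)" "adom (fuse b c A) = letterO b (letterO c A)"
    "acod (fuse b c A) = letterO (fuse_letters b c) A"
  using assms by (cases b; cases c; simp)+

lemma fuse_natural:
  assumes "same_kind b c" "letter b" "letter c" "letter_src b = letter_tgt c" "vert h"
    "base (adom h) = letter_src c"
  shows "letterA (fuse_letters b c) h \<bullet> fuse b c (adom h) = fuse b c (acod h) \<bullet> letterA b (letterA c h)"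
  using assms by (cases b; cases c) (simp_all add: compL_natural compU_natural)

lemma fuse_assoc:
  assumes "same_kind b c" "same_kind c d" "letter b" "letter c" "letter d"
    "letter_src b = letter_tgt c" "letter_src c = letter_tgt d" "shape A" "base A = letter_src d"
  shows "fuse (fuse_letters b c) d A \<bullet> fuse b c (letterO d A) =
    fuse b (fuse_letters c d) A \<bullet> letterA b (fuse c d A)"
  using assms by (cases b; cases c; cases d) (simp_all add: compL_assoc compU_assoc)

lemma is_ident_src: "is_ident u \<Longrightarrow> letter_src u = letter_tgt u"
  by (auto simp: is_ident_def)

lemma fuse_letters_ident:
  assumes "is_ident u" "letter u" "same_kind u b" "letter b" "letter_tgt b = letter_tgt u"
  shows "fuse_letters u b = b"
  using assms(1,2)
proof (cases rule: is_identE)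
  case (1 X)
  then show ?thesis
    using assms(3-) by (cases b) auto
next
  case (2 X)
  then show ?thesis
    using assms(3-) by (cases b) auto
qed

lemma fuse_ident:
  assumes "is_ident u" "letter u" "same_kind u b" "letter b" "letter_tgt b = letter_tgt u"
    "shape A" "base A = letter_src b"
  shows "fuse u b A = erase u (letterO b A)"
  using assms(1,2)
proof (cases rule: is_identE)
  case (1 X)
  then show ?thesis
    using assms(3-) by (cases b) (auto simp: compL_unit)
next
  case (2 X)
  then show ?thesis
    using assms(3-) by (cases b) (auto simp: compU_unit)
qed

lemma erase_arr [simp]:
  assumes "is_ident u" "letter u" "shape A" "base A = letter_tgt u"
  shows "vert (erase u A)" "adom (erase u A) = letterO u A" "acod (erase u A) = A"
    "vert (erase_inv u A)" "adom (erase_inv u A) = A" "acod (erase_inv u A) = letterO u A"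
    "erase u A \<bullet> erase_inv u A = ide A" "erase_inv u A \<bullet> erase u A = ide (letterO u A)"
proof -
  have "erase u A \<in> Hom (Fib \<G> (letter_tgt u)) (letterO u A) A \<and>
      inverse_arrows (Fib \<G> (letter_tgt u)) (erase u A) (erase_inv u A)"
    using assms(1,2)
  proof (cases rule: is_identE)
    case (1 X)
    then show ?thesis
      using nat_iso_component[OF trivL_nat_iso[OF 1(1)], of A] assms(3,4)
      by (simp add: erase_inv_def id_fctr_def)
  next
    case (2 X)
    then show ?thesis
      using nat_iso_component[OF trivU_nat_iso[OF 2(1)], of A] assms(3,4)
      by (simp add: erase_inv_def id_fctr_def)
  qed
  then show "vert (erase u A)" "adom (erase u A) = letterO u A" "acod (erase u A) = A"
    "vert (erase_inv u A)" "adom (erase_inv u A) = A" "acod (erase_inv u A) = letterO u A"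
    "erase u A \<bullet> erase_inv u A = ide A" "erase_inv u A \<bullet> erase u A = ide (letterO u A)"
    by (auto simp: Hom_Fib inverse_arrows_def)
qed

lemma erase_natural:
  assumes "is_ident u" "letter u" "vert h" "base (adom h) = letter_tgt u"
  shows "h \<bullet> erase u (adom h) = erase u (acod h) \<bullet> letterA u h"
  using assms(1,2)
proof (cases rule: is_identE)
  case (1 X)
  then show ?thesis using assms(3,4) trivL_natural[of X h] by simp
next
  case (2 X)
  then show ?thesis using assms(3,4) trivU_natural[of X h] by simp
qed

section \<open>Normal forms of words\<close>

text \<open>Keeping identities out of words changes the functor only by the isomorphism \<open>tidy\<close>.\<close>

definition tidy_Cons :: "'f basic \<Rightarrow> 'f basic list \<Rightarrow> 'f basic list" where
  "tidy_Cons b N = (if is_ident b then N else b # N)"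

definition tidy :: "'f basic \<Rightarrow> 's \<Rightarrow> 'a" where
  "tidy b C = (if is_ident b then erase b C else ide (letterO b C))"

definition tidy_inv :: "'f basic \<Rightarrow> 's \<Rightarrow> 'a" where
  "tidy_inv b C = (if is_ident b then erase_inv b C else ide (letterO b C))"

definition avoids :: "'f basic \<Rightarrow> 'f basic list \<Rightarrow> bool" where
  "avoids b N \<longleftrightarrow> N = [] \<or> \<not> same_kind b (hd N)"

text \<open>Every word without identities is read as starting with a letter of the kind of \<open>b\<close>: its first letter if that has
this kind, and otherwise an identity. This convention makes all cases of adding \<open>b\<close> to the word
instances of one formula.\<close>

fun lead :: "'f basic \<Rightarrow> 'f basic list \<Rightarrow> 'f basic" where
  "lead b (c # N) = (if same_kind b c then c else ident_like b (letter_src b))"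
| "lead b [] = ident_like b (letter_src b)"

fun remainder :: "'f basic \<Rightarrow> 'f basic list \<Rightarrow> 'f basic list" where
  "remainder b (c # N) = (if same_kind b c then N else c # N)"
| "remainder b [] = []"

definition act :: "'f basic \<Rightarrow> 'f basic list \<Rightarrow> 'f basic list" where
  "act b N = tidy_Cons (fuse_letters b (lead b N)) (remainder b N)"

definition act_arr :: "'f basic \<Rightarrow> 'f basic list \<Rightarrow> 's \<Rightarrow> 'a" where
  "act_arr b N A = (let c = lead b N; C = wordO (remainder b N) A in
     tidy (fuse_letters b c) C \<bullet> fuse b c C \<bullet> letterA b (tidy_inv c C))"

fun normal :: "'f basic list \<Rightarrow> bool" where
  "normal [] \<longleftrightarrow> True"
| "normal (b # N) \<longleftrightarrow> \<not> is_ident b \<and> avoids b N \<and> normal N"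

fun normal_form :: "'f basic list \<Rightarrow> 'f basic list" where
  "normal_form [] = []"
| "normal_form (b # ts) = act b (normal_form ts)"

fun reduction :: "'f basic list \<Rightarrow> 's \<Rightarrow> 'a" where
  "reduction [] A = ide A"
| "reduction (b # ts) A = act_arr b (normal_form ts) A \<bullet> letterA b (reduction ts A)"

lemma ident_like_letter:
  assumes "letter b" "X \<in> spaces"
  shows "is_ident (ident_like b X)" "letter (ident_like b X)" "same_kind b (ident_like b X)"
    "letter_src (ident_like b X) = X" "letter_tgt (ident_like b X) = X"
  using assms by (cases b; auto simp: is_ident_def)+

lemma ident_like_unique:
  assumes "is_ident u" "same_kind b u" "letter_tgt u = X"
  shows "u = ident_like b X"
  using assms by (cases b; cases u) (auto simp: is_ident_def)

lemma letter_spaces: "letter b \<Longrightarrow> letter_src b \<in> spaces" "letter b \<Longrightarrow> letter_tgt b \<in> spaces"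
  by (cases b; simp)+

text \<open>The converse of \<open>lead\<close> and \<open>remainder\<close>: the normal words on which \<open>b\<close> can act are \<open>tidy_Cons c M\<close> with \<open>c\<close> of
the kind of \<open>b\<close> and no such letter at the head of \<open>M\<close>.\<close>

lemma normal_split:
  assumes "normal N" "typed N X (letter_src b)" "letter b"
  obtains c M where "letter c" "same_kind b c" "letter_tgt c = letter_src b" "typed M X (letter_src c)"
    "normal M" "avoids b M" "N = tidy_Cons c M"
proof (cases "avoids b N")
  case True
  then show ?thesis
    using that[of "ident_like b (letter_src b)" N] ident_like_letter[OF assms(3) letter_spaces(1)[OF assms(3)]]
      assms by (simp add: tidy_Cons_def)
next
  case False
  then obtain c M where *: "N = c # M" "same_kind b c"
    by (cases N) (auto simp: avoids_def)
  then have "avoids b M"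
    using assms(1) same_kind_trans same_kind_sym unfolding * avoids_def normal.simps by metis
  then show ?thesis
    using that[of c M] * assms by (simp add: tidy_Cons_def)
qed

lemma split_tidy_Cons:
  assumes "letter c" "same_kind b c" "letter_tgt c = letter_src b" "avoids b M"
  shows "lead b (tidy_Cons c M) = c" "remainder b (tidy_Cons c M) = M"
proof -
  have "lead b M = ident_like b (letter_src b)" "remainder b M = M"
    using assms(4) by (cases M; simp add: avoids_def)+
  then show "lead b (tidy_Cons c M) = c" "remainder b (tidy_Cons c M) = M"
    using assms ident_like_unique[of c b "letter_src b"] by (simp_all add: tidy_Cons_def)
qed

lemma act_tidy_Cons:
  assumes "letter c" "same_kind b c" "letter_tgt c = letter_src b" "avoids b M"
  shows "act b (tidy_Cons c M) = tidy_Cons (fuse_letters b c) M"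
    "act_arr b (tidy_Cons c M) A = tidy (fuse_letters b c) (wordO M A) \<bullet> fuse b c (wordO M A) \<bullet>
      letterA b (tidy_inv c (wordO M A))"
  by (simp_all add: act_def act_arr_def Let_def split_tidy_Cons[OF assms])

lemma tidy_arr [simp]:
  assumes "letter b" "shape C" "base C = letter_src b"
  shows "vert (tidy b C)" "adom (tidy b C) = letterO b C"
    "vert (tidy_inv b C)" "acod (tidy_inv b C) = letterO b C"
    "adom (tidy_inv b C) = acod (tidy b C)"
    "tidy b C \<bullet> tidy_inv b C = ide (acod (tidy b C))" "tidy_inv b C \<bullet> tidy b C = ide (letterO b C)"
  using assms is_ident_src[of b] by (auto simp: tidy_def tidy_inv_def)

lemma acod_tidy:
  assumes "letter b" "typed M X (letter_src b)" "shape A" "base A = X"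
  shows "acod (tidy b (wordO M A)) = wordO (tidy_Cons b M) A"
  using assms word_obj[OF assms(2-4)] is_ident_src[of b] by (auto simp: tidy_def tidy_Cons_def)

lemma typed_tidy_Cons:
  assumes "letter b" "typed M X (letter_src b)"
  shows "typed (tidy_Cons b M) X (letter_tgt b)"
  using assms is_ident_src[of b] by (auto simp: tidy_Cons_def)

lemma act_normal:
  assumes "normal N" "typed N X (letter_src b)" "letter b"
  shows "normal (act b N)" "typed (act b N) X (letter_tgt b)"
proof -
  obtain c M where c: "letter c" "same_kind b c" "letter_tgt c = letter_src b" "typed M X (letter_src c)"
    "normal M" "avoids b M" "N = tidy_Cons c M"
    by (rule normal_split[OF assms])
  have b: "letter (fuse_letters b c)" "letter_src (fuse_letters b c) = letter_src c"
    "letter_tgt (fuse_letters b c) = letter_tgt b" "same_kind b (fuse_letters b c)"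
    using fuse_letters_letter[OF c(2) assms(3) c(1)] c(3) by simp_all
  have "avoids (fuse_letters b c) M"
    using c(6) b(4) same_kind_trans unfolding avoids_def by metis
  then show "normal (act b N)"
    using c(5) unfolding c(7) act_tidy_Cons(1)[OF c(1-3,6)] by (simp add: tidy_Cons_def)
  show "typed (act b N) X (letter_tgt b)"
    using typed_tidy_Cons[OF b(1), of M X] b(2,3) c(4)
    unfolding c(7) act_tidy_Cons(1)[OF c(1-3,6)] by simp
qed

lemma normal_form_normal:
  assumes "typed ts X Z"
  shows "normal (normal_form ts) \<and> typed (normal_form ts) X Z"
  using assms
proof (induction ts arbitrary: Z)
  case (Cons b ts)
  then show ?case using act_normal[of "normal_form ts" X b] Cons.IH[of "letter_src b"] by simp
qed simp

text \<open>Reductions are isomorphisms; a left inverse lets them be cancelled from an equation between composites.\<close>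

definition split_mono :: "'a \<Rightarrow> bool" where
  "split_mono h \<longleftrightarrow> vert h \<and> (\<exists>k. vert k \<and> adom k = acod h \<and> acod k = adom h \<and> k \<bullet> h = ide (adom h))"

lemma split_monoI:
  assumes "vert h" "vert k" "adom k = acod h" "acod k = adom h" "k \<bullet> h = ide (adom h)"
  shows "split_mono h"
  using assms by (auto simp: split_mono_def)

lemma split_mono_cancel:
  assumes "split_mono h" "vert x" "vert y" "acod x = adom h" "acod y = adom h" "h \<bullet> x = h \<bullet> y"
  shows "x = y"
proof -
  obtain k where k: "vert h" "vert k" "adom k = acod h" "acod k = adom h" "k \<bullet> h = ide (adom h)"
    using assms(1) by (auto simp: split_mono_def)
  have "x = (k \<bullet> h) \<bullet> x"
    using k assms(2,4) by (simp del: vert_assoc)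
  also have "\<dots> = (k \<bullet> h) \<bullet> y"
    using k(1-4) assms(2-6) by simp
  also have "\<dots> = y"
    using k assms(3,5) by (simp del: vert_assoc)
  finally show ?thesis .
qed

lemma split_mono_comp:
  assumes "split_mono h" "split_mono g" "adom g = acod h"
  shows "split_mono (g \<bullet> h)"
proof -
  obtain k where k: "vert h" "vert k" "adom k = acod h" "acod k = adom h" "k \<bullet> h = ide (adom h)"
    using assms(1) by (auto simp: split_mono_def)
  obtain l where l: "vert g" "vert l" "adom l = acod g" "acod l = adom g" "l \<bullet> g = ide (adom g)"
    using assms(2) by (auto simp: split_mono_def)
  have "(k \<bullet> l) \<bullet> (g \<bullet> h) = k \<bullet> (l \<bullet> g) \<bullet> h"
    using k(1-4) l(1-4) assms(3) by simp
  also have "\<dots> = ide (adom h)"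
    unfolding l(5) using k l(1) assms(3) by simp
  finally show ?thesis
    using k(1-4) l(1-4) assms(3) by (intro split_monoI[of _ "k \<bullet> l"]) simp_all
qed

lemma split_mono_letter:
  assumes "split_mono h" "letter b" "base (adom h) = letter_src b"
  shows "split_mono (letterA b h)"
proof -
  obtain k where k: "vert h" "vert k" "adom k = acod h" "acod k = adom h" "k \<bullet> h = ide (adom h)"
    using assms(1) by (auto simp: split_mono_def)
  have "letterA b k \<bullet> letterA b h = ide (letterO b (adom h))"
    using letter_comp[OF assms(2) k(1,2) assms(3) k(3)[symmetric]] k(1,5) assms(2,3) by simp
  then show ?thesis
    using k(1-4) assms(2,3) by (intro split_monoI[of _ "letterA b k"]) simp_all
qed

lemma split_mono_fuse:
  assumes "same_kind b c" "letter b" "letter c" "letter_src b = letter_tgt c" "shape A"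
    "base A = letter_src c"
  shows "split_mono (fuse b c A)"
proof -
  have iso: "split_mono h" if "h \<in> Hom (Fib \<G> X) B C" "inverse_arrows (Fib \<G> X) h k" for h k X B C
    using that by (intro split_monoI[of h k]) (auto simp: Hom_Fib inverse_arrows_def)
  show ?thesis
  proof (cases b)
    case (Push g)
    with assms(1) obtain f where c: "c = Push f" by (cases c) auto
    show ?thesis
      unfolding Push c fuse.simps
      by (rule iso[OF nat_iso_component[OF compL_nat_iso]]) (use assms Push c in simp_all)
  next
    case (Pull f)
    with assms(1) obtain g where c: "c = Pull g" by (cases c) auto
    show ?thesis
      unfolding Pull c fuse.simps
      by (rule iso[OF nat_iso_component[OF compU_nat_iso]]) (use assms Pull c in simp_all)
  qed
qed

lemma act_arr_split_mono:
  assumes N: "normal N" "typed N X (letter_src b)" "letter b" and A: "shape A" "base A = X"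
  shows "split_mono (act_arr b N A) \<and> adom (act_arr b N A) = letterO b (wordO N A) \<and>
    acod (act_arr b N A) = wordO (act b N) A"
proof -
  obtain c M where c: "letter c" "same_kind b c" "letter_tgt c = letter_src b" "typed M X (letter_src c)"
    "normal M" "avoids b M" "N = tidy_Cons c M"
    by (rule normal_split[OF N])
  let ?C = "wordO M A"
  have C: "shape ?C" "base ?C = letter_src c"
    using word_obj[OF c(4) A] by simp_all
  have bc: "letter (fuse_letters b c)" "letter_src (fuse_letters b c) = letter_src c"
    using fuse_letters_letter[OF c(2) N(3) c(1)] c(3) by simp_all
  have N': "wordO N A = acod (tidy c ?C)"
    using acod_tidy[OF c(1,4) A] c(7) by simp
  have bN: "base (acod (tidy c ?C)) = letter_src b"
    using word_obj[OF N(2) A] N' by simp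
  have "split_mono (tidy_inv c ?C)"
    using c(1) C by (intro split_monoI[of _ "tidy c ?C"]) simp_all
  then have 1: "split_mono (letterA b (tidy_inv c ?C))"
    using N(3) c(1) C bN by (intro split_mono_letter) simp_all
  have 2: "split_mono (fuse b c ?C)"
    using c C N(3) by (intro split_mono_fuse) simp_all
  have 3: "split_mono (tidy (fuse_letters b c) ?C)"
    using bc C by (intro split_monoI[of _ "tidy_inv (fuse_letters b c) ?C"]) simp_all
  have d: "vert (tidy_inv c ?C)" "adom (tidy_inv c ?C) = wordO N A" "acod (tidy_inv c ?C) = letterO c ?C"
    using c(1) C N' by simp_all
  have e: "vert (letterA b (tidy_inv c ?C))" "adom (letterA b (tidy_inv c ?C)) = letterO b (wordO N A)"
    "acod (letterA b (tidy_inv c ?C)) = letterO b (letterO c ?C)"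
    using d N' bN N(3) by simp_all
  have f: "vert (fuse b c ?C)" "adom (fuse b c ?C) = letterO b (letterO c ?C)"
    "acod (fuse b c ?C) = letterO (fuse_letters b c) ?C"
    using fuse_arr[OF c(2) N(3) c(1) c(3)[symmetric] C] by simp_all
  have g: "vert (tidy (fuse_letters b c) ?C)" "adom (tidy (fuse_letters b c) ?C) = letterO (fuse_letters b c) ?C"
    "acod (tidy (fuse_letters b c) ?C) = wordO (act b N) A"
    using bc C acod_tidy[OF bc(1) _ A, of M] c(4) unfolding c(7) act_tidy_Cons(1)[OF c(1-3,6)] by simp_all
  have eq: "act_arr b N A = tidy (fuse_letters b c) ?C \<bullet> fuse b c ?C \<bullet> letterA b (tidy_inv c ?C)"
    unfolding c(7) by (rule act_tidy_Cons(2)[OF c(1-3,6)])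
  have "split_mono (tidy (fuse_letters b c) ?C \<bullet> fuse b c ?C \<bullet> letterA b (tidy_inv c ?C))"
    using e f g by (intro split_mono_comp 1 2 3) simp_all
  then show ?thesis
    unfolding eq using e f g by simp
qed

lemma reduction_split_mono:
  assumes "typed ts X Z" "shape A" "base A = X"
  shows "split_mono (reduction ts A) \<and> adom (reduction ts A) = wordO ts A \<and>
    acod (reduction ts A) = wordO (normal_form ts) A"
  using assms(1)
proof (induction ts arbitrary: Z)
  case Nil
  have "split_mono (ide A)"
    using assms by (intro split_monoI[of _ "ide A"]) simp_all
  then show ?case using assms by simp
next
  case (Cons b ts)
  then have b: "letter b" "typed ts X (letter_src b)" by auto
  note IH = Cons.IH[OF b(2)]
  have n: "normal (normal_form ts)" "typed (normal_form ts) X (letter_src b)"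
    using normal_form_normal[OF b(2)] by auto
  note a = act_arr_split_mono[OF n b(1) assms(2,3)]
  have v: "vert (reduction ts A)" "vert (act_arr b (normal_form ts) A)"
    using IH a by (auto simp: split_mono_def)
  have bs: "base (wordO ts A) = letter_src b"
    using word_obj[OF b(2) assms(2,3)] by simp
  have "split_mono (act_arr b (normal_form ts) A \<bullet> letterA b (reduction ts A))"
    using IH a v b bs by (intro split_mono_comp split_mono_letter) simp_all
  then show ?case
    using IH a v b bs by simp
qed

lemma reduction_arr:
  assumes "typed ts X Z" "shape A" "base A = X"
  shows "vert (reduction ts A)" "adom (reduction ts A) = wordO ts A"
    "acod (reduction ts A) = wordO (normal_form ts) A"
  using reduction_split_mono[OF assms] by (auto simp: split_mono_def)

lemma act_arr_arr:
  assumes N: "normal N" "typed N X (letter_src b)" "letter b" and A: "shape A" "base A = X"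
  shows "vert (act_arr b N A)" "adom (act_arr b N A) = letterO b (wordO N A)"
    "acod (act_arr b N A) = wordO (act b N) A"
  using act_arr_split_mono[OF assms] by (auto simp: split_mono_def)

lemma normal_split_pair:
  assumes N: "normal N" "typed N X (letter_src c)" and bc: "letter b" "letter c" "same_kind b c"
    "letter_src b = letter_tgt c"
  obtains d M where "letter d" "same_kind c d" "letter_tgt d = letter_src c" "typed M X (letter_src d)"
    "avoids c M" "N = tidy_Cons d M"
    "same_kind (fuse_letters b c) d" "same_kind b (fuse_letters c d)"
    "avoids (fuse_letters b c) M" "avoids b M"
proof -
  obtain d M where d: "letter d" "same_kind c d" "letter_tgt d = letter_src c" "typed M X (letter_src d)"
    "normal M" "avoids c M" "N = tidy_Cons d M"
    by (rule normal_split[OF N bc(2)])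
  note k = fuse_letters_letter[OF bc(3,1,2,4)]
  note l = fuse_letters_letter[OF d(2) bc(2) d(1) d(3)[symmetric]]
  have "same_kind (fuse_letters b c) d" "same_kind b (fuse_letters c d)"
    using same_kind_trans same_kind_sym k(4) l(4) bc(3) d(2) by metis+
  moreover have "avoids (fuse_letters b c) M" "avoids b M"
    using d(6) same_kind_trans same_kind_sym k(4) bc(3) unfolding avoids_def by metis+
  ultimately show ?thesis
    using that[of d M] d by blast
qed

lemma act_fuse_letters:
  assumes N: "normal N" "typed N X (letter_src c)" and bc: "letter b" "letter c" "same_kind b c"
    "letter_src b = letter_tgt c"
  shows "act (fuse_letters b c) N = act b (act c N)"
proof -
  obtain d M where d: "letter d" "same_kind c d" "letter_tgt d = letter_src c" "typed M X (letter_src d)"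
    "avoids c M" "N = tidy_Cons d M" and kinds: "same_kind (fuse_letters b c) d" "same_kind b (fuse_letters c d)"
    and av: "avoids (fuse_letters b c) M" "avoids b M"
    by (rule normal_split_pair[OF N bc])
  note k = fuse_letters_letter[OF bc(3,1,2,4)]
  note l = fuse_letters_letter[OF d(2) bc(2) d(1) d(3)[symmetric]]
  have tgts: "letter_tgt d = letter_src (fuse_letters b c)" "letter_tgt (fuse_letters c d) = letter_src b"
    using k(2) d(3) l(3) bc(4) by simp_all
  have "act c N = tidy_Cons (fuse_letters c d) M"
    unfolding d(6) by (rule act_tidy_Cons(1)[OF d(1-3,5)])
  then have "act b (act c N) = tidy_Cons (fuse_letters b (fuse_letters c d)) M"
    using act_tidy_Cons(1)[OF l(1) kinds(2) tgts(2) av(2)] by simp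
  moreover have "act (fuse_letters b c) N = tidy_Cons (fuse_letters (fuse_letters b c) d) M"
    unfolding d(6) by (rule act_tidy_Cons(1)[OF d(1) kinds(1) tgts(1) av(1)])
  ultimately show ?thesis
    using fuse_letters_assoc[OF bc(3) d(2) bc(1,2) d(1) bc(4) d(3)[symmetric]] by simp
qed

text \<open>Fusing \<open>b\<close> with \<open>c\<close> and then with \<open>d\<close>, or first \<open>c\<close> with \<open>d\<close>: associativity. The tidying of the intermediate
word \<open>tidy_Cons (c d) M\<close> on the second way is undone at once by the following action.\<close>

lemma act_arr_fuse:
  assumes N: "normal N" "typed N X (letter_src c)" and bc: "letter b" "letter c" "same_kind b c"
    "letter_src b = letter_tgt c" and A: "shape A" "base A = X"
  shows "act_arr (fuse_letters b c) N A \<bullet> fuse b c (wordO N A) =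
      act_arr b (act c N) A \<bullet> letterA b (act_arr c N A)"
proof -
  let ?bc = "fuse_letters b c"
  obtain d M where d: "letter d" "same_kind c d" "letter_tgt d = letter_src c" "typed M X (letter_src d)"
    "avoids c M" "N = tidy_Cons d M" and kinds: "same_kind ?bc d" "same_kind b (fuse_letters c d)"
    and av: "avoids ?bc M" "avoids b M"
    by (rule normal_split_pair[OF N bc])
  let ?C = "wordO M A" and ?cd = "fuse_letters c d"
  let ?bcd = "fuse_letters b (fuse_letters c d)"
  have C: "shape ?C" "base ?C = letter_src d"
    using word_obj[OF d(4) A] by simp_all
  note k = fuse_letters_letter[OF bc(3,1,2,4)]
  note l = fuse_letters_letter[OF d(2) bc(2) d(1) d(3)[symmetric]]
  have assoc: "fuse_letters ?bc d = ?bcd"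
    using bc d by (intro fuse_letters_assoc) simp_all
  have tgts: "letter_tgt d = letter_src ?bc" "letter_tgt ?cd = letter_src b"
    using k(2) d(3) l(3) bc(4) by simp_all
  note bcd = fuse_letters_letter[OF kinds(2) bc(1) l(1) tgts(2)[symmetric]]
  have act_c: "act c N = tidy_Cons ?cd M"
    unfolding d(6) by (rule act_tidy_Cons(1)[OF d(1-3,5)])
  let ?t = "tidy ?bcd ?C" and ?ti = "tidy_inv d ?C"
  have N': "wordO N A = acod (tidy d ?C)"
    using acod_tidy[OF d(1,4) A] d(6) by simp
  have bN: "base (wordO N A) = letter_src c" "shape (wordO N A)"
    using word_obj[OF N(2) A] by simp_all
  have ti: "vert ?ti" "adom ?ti = wordO N A" "acod ?ti = letterO d ?C"
    using d(1) C N' by simp_all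
  have t: "vert ?t" "adom ?t = letterO ?bcd ?C"
    using bcd l C by simp_all
  have u: "vert (tidy ?cd ?C)" "vert (tidy_inv ?cd ?C)" "adom (tidy ?cd ?C) = letterO ?cd ?C"
    "acod (tidy_inv ?cd ?C) = letterO ?cd ?C" "adom (tidy_inv ?cd ?C) = acod (tidy ?cd ?C)"
    "tidy_inv ?cd ?C \<bullet> tidy ?cd ?C = ide (letterO ?cd ?C)"
    using l C by simp_all
  have f1: "vert (fuse ?bc d ?C)" "adom (fuse ?bc d ?C) = letterO ?bc (letterO d ?C)"
    "acod (fuse ?bc d ?C) = letterO ?bcd ?C"
    using fuse_arr[OF kinds(1) k(1) d(1) tgts(1)[symmetric] C] assoc by simp_all
  have f2: "vert (fuse b c (letterO d ?C))" "adom (fuse b c (letterO d ?C)) = letterO b (letterO c (letterO d ?C))"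
    "acod (fuse b c (letterO d ?C)) = letterO ?bc (letterO d ?C)"
    "vert (fuse b c (wordO N A))" "acod (fuse b c (wordO N A)) = letterO ?bc (wordO N A)"
    using fuse_arr[OF bc(3,1,2,4), of "letterO d ?C"] fuse_arr[OF bc(3,1,2,4), of "wordO N A"] d(1,3) C bN
    by simp_all
  have f3: "vert (fuse c d ?C)" "adom (fuse c d ?C) = letterO c (letterO d ?C)"
    "acod (fuse c d ?C) = letterO ?cd ?C"
    using fuse_arr[OF d(2) bc(2) d(1) d(3)[symmetric] C] by simp_all
  have f4: "vert (fuse b ?cd ?C)" "adom (fuse b ?cd ?C) = letterO b (letterO ?cd ?C)"
    "acod (fuse b ?cd ?C) = letterO ?bcd ?C"
    using fuse_arr[OF kinds(2) bc(1) l(1) tgts(2)[symmetric]] C l(2) by simp_all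
  have cti: "vert (letterA c ?ti)" "adom (letterA c ?ti) = letterO c (wordO N A)"
    "acod (letterA c ?ti) = letterO c (letterO d ?C)"
    using ti bN bc(2) by simp_all
  have bcN: "base (letterO c (wordO N A)) = letter_src b"
    using bN bc by simp
  have bcti: "vert (letterA b (letterA c ?ti))" "acod (letterA b (letterA c ?ti)) = letterO b (letterO c (letterO d ?C))"
    using cti bcN bc(1) by simp_all
  have bu: "base (letterO ?cd ?C) = letter_src b"
    using l C tgts by simp
  have bc2: "base (letterO c (letterO d ?C)) = letter_src b"
    using bc d C by simp
  have nat: "letterA ?bc ?ti \<bullet> fuse b c (wordO N A) = fuse b c (letterO d ?C) \<bullet> letterA b (letterA c ?ti)"
    using fuse_natural[OF bc(3,1,2,4) ti(1)] ti bN by simp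
  have ti': "vert (letterA ?bc ?ti)" "adom (letterA ?bc ?ti) = letterO ?bc (wordO N A)"
    "acod (letterA ?bc ?ti) = letterO ?bc (letterO d ?C)"
    using ti k bN by simp_all
  have "act_arr ?bc N A \<bullet> fuse b c (wordO N A) =
      (?t \<bullet> fuse ?bc d ?C \<bullet> letterA ?bc ?ti) \<bullet> fuse b c (wordO N A)"
    using act_tidy_Cons(2)[OF d(1) kinds(1) tgts(1) av(1), of A] assoc d(6) by simp
  also have "\<dots> = ?t \<bullet> fuse ?bc d ?C \<bullet> letterA ?bc ?ti \<bullet> fuse b c (wordO N A)"
    using t f1 ti' f2 by simp
  also have "\<dots> = ?t \<bullet> (fuse ?bc d ?C \<bullet> fuse b c (letterO d ?C)) \<bullet> letterA b (letterA c ?ti)"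
    unfolding nat using t f1 f2 bcti by simp
  also have "fuse ?bc d ?C \<bullet> fuse b c (letterO d ?C) = fuse b ?cd ?C \<bullet> letterA b (fuse c d ?C)"
    using bc d C by (intro fuse_assoc) simp_all
  also have "?t \<bullet> (fuse b ?cd ?C \<bullet> letterA b (fuse c d ?C)) \<bullet> letterA b (letterA c ?ti) =
      ?t \<bullet> fuse b ?cd ?C \<bullet> letterA b (fuse c d ?C \<bullet> letterA c ?ti)"
    using t f4 f3 cti bcti bc2 bcN bc(1) by simp
  \<comment> \<open>Insert the tidying of the intermediate word and its inverse.\<close>
  also have "fuse c d ?C \<bullet> letterA c ?ti = (tidy_inv ?cd ?C \<bullet> tidy ?cd ?C) \<bullet> fuse c d ?C \<bullet> letterA c ?ti"
    unfolding u(6) using f3 cti by simp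
  also have "?t \<bullet> fuse b ?cd ?C \<bullet> letterA b \<dots> =
      (?t \<bullet> fuse b ?cd ?C \<bullet> letterA b (tidy_inv ?cd ?C)) \<bullet>
      letterA b (tidy ?cd ?C \<bullet> fuse c d ?C \<bullet> letterA c ?ti)"
    using t f4 f3 cti u(1-5) bc2 bcN bu bc(1) vert_shape(4)[of "tidy ?cd ?C"] by simp
  also have "\<dots> = act_arr b (act c N) A \<bullet> letterA b (act_arr c N A)"
    unfolding act_c act_tidy_Cons(2)[OF l(1) kinds(2) tgts(2) av(2)]
    unfolding d(6) act_tidy_Cons(2)[OF d(1-3,5)] ..
  finally show "act_arr ?bc N A \<bullet> fuse b c (wordO N A) =
      act_arr b (act c N) A \<bullet> letterA b (act_arr c N A)" .
qed

text \<open>Fusing an identity with a letter is erasing it, by unitality; naturality moves the erasure across the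
tidying.\<close>

lemma act_ident:
  assumes N: "normal N" "typed N X (letter_src u)" and u: "letter u" "is_ident u"
  shows "act u N = N"
    "shape A \<Longrightarrow> base A = X \<Longrightarrow> act_arr u N A = erase u (wordO N A)"
proof -
  obtain c M where c: "letter c" "same_kind u c" "letter_tgt c = letter_src u" "typed M X (letter_src c)"
    "normal M" "avoids u M" "N = tidy_Cons c M"
    by (rule normal_split[OF N u(1)])
  have tu: "letter_tgt c = letter_tgt u"
    using c(3) is_ident_src[OF u(2)] by simp
  note fl = fuse_letters_ident[OF u(2,1) c(2,1) tu]
  show "act u N = N"
    using act_tidy_Cons(1)[OF c(1-3,6)] fl c(7) by simp
  assume A: "shape A" "base A = X"
  let ?C = "wordO M A"
  have C: "shape ?C" "base ?C = letter_src c"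
    using word_obj[OF c(4) A] by simp_all
  note f = fl fuse_ident[OF u(2,1) c(2,1) tu C]
  have N': "acod (tidy c ?C) = wordO N A"
    using acod_tidy[OF c(1,4) A] c(7) by simp
  have bN: "base (wordO N A) = letter_tgt u" "shape (wordO N A)"
    using word_obj[OF N(2) A] is_ident_src[OF u(2)] by simp_all
  have ti: "vert (tidy_inv c ?C)" "adom (tidy_inv c ?C) = wordO N A" "acod (tidy_inv c ?C) = letterO c ?C"
    "vert (tidy c ?C)" "adom (tidy c ?C) = letterO c ?C" "tidy c ?C \<bullet> tidy_inv c ?C = ide (wordO N A)"
    using c(1) C N' by simp_all
  have "act_arr u N A = tidy c ?C \<bullet> erase u (letterO c ?C) \<bullet> letterA u (tidy_inv c ?C)"
    using act_tidy_Cons(2)[OF c(1-3,6), of A] f c(7) by simp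
  also have "erase u (letterO c ?C) \<bullet> letterA u (tidy_inv c ?C) = tidy_inv c ?C \<bullet> erase u (wordO N A)"
    using erase_natural[OF u(2,1) ti(1)] ti bN by simp
  also have "tidy c ?C \<bullet> tidy_inv c ?C \<bullet> erase u (wordO N A) =
      (tidy c ?C \<bullet> tidy_inv c ?C) \<bullet> erase u (wordO N A)"
    using ti(1-5) bN u by simp
  also have "\<dots> = erase u (wordO N A)"
    unfolding ti(6) using bN u by simp
  finally show "act_arr u N A = erase u (wordO N A)" .
qed

section \<open>Transformations generated by composition and triviality\<close>

definition same_reduction :: "'x \<Rightarrow> 'x \<Rightarrow> 'f basic list \<Rightarrow> 'f basic list \<Rightarrow> ('s \<Rightarrow> 'a) \<Rightarrow> bool" where
  "same_reduction X Z ts us \<phi> \<longleftrightarrow> typed ts X Z \<and> typed us X Z \<and> between X ts us \<phi> \<and>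
     normal_form us = normal_form ts \<and>
     (\<forall>A. shape A \<longrightarrow> base A = X \<longrightarrow> reduction us A \<bullet> \<phi> A = reduction ts A)"

lemma same_reductionD:
  assumes "same_reduction X Z ts us \<phi>"
  shows "typed ts X Z" "typed us X Z" "between X ts us \<phi>" "normal_form us = normal_form ts"
    "shape A \<Longrightarrow> base A = X \<Longrightarrow> reduction us A \<bullet> \<phi> A = reduction ts A"
  using assms by (auto simp: same_reduction_def)

lemma transformation_invariant_reduction: "transformation_invariant \<G> same_reduction"
proof unfold_locales
  show "same_reduction X Z ts ts (\<lambda>A. ide (wordO ts A))" if ts: "typed ts X Z" for X Z ts
    using ts word_obj[OF ts] reduction_arr[OF ts] by (simp add: same_reduction_def between_def)
next
  fix X Z ts us vs \<phi> \<psi> assume \<phi>: "same_reduction X Z ts us \<phi>" and \<psi>: "same_reduction X Z us vs \<psi>"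
  note p = same_reductionD[OF \<phi>] and q = same_reductionD[OF \<psi>]
  have "reduction vs A \<bullet> \<psi> A \<bullet> \<phi> A = reduction ts A" if A: "shape A" "base A = X" for A
  proof -
    have "reduction vs A \<bullet> \<psi> A \<bullet> \<phi> A = (reduction vs A \<bullet> \<psi> A) \<bullet> \<phi> A"
      using reduction_arr[OF q(2) A] between_arr[OF p(3) A] between_arr[OF q(3) A] by simp
    then show ?thesis using p(5)[OF A] q(5)[OF A] by simp
  qed
  moreover have "between X ts vs (\<lambda>A. \<psi> A \<bullet> \<phi> A)"
    using p(3) q(3) by (auto simp: between_def)
  ultimately show "same_reduction X Z ts vs (\<lambda>A. \<psi> A \<bullet> \<phi> A)"
    using p q by (simp add: same_reduction_def)
next
  fix X Z ts us \<phi> \<psi>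
  assume \<phi>: "same_reduction X Z ts us \<phi>" and \<psi>: "between X us ts \<psi>"
    and inv: "\<And>A. shape A \<Longrightarrow> base A = X \<Longrightarrow> \<phi> A \<bullet> \<psi> A = ide (wordO us A)"
  note p = same_reductionD[OF \<phi>]
  have "reduction ts A \<bullet> \<psi> A = reduction us A" if A: "shape A" "base A = X" for A
  proof -
    have "reduction ts A \<bullet> \<psi> A = reduction us A \<bullet> \<phi> A \<bullet> \<psi> A"
      unfolding p(5)[OF A, symmetric]
      using reduction_arr[OF p(2) A] between_arr[OF p(3) A] between_arr[OF \<psi> A] by simp
    then show ?thesis
      using reduction_arr[OF p(2) A] inv[OF A] by simp
  qed
  then show "same_reduction X Z us ts \<psi>"
    using p \<psi> by (simp add: same_reduction_def)
next
  fix X Z ts us \<phi> b assume \<phi>: "same_reduction X Z ts us \<phi>" and b: "letter b" "letter_src b = Z"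
  note p = same_reductionD[OF \<phi>]
  have ts: "typed ts X (letter_src b)" and us: "typed us X (letter_src b)"
    using p b by simp_all
  note n = normal_form_normal[OF ts]
  have "reduction (b # us) A \<bullet> letterA b (\<phi> A) = reduction (b # ts) A" if A: "shape A" "base A = X" for A
  proof -
    note r = reduction_arr[OF us A] and f = between_arr[OF p(3) A]
      and a = act_arr_arr[OF conjunct1[OF n] conjunct2[OF n] b(1) A]
    have ob: "base (wordO us A) = letter_src b" "base (wordO ts A) = letter_src b"
      using word_obj[OF us A] word_obj[OF ts A] by simp_all
    have "reduction (b # us) A \<bullet> letterA b (\<phi> A) =
        act_arr b (normal_form ts) A \<bullet> letterA b (reduction us A \<bullet> \<phi> A)"
      using r f a ob b(1) p(4) by simp
    then show ?thesis
      using p(5)[OF A] by simp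
  qed
  moreover have "between X (b # ts) (b # us) (\<lambda>A. letterA b (\<phi> A))"
    unfolding between_def using b(1) between_arr[OF p(3)] word_obj[OF ts] by simp
  ultimately show "same_reduction X (letter_tgt b) (b # ts) (b # us) (\<lambda>A. letterA b (\<phi> A))"
    using ts us b(1) p(4) by (simp add: same_reduction_def)
qed

text \<open>Naturality of \<open>fuse\<close> replaces the word by its normal form, where \<open>act_arr_fuse\<close> applies.\<close>

lemma same_reduction_fuse:
  assumes bc: "letter b" "letter c" "same_kind b c" "letter_src b = letter_tgt c"
    and ts: "typed ts X (letter_src c)"
  shows "same_reduction X (letter_tgt b) (b # c # ts) (fuse_letters b c # ts) (\<lambda>A. fuse b c (wordO ts A))"
proof -
  note k = fuse_letters_letter[OF bc(3,1,2,4)]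
  have N: "normal (normal_form ts)" "typed (normal_form ts) X (letter_src c)"
    using normal_form_normal[OF ts] by auto
  have N': "normal (act c (normal_form ts))" "typed (act c (normal_form ts)) X (letter_src b)"
    using act_normal[OF N bc(2)] bc(4) by simp_all
  have Nf: "typed (normal_form ts) X (letter_src (fuse_letters b c))"
    using N(2) k(2) by simp
  have "reduction (fuse_letters b c # ts) A \<bullet> fuse b c (wordO ts A) = reduction (b # c # ts) A"
    if A: "shape A" "base A = X" for A
  proof -
    let ?N = "normal_form ts" and ?r = "reduction ts A"
    note r = reduction_arr[OF ts A]
    have ob: "shape (wordO ts A)" "base (wordO ts A) = letter_src c" "shape (wordO ?N A)"
      "base (wordO ?N A) = letter_src c"
      using word_obj[OF ts A] word_obj[OF N(2) A] by simp_all
    note a1 = act_arr_arr[OF N(1) Nf k(1) A] and a2 = act_arr_arr[OF N bc(2) A]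
      and a3 = act_arr_arr[OF N' bc(1) A]
    have "reduction (fuse_letters b c # ts) A \<bullet> fuse b c (wordO ts A) =
        act_arr (fuse_letters b c) ?N A \<bullet> letterA (fuse_letters b c) ?r \<bullet> fuse b c (wordO ts A)"
      using a1 r ob k bc by simp
    also have "letterA (fuse_letters b c) ?r \<bullet> fuse b c (wordO ts A) =
        fuse b c (wordO ?N A) \<bullet> letterA b (letterA c ?r)"
      using fuse_natural[OF bc(3,1,2,4) r(1)] r ob by simp
    also have "act_arr (fuse_letters b c) ?N A \<bullet> \<dots> =
        (act_arr (fuse_letters b c) ?N A \<bullet> fuse b c (wordO ?N A)) \<bullet> letterA b (letterA c ?r)"
      using a1 r ob k bc by simp
    also have "\<dots> = reduction (b # c # ts) A"
      unfolding act_arr_fuse[OF N bc A] using a2 a3 r ob bc by simp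
    finally show ?thesis .
  qed
  moreover have "between X (b # c # ts) (fuse_letters b c # ts) (\<lambda>A. fuse b c (wordO ts A))"
    unfolding between_def using bc word_obj[OF ts] by simp
  moreover have "normal_form (fuse_letters b c # ts) = normal_form (b # c # ts)"
    using act_fuse_letters[OF N bc] by simp
  ultimately show ?thesis
    using ts bc k by (simp add: same_reduction_def)
qed

lemma same_reduction_erase:
  assumes u: "letter u" "is_ident u" and ts: "typed ts X (letter_src u)"
  shows "same_reduction X (letter_src u) (u # ts) ts (\<lambda>A. erase u (wordO ts A))"
proof -
  have N: "normal (normal_form ts)" "typed (normal_form ts) X (letter_src u)"
    using normal_form_normal[OF ts] by auto
  have st: "letter_src u = letter_tgt u"
    using is_ident_src[OF u(2)] .
  have "reduction ts A \<bullet> erase u (wordO ts A) = reduction (u # ts) A" if A: "shape A" "base A = X" for A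
    using erase_natural[OF u(2,1), of "reduction ts A"] reduction_arr[OF ts A] word_obj[OF ts A]
      act_ident(2)[OF N u A] st by simp
  moreover have "between X (u # ts) ts (\<lambda>A. erase u (wordO ts A))"
    unfolding between_def using u st word_obj[OF ts] by simp
  ultimately show ?thesis
    using ts u(1) st act_ident(1)[OF N u] by (simp add: same_reduction_def)
qed

lemma comp_triv_same_reduction:
  assumes "(F, G, \<phi>) \<in> gen \<G> (comp_class \<G> \<union> triv_class \<G>)"
  shows "same_reduction (src F) (tgt F) (terms F) (terms G) \<phi>"
proof -
  interpret transformation_invariant \<G> same_reduction
    by (rule transformation_invariant_reduction)
  have "invariant (comp0 \<G>)"
    unfolding comp0_def
  proof (rule invariant_whiskerings)
    fix H K :: "('x, 'f) sgf" and \<phi> ts X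
    assume "(H, K, \<phi>) \<in> {(lower \<G> g \<odot> lower \<G> f, lower \<G> (g \<star> f), cL f g) | f g.
        f \<in> maps \<and> g \<in> maps \<and> scod f = sdom g} \<union>
      {(upper \<G> f \<odot> upper \<G> g, upper \<G> (g \<star> f), cU f g) | f g.
        f \<in> maps \<and> g \<in> maps \<and> scod f = sdom g}" and ts: "typed ts X (src H)"
    then consider f g where "H = lower \<G> g \<odot> lower \<G> f" "K = lower \<G> (g \<star> f)" "\<phi> = cL f g"
        "f \<in> maps" "g \<in> maps" "scod f = sdom g"
      | f g where "H = upper \<G> f \<odot> upper \<G> g" "K = upper \<G> (g \<star> f)" "\<phi> = cU f g"
        "f \<in> maps" "g \<in> maps" "scod f = sdom g" by auto
    then show "src K = src H \<and> tgt K = tgt H \<and>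
        same_reduction X (tgt H) (terms H @ ts) (terms K @ ts) (\<lambda>A. \<phi> (wordO ts A))"
    proof cases
      case (1 f g)
      then show ?thesis
        using same_reduction_fuse[of "Push g" "Push f" ts X] ts by (simp add: lower_def sgf_cmp_def)
    next
      case (2 f g)
      then show ?thesis
        using same_reduction_fuse[of "Pull f" "Pull g" ts X] ts by (simp add: upper_def sgf_cmp_def)
    qed
  qed
  moreover have "invariant (triv0 \<G>)"
    unfolding triv0_def
  proof (rule invariant_whiskerings)
    fix H K :: "('x, 'f) sgf" and \<phi> ts X
    assume "(H, K, \<phi>) \<in> {(lower \<G> (side Y), sgf_id Y, trivL \<G> Y) | Y. Y \<in> spaces} \<union>
      {(upper \<G> (side Y), sgf_id Y, trivU \<G> Y) | Y. Y \<in> spaces}" and ts: "typed ts X (src H)"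
    then consider Y where "H = lower \<G> (side Y)" "K = sgf_id Y" "\<phi> = trivL \<G> Y" "Y \<in> spaces"
      | Y where "H = upper \<G> (side Y)" "K = sgf_id Y" "\<phi> = trivU \<G> Y" "Y \<in> spaces" by auto
    then show "src K = src H \<and> tgt K = tgt H \<and>
        same_reduction X (tgt H) (terms H @ ts) (terms K @ ts) (\<lambda>A. \<phi> (wordO ts A))"
    proof cases
      case (1 Y)
      then show ?thesis
        using same_reduction_erase[of "Push (side Y)" ts X] ts
        by (auto simp: lower_def sgf_id_def is_ident_def)
    next
      case (2 Y)
      then show ?thesis
        using same_reduction_erase[of "Pull (side Y)" ts X] ts
        by (auto simp: upper_def sgf_id_def is_ident_def)
    qed
  qed
  ultimately have "invariant (gen \<G> (comp_class \<G> \<union> triv_class \<G>))"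
    by (simp add: comp_class_def triv_class_def invariant_gen invariant_inverses invariant_Un)
  then show ?thesis
    using assms by (auto simp: invariant_def)
qed

lemma same_reduction_unique:
  assumes \<phi>: "same_reduction X Z ts us \<phi>" and \<psi>: "same_reduction X Z ts us \<psi>"
  shows "nt_eq (Fib \<G> X) \<phi> \<psi>"
proof -
  have "\<phi> A = \<psi> A" if A: "shape A" "base A = X" for A
    using split_mono_cancel[of "reduction us A" "\<phi> A" "\<psi> A"]
      reduction_split_mono[OF same_reductionD(2)[OF \<phi>] A]
      between_arr[OF same_reductionD(3)[OF \<phi>] A] between_arr[OF same_reductionD(3)[OF \<psi>] A]
      same_reductionD(5)[OF \<phi> A] same_reductionD(5)[OF \<psi> A]
    by simp
  then show ?thesis by (simp add: nt_eq_def)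
qed

end

section \<open>Coherence\<close>

theorem theorem2p2:
  fixes \<G> :: "('s, 'a, 'x, 'f) geofib"
  assumes "geofibered \<G>"
  shows
    "(\<forall>F\<in>SGF \<G>. \<forall>G\<in>SGF \<G>. \<forall>\<phi> \<psi>.
        (F, G, \<phi>) \<in> gen \<G> (comp_class \<G> \<union> triv_class \<G>) \<and>
        (F, G, \<psi>) \<in> gen \<G> (comp_class \<G> \<union> triv_class \<G>) \<longrightarrow>
        nt_eq (Fib \<G> (src F)) \<phi> \<psi>) \<and>
     (\<forall>Q. determined_fibered_products (Sp \<G>) Q \<longrightarrow>
       (\<forall>a\<in>Arr (Sp \<G>). \<forall>b\<in>Arr (Sp \<G>). Dom (Sp \<G>) a = Dom (Sp \<G>) b \<longrightarrow>
         (\<forall>F\<in>SGF \<G>. \<forall>\<phi> \<psi>.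
            (F, lower \<G> a \<odot> upper \<G> b, \<phi>) \<in> SGNT0 \<G> Q \<and>
            (F, lower \<G> a \<odot> upper \<G> b, \<psi>) \<in> SGNT0 \<G> Q \<longrightarrow>
            nt_eq (Fib \<G> (src F)) \<phi> \<psi>))) \<and>
     (\<forall>a\<in>Arr (Sp \<G>). \<forall>b\<in>Arr (Sp \<G>). Dom (Sp \<G>) a = Dom (Sp \<G>) b \<longrightarrow>
       (\<forall>F\<in>SGF \<G>. \<forall>\<phi> \<psi>.
          (F, lower \<G> a \<odot> upper \<G> b, \<phi>) \<in> SGNT0 \<G> (cartesian (Sp \<G>)) \<and>
          (F, lower \<G> a \<odot> upper \<G> b, \<psi>) \<in> SGNT0 \<G> (cartesian (Sp \<G>)) \<longrightarrow>
          (\<exists>k. is_iso (Sp \<G>) k \<and> Dom (Sp \<G>) k = Dom (Sp \<G>) a \<and> Cod (Sp \<G>) k = Dom (Sp \<G>) a \<and>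
               a \<cdot>\<^bsub>Sp \<G>\<^esub> k = a \<and> b \<cdot>\<^bsub>Sp \<G>\<^esub> k = b \<and>
               nt_eq (Fib \<G> (src F)) \<psi> (\<lambda>A. change_fp \<G> a b k A \<cdot>\<^bsub>Sh \<G>\<^esub> \<phi> A))))"
proof -
  interpret geofibration \<G>
    by unfold_locales (rule assms)
  have pair: "transports Q (scod b) (tgt F) (terms F) [Push a, Pull b] \<phi>" "src F = scod b"
    if "(F, lower \<G> a \<odot> upper \<G> b, \<phi>) \<in> SGNT0 \<G> Q" for Q F a b \<phi>
  proof -
    have t: "transports Q (src F) (tgt F) (terms F) [Push a, Pull b] \<phi>"
      using SGNT0_transports[OF that] by (simp add: lower_def upper_def sgf_cmp_def)
    then have "typed [Push a, Pull b] (src F) (tgt F)"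
      unfolding transports_def by blast
    then show "src F = scod b"
      by simp
    then show "transports Q (scod b) (tgt F) (terms F) [Push a, Pull b] \<phi>"
      using t by simp
  qed
  show ?thesis
  proof (intro conjI ballI allI impI; elim conjE)
    fix F G \<phi> \<psi>
    assume "(F, G, \<phi>) \<in> gen \<G> (comp_class \<G> \<union> triv_class \<G>)"
      "(F, G, \<psi>) \<in> gen \<G> (comp_class \<G> \<union> triv_class \<G>)"
    then show "nt_eq (Fib \<G> (src F)) \<phi> \<psi>"
      by (intro same_reduction_unique[OF comp_triv_same_reduction comp_triv_same_reduction])
  next
    fix Q a b F \<phi> \<psi>
    assume Q: "determined_fibered_products (Sp \<G>) Q" and ab: "a \<in> maps" "b \<in> maps" "sdom a = sdom b"
      and *: "(F, lower \<G> a \<odot> upper \<G> b, \<phi>) \<in> SGNT0 \<G> Q"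
      "(F, lower \<G> a \<odot> upper \<G> b, \<psi>) \<in> SGNT0 \<G> Q"
    show "nt_eq (Fib \<G> (src F)) \<phi> \<psi>"
      unfolding nt_eq_def pair(2)[OF *(1)]
      using determined_unique_transport[OF ab Q pair(1)[OF *(1)] pair(1)[OF *(2)]] by simp
  next
    fix a b F \<phi> \<psi>
    assume ab: "a \<in> maps" "b \<in> maps" "sdom a = sdom b"
      and *: "(F, lower \<G> a \<odot> upper \<G> b, \<phi>) \<in> SGNT0 \<G> (cartesian (Sp \<G>))"
      "(F, lower \<G> a \<odot> upper \<G> b, \<psi>) \<in> SGNT0 \<G> (cartesian (Sp \<G>))"
    show "\<exists>k. is_iso (Sp \<G>) k \<and> sdom k = sdom a \<and> scod k = sdom a \<and> a \<star> k = a \<and> b \<star> k = b \<and>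
        nt_eq (Fib \<G> (src F)) \<psi> (\<lambda>A. change_fp \<G> a b k A \<bullet> \<phi> A)"
      unfolding pair(2)[OF *(1)]
      by (rule transports_differ_by_change_fp[OF ab pair(1)[OF *(1)] pair(1)[OF *(2)]])
  qed
qed

end
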